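(* Let $\mathbf{MonCat}_p$ be the $2$-category of small monoidal categories, strong monoidal functors and monoidal natural transformations, and let $\mathbf{SMonCat}_p \hookrightarrow \mathbf{MonCat}_p$ be its full sub-$2$-category of strict monoidal categories. Then idempotents do not split in $\mathbf{SMonCat}_p$; in particular $\mathbf{SMonCat}_p$ is not accessible. Moreover, the inclusion $\mathbf{SMonCat}_p \hookrightarrow \mathbf{MonCat}_p$ exhibits $\mathbf{MonCat}_p$ as the idempotent completion of $\mathbf{SMonCat}_p$.
   Context: An idempotent $e:A\to A$, $e\circ e=e$, splits if $e=s\circ r$ with $r\circ s=1$ (strict equalities of $1$-cells). A full inclusion $\mathcal{A}\to\mathcal{B}$ exhibits $\mathcal{B}$ as the idempotent completion of $\mathcal{A}$ if idempotents split in $\mathcal{B}$ and each object of $\mathcal{B}$ is a retract of an object of $\mathcal{A}$. Accessible means $\lambda$-accessible for some regular cardinal $\lambda$: a $2$-category $\mathcal{C}$ is $\lambda$-accessible if it has ($\mathbf{Cat}$-enriched conical) $\lambda$-filtered colimits and a set $\mathcal{G}$ of objects $X$ for which $\mathcal{C}(X,-):\mathcal{C}\to\mathbf{Cat}$ preserves $\lambda$-filtered colimits, such that each object of $\mathcal{C}$ is a $\lambda$-filtered colimit of objects of $\mathcal{G}$. *)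

theory Defs
  imports "HOL-Library.Countable_Set" "HOL-Library.FuncSet"
begin

unbundle cardinal_syntax

section \<open>Categories, functors, natural transformations\<close>

record ('o, 'a) cat =
  Obj :: "'o set"
  Arr :: "'a set"
  Dom :: "'a \<Rightarrow> 'o"
  Cod :: "'a \<Rightarrow> 'o"
  Idt :: "'o \<Rightarrow> 'a"
  Comp :: "'a \<Rightarrow> 'a \<Rightarrow> 'a" (infixl "\<cdot>\<index>" 60)

definition Hom :: "('o, 'a, 'x) cat_scheme \<Rightarrow> 'o \<Rightarrow> 'o \<Rightarrow> 'a set" where
  "Hom C x y = {f \<in> Arr C. Dom C f = x \<and> Cod C f = y}"

locale category =
  fixes C :: "('o, 'a, 'x) cat_scheme" (structure)
  assumes Dom_in: "f \<in> Arr C \<Longrightarrow> Dom C f \<in> Obj C"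
    and Cod_in: "f \<in> Arr C \<Longrightarrow> Cod C f \<in> Obj C"
    and Id_in: "x \<in> Obj C \<Longrightarrow> Idt C x \<in> Hom C x x"
    and Comp_in: "f \<in> Hom C x y \<Longrightarrow> g \<in> Hom C y z \<Longrightarrow> g \<cdot> f \<in> Hom C x z"
    and Comp_Id: "f \<in> Hom C x y \<Longrightarrow> f \<cdot> Idt C x = f"
    and Id_Comp: "f \<in> Hom C x y \<Longrightarrow> Idt C y \<cdot> f = f"
    and Comp_assoc: "f \<in> Hom C w x \<Longrightarrow> g \<in> Hom C x y \<Longrightarrow> h \<in> Hom C y z \<Longrightarrow>
      (h \<cdot> g) \<cdot> f = h \<cdot> (g \<cdot> f)"

definition iso_in :: "('o, 'a, 'x) cat_scheme \<Rightarrow> 'a \<Rightarrow> bool" where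
  "iso_in C f \<longleftrightarrow> f \<in> Arr C \<and>
    (\<exists>g \<in> Hom C (Cod C f) (Dom C f).
      Comp C g f = Idt C (Dom C f) \<and> Comp C f g = Idt C (Cod C f))"

definition is_functor ::
  "('o, 'a, 'x) cat_scheme \<Rightarrow> ('p, 'b, 'y) cat_scheme \<Rightarrow> ('o \<Rightarrow> 'p) \<Rightarrow> ('a \<Rightarrow> 'b) \<Rightarrow> bool" where
  "is_functor A B F0 F1 \<longleftrightarrow>
    (\<forall>x \<in> Obj A. F0 x \<in> Obj B \<and> F1 (Idt A x) = Idt B (F0 x)) \<and>
    (\<forall>f \<in> Arr A. F1 f \<in> Hom B (F0 (Dom A f)) (F0 (Cod A f))) \<and>
    (\<forall>f \<in> Arr A. \<forall>g \<in> Arr A. Dom A g = Cod A f \<longrightarrow>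
      F1 (Comp A g f) = Comp B (F1 g) (F1 f))"

definition is_nat_trans ::
  "('o, 'a, 'x) cat_scheme \<Rightarrow> ('p, 'b, 'y) cat_scheme \<Rightarrow> ('o \<Rightarrow> 'p) \<Rightarrow> ('a \<Rightarrow> 'b) \<Rightarrow>
    ('o \<Rightarrow> 'p) \<Rightarrow> ('a \<Rightarrow> 'b) \<Rightarrow> ('o \<Rightarrow> 'b) \<Rightarrow> bool" where
  "is_nat_trans A B F0 F1 G0 G1 \<tau> \<longleftrightarrow>
    (\<forall>x \<in> Obj A. \<tau> x \<in> Hom B (F0 x) (G0 x)) \<and>
    (\<forall>f \<in> Arr A. Comp B (G1 f) (\<tau> (Dom A f)) = Comp B (\<tau> (Cod A f)) (F1 f))"

text \<open>
  Smallness is measured by a type \<open>'u\<close>: a set is small if it has fewer elements than \<open>'u\<close>.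
  If the cardinality of \<open>'u\<close> is strongly inaccessible, the small subsets of \<open>'u\<close> and the
  functions between them form a category equivalent to the category of sets of a Grothendieck
  universe. Everything below makes sense for any \<open>'u\<close>, so no such assumption is built in.
\<close>

definition small_set :: "'u itself \<Rightarrow> 'b set \<Rightarrow> bool" where
  "small_set U S \<longleftrightarrow> |S| <o |UNIV :: 'u set|"

definition small_category :: "('u, 'u, 'x) cat_scheme \<Rightarrow> bool" where
  "small_category C \<longleftrightarrow>
    category C \<and> small_set TYPE('u) (Obj C) \<and> small_set TYPE('u) (Arr C)"


section \<open>2-categories\<close>

text \<open>
  \<open>cmp\<close> is composition of 1-cells, \<open>vcmp\<close> and \<open>hcmp\<close> are vertical and horizontal composition
  of 2-cells, all in applicative order; \<open>cdom\<close> and \<open>ccod\<close> are the source and the target 1-cell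
  of a 2-cell.
\<close>

record ('o, 'm, 'c) twocat =
  Obj0 :: "'o set"
  Mor :: "'m set"
  Cell :: "'c set"
  src :: "'m \<Rightarrow> 'o"
  trg :: "'m \<Rightarrow> 'o"
  one :: "'o \<Rightarrow> 'm"
  cmp :: "'m \<Rightarrow> 'm \<Rightarrow> 'm"
  cdom :: "'c \<Rightarrow> 'm"
  ccod :: "'c \<Rightarrow> 'm"
  cid :: "'m \<Rightarrow> 'c"
  vcmp :: "'c \<Rightarrow> 'c \<Rightarrow> 'c"
  hcmp :: "'c \<Rightarrow> 'c \<Rightarrow> 'c"

definition underlying :: "('o, 'm, 'c) twocat \<Rightarrow> ('o, 'm) cat" where
  "underlying C =
    \<lparr>Obj = Obj0 C, Arr = Mor C, Dom = src C, Cod = trg C, Idt = one C, Comp = cmp C\<rparr>"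

definition mor :: "('o, 'm, 'c) twocat \<Rightarrow> 'o \<Rightarrow> 'o \<Rightarrow> 'm set" where
  "mor C X Y = {f \<in> Mor C. src C f = X \<and> trg C f = Y}"

definition hom :: "('o, 'm, 'c) twocat \<Rightarrow> 'o \<Rightarrow> 'o \<Rightarrow> ('m, 'c) cat" where
  "hom C X Y =
    \<lparr>Obj = mor C X Y, Arr = {\<alpha> \<in> Cell C. cdom C \<alpha> \<in> mor C X Y \<and> ccod C \<alpha> \<in> mor C X Y},
     Dom = cdom C, Cod = ccod C, Idt = cid C, Comp = vcmp C\<rparr>"

locale two_category =
  fixes C :: "('o, 'm, 'c) twocat"
  assumes category_underlying: "category (underlying C)"
    and category_hom: "X \<in> Obj0 C \<Longrightarrow> Y \<in> Obj0 C \<Longrightarrow> category (hom C X Y)"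
    and Cell_hom: "\<alpha> \<in> Cell C \<Longrightarrow> \<exists>X \<in> Obj0 C. \<exists>Y \<in> Obj0 C. \<alpha> \<in> Arr (hom C X Y)"
    and hcmp_in:
      "\<alpha> \<in> Arr (hom C X Y) \<Longrightarrow> \<beta> \<in> Arr (hom C Y Z) \<Longrightarrow>
        hcmp C \<beta> \<alpha> \<in> Hom (hom C X Z)
          (cmp C (cdom C \<beta>) (cdom C \<alpha>)) (cmp C (ccod C \<beta>) (ccod C \<alpha>))"
    and hcmp_cid:
      "f \<in> mor C X Y \<Longrightarrow> g \<in> mor C Y Z \<Longrightarrow> hcmp C (cid C g) (cid C f) = cid C (cmp C g f)"
    and interchange:
      "\<alpha> \<in> Hom (hom C X Y) f f' \<Longrightarrow> \<alpha>' \<in> Hom (hom C X Y) f' f'' \<Longrightarrow>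
        \<beta> \<in> Hom (hom C Y Z) g g' \<Longrightarrow> \<beta>' \<in> Hom (hom C Y Z) g' g'' \<Longrightarrow>
        hcmp C (vcmp C \<beta>' \<beta>) (vcmp C \<alpha>' \<alpha>) = vcmp C (hcmp C \<beta>' \<alpha>') (hcmp C \<beta> \<alpha>)"
    and hcmp_one: "\<alpha> \<in> Arr (hom C X Y) \<Longrightarrow> hcmp C \<alpha> (cid C (one C X)) = \<alpha>"
    and one_hcmp: "\<alpha> \<in> Arr (hom C X Y) \<Longrightarrow> hcmp C (cid C (one C Y)) \<alpha> = \<alpha>"
    and hcmp_assoc:
      "\<alpha> \<in> Arr (hom C W X) \<Longrightarrow> \<beta> \<in> Arr (hom C X Y) \<Longrightarrow> \<gamma> \<in> Arr (hom C Y Z) \<Longrightarrow>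
        hcmp C (hcmp C \<gamma> \<beta>) \<alpha> = hcmp C \<gamma> (hcmp C \<beta> \<alpha>)"

definition full_sub :: "('o, 'm, 'c) twocat \<Rightarrow> 'o set \<Rightarrow> ('o, 'm, 'c) twocat" where
  "full_sub C S = C
    \<lparr>Obj0 := Obj0 C \<inter> S,
     Mor := {f \<in> Mor C. src C f \<in> S \<and> trg C f \<in> S},
     Cell := {\<alpha> \<in> Cell C. src C (cdom C \<alpha>) \<in> S \<and> trg C (cdom C \<alpha>) \<in> S}\<rparr>"


section \<open>Idempotents\<close>

definition idempotents_split :: "('o, 'm, 'c) twocat \<Rightarrow> bool" where
  "idempotents_split C \<longleftrightarrow>
    (\<forall>A \<in> Obj0 C. \<forall>e \<in> mor C A A. cmp C e e = e \<longrightarrow>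
      (\<exists>B \<in> Obj0 C. \<exists>r \<in> mor C A B. \<exists>s \<in> mor C B A. e = cmp C s r \<and> cmp C r s = one C B))"

definition is_retract_of :: "('o, 'm, 'c) twocat \<Rightarrow> 'o \<Rightarrow> 'o \<Rightarrow> bool" where
  "is_retract_of C X A \<longleftrightarrow> (\<exists>s \<in> mor C X A. \<exists>r \<in> mor C A X. cmp C r s = one C X)"

definition exhibits_idempotent_completion ::
  "('o, 'm, 'c) twocat \<Rightarrow> ('o, 'm, 'c) twocat \<Rightarrow> bool" where
  "exhibits_idempotent_completion A B \<longleftrightarrow>
    Obj0 A \<subseteq> Obj0 B \<and> A = full_sub B (Obj0 A) \<and>
    idempotents_split B \<and> (\<forall>X \<in> Obj0 B. \<exists>Y \<in> Obj0 A. is_retract_of B X Y)"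


section \<open>Filtered colimits and accessibility\<close>

text \<open>
  \<open>X\<close> and \<open>act\<close> give a contravariant diagram of sets on \<open>J\<close>; \<open>is_limit\<close> says that the
  canonical map from \<open>L\<close> to the limit of that diagram is a bijection.
\<close>

definition matching_families ::
  "('j, 'i) cat \<Rightarrow> ('j \<Rightarrow> 'x set) \<Rightarrow> ('i \<Rightarrow> 'x \<Rightarrow> 'x) \<Rightarrow> ('j \<Rightarrow> 'x) set" where
  "matching_families J X act =
    {\<xi> \<in> Pi\<^sub>E (Obj J) X. \<forall>u \<in> Arr J. act u (\<xi> (Cod J u)) = \<xi> (Dom J u)}"

definition is_limit ::
  "('j, 'i) cat \<Rightarrow> ('j \<Rightarrow> 'x set) \<Rightarrow> ('i \<Rightarrow> 'x \<Rightarrow> 'x) \<Rightarrow> 'l set \<Rightarrow> ('j \<Rightarrow> 'l \<Rightarrow> 'x) \<Rightarrow> bool" where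
  "is_limit J X act L p \<longleftrightarrow>
    bij_betw (\<lambda>x. \<lambda>j \<in> Obj J. p j x) L (matching_families J X act)"

text \<open>
  Conical colimit, enriched over \<open>Cat\<close>, of a functor \<open>(D0, D1)\<close> from \<open>J\<close> to the underlying
  category of \<open>C\<close>: the comparison functor from \<open>hom C L Y\<close> to the limit in \<open>Cat\<close> of the
  \<open>hom C (D0 j) Y\<close> is an isomorphism of categories, that is, bijective on 1-cells and on
  2-cells of \<open>C\<close>.
\<close>

definition is_colimit ::
  "('o, 'm, 'c) twocat \<Rightarrow> ('j, 'i) cat \<Rightarrow> ('j \<Rightarrow> 'o) \<Rightarrow> ('i \<Rightarrow> 'm) \<Rightarrow> 'o \<Rightarrow> ('j \<Rightarrow> 'm) \<Rightarrow> bool" where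
  "is_colimit C J D0 D1 L p \<longleftrightarrow>
    L \<in> Obj0 C \<and> (\<forall>j \<in> Obj J. p j \<in> mor C (D0 j) L) \<and>
    (\<forall>u \<in> Arr J. cmp C (p (Cod J u)) (D1 u) = p (Dom J u)) \<and>
    (\<forall>Y \<in> Obj0 C.
      is_limit J (\<lambda>j. Obj (hom C (D0 j) Y)) (\<lambda>u h. cmp C h (D1 u))
        (Obj (hom C L Y)) (\<lambda>j h. cmp C h (p j)) \<and>
      is_limit J (\<lambda>j. Arr (hom C (D0 j) Y)) (\<lambda>u \<alpha>. hcmp C \<alpha> (cid C (D1 u)))
        (Arr (hom C L Y)) (\<lambda>j \<alpha>. hcmp C \<alpha> (cid C (p j))))"

type_synonym ('o, 'a, 'p, 'b) ftor = "('o \<Rightarrow> 'p) \<times> ('a \<Rightarrow> 'b)"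

definition functors ::
  "('o, 'a) cat \<Rightarrow> ('p, 'b) cat \<Rightarrow> ('o, 'a, 'p, 'b) ftor set" where
  "functors A T = {(F0, F1). is_functor A T F0 F1 \<and>
    F0 \<in> extensional (Obj A) \<and> F1 \<in> extensional (Arr A)}"

definition nat_transes ::
  "('o, 'a) cat \<Rightarrow> ('p, 'b) cat \<Rightarrow>
    (('o, 'a, 'p, 'b) ftor \<times> ('o \<Rightarrow> 'b) \<times> ('o, 'a, 'p, 'b) ftor) set" where
  "nat_transes A T = {(F, \<tau>, G). F \<in> functors A T \<and> G \<in> functors A T \<and>
    is_nat_trans A T (fst F) (snd F) (fst G) (snd G) \<tau> \<and> \<tau> \<in> extensional (Obj A)}"

definition precomp ::
  "('n, 'e) cat \<Rightarrow> ('n, 'e, 'o, 'a) ftor \<Rightarrow> ('o, 'a, 'p, 'b) ftor \<Rightarrow> ('n, 'e, 'p, 'b) ftor" where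
  "precomp A P F = (compose (Obj A) (fst F) (fst P), compose (Arr A) (snd F) (snd P))"

definition prewhisker ::
  "('n, 'e) cat \<Rightarrow> ('n, 'e, 'o, 'a) ftor \<Rightarrow>
    ('o, 'a, 'p, 'b) ftor \<times> ('o \<Rightarrow> 'b) \<times> ('o, 'a, 'p, 'b) ftor \<Rightarrow>
    ('n, 'e, 'p, 'b) ftor \<times> ('n \<Rightarrow> 'b) \<times> ('n, 'e, 'p, 'b) ftor" where
  "prewhisker A P = (\<lambda>(F, \<tau>, G). (precomp A P F, compose (Obj A) \<tau> (fst P), precomp A P G))"

text \<open>
  The same universal property in the 2-category \<open>Cat\<close> of small categories, functors and
  natural transformations, for a cocone of categories that need not live on \<open>'u\<close> (below they
  are hom categories). Every small category is isomorphic to one on \<open>'u\<close>, so these suffice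
  as test objects.
\<close>

definition is_colimit_in_Cat ::
  "('u, 'u) cat \<Rightarrow> ('u \<Rightarrow> ('o, 'a) cat) \<Rightarrow> ('u \<Rightarrow> ('o, 'a, 'o, 'a) ftor) \<Rightarrow>
    ('o, 'a) cat \<Rightarrow> ('u \<Rightarrow> ('o, 'a, 'o, 'a) ftor) \<Rightarrow> bool" where
  "is_colimit_in_Cat J D0 D1 L p \<longleftrightarrow>
    (\<forall>j \<in> Obj J. is_functor (D0 j) L (fst (p j)) (snd (p j))) \<and>
    (\<forall>u \<in> Arr J. precomp (D0 (Dom J u)) (D1 u) (p (Cod J u)) =
      precomp (D0 (Dom J u)) (id, id) (p (Dom J u))) \<and>
    (\<forall>T :: ('u, 'u) cat. small_category T \<longrightarrow>
      is_limit J (\<lambda>j. functors (D0 j) T) (\<lambda>u. precomp (D0 (Dom J u)) (D1 u))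
        (functors L T) (\<lambda>j. precomp (D0 j) (p j)) \<and>
      is_limit J (\<lambda>j. nat_transes (D0 j) T) (\<lambda>u. prewhisker (D0 (Dom J u)) (D1 u))
        (nat_transes L T) (\<lambda>j. prewhisker (D0 j) (p j)))"

definition postcomp :: "('o, 'm, 'c) twocat \<Rightarrow> 'm \<Rightarrow> ('m, 'c, 'm, 'c) ftor" where
  "postcomp C f = (cmp C f, hcmp C (cid C f))"

definition regular_cardinal :: "'u rel \<Rightarrow> bool" where
  "regular_cardinal \<kappa> \<longleftrightarrow> Card_order \<kappa> \<and> infinite (Field \<kappa>) \<and> regularCard \<kappa>"

definition small_filtered_category :: "'u rel \<Rightarrow> ('u, 'u) cat \<Rightarrow> bool" where
  "small_filtered_category \<kappa> J \<longleftrightarrow> small_category J \<and>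
    (\<forall>K :: ('u, 'u) cat. \<forall>F0 F1. category K \<and> |Arr K| <o \<kappa> \<and> is_functor K J F0 F1 \<longrightarrow>
      (\<exists>j \<in> Obj J. \<exists>q. (\<forall>k \<in> Obj K. q k \<in> Hom J (F0 k) j) \<and>
        (\<forall>u \<in> Arr K. Comp J (q (Cod K u)) (F1 u) = q (Dom K u))))"

definition has_filtered_colimits :: "'u rel \<Rightarrow> ('o, 'm, 'c) twocat \<Rightarrow> bool" where
  "has_filtered_colimits \<kappa> C \<longleftrightarrow>
    (\<forall>J D0 D1. small_filtered_category \<kappa> J \<and> is_functor J (underlying C) D0 D1 \<longrightarrow>
      (\<exists>L p. is_colimit C J D0 D1 L p))"

definition presentable :: "'u rel \<Rightarrow> ('o, 'm, 'c) twocat \<Rightarrow> 'o \<Rightarrow> bool" where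
  "presentable \<kappa> C X \<longleftrightarrow>
    (\<forall>J D0 D1 L p. small_filtered_category \<kappa> J \<and> is_functor J (underlying C) D0 D1 \<and>
      is_colimit C J D0 D1 L p \<longrightarrow>
      is_colimit_in_Cat J (\<lambda>j. hom C X (D0 j)) (\<lambda>u. postcomp C (D1 u))
        (hom C X L) (\<lambda>j. postcomp C (p j)))"

definition lambda_accessible :: "'u rel \<Rightarrow> ('o, 'm, 'c) twocat \<Rightarrow> bool" where
  "lambda_accessible \<kappa> C \<longleftrightarrow> has_filtered_colimits \<kappa> C \<and>
    (\<exists>G \<subseteq> Obj0 C. small_set TYPE('u) G \<and> (\<forall>X \<in> G. presentable \<kappa> C X) \<and>
      (\<forall>Y \<in> Obj0 C. \<exists>J D0 D1 p. small_filtered_category \<kappa> J \<and> is_functor J (underlying C) D0 D1 \<and>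
        (\<forall>j \<in> Obj J. D0 j \<in> G) \<and> is_colimit C J D0 D1 Y p))"

text \<open>
  Every small cardinal is the order type of a cardinal order on a subset of \<open>'u\<close>. No local
  smallness is imposed on \<open>C\<close>, so that non-accessibility never results from a lack of it.
\<close>

definition accessible :: "'u itself \<Rightarrow> ('o, 'm, 'c) twocat \<Rightarrow> bool" where
  "accessible U C \<longleftrightarrow>
    (\<exists>\<kappa> :: 'u rel. regular_cardinal \<kappa> \<and> \<kappa> <o |UNIV :: 'u set| \<and> lambda_accessible \<kappa> C)"


section \<open>Monoidal categories\<close>

record ('o, 'a) moncat = "('o, 'a) cat" +
  Tens :: "'o \<Rightarrow> 'o \<Rightarrow> 'o" (infixl "\<otimes>\<index>" 70)
  TensA :: "'a \<Rightarrow> 'a \<Rightarrow> 'a" (infixl "\<boxtimes>\<index>" 70)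
  Unit :: "'o" ("\<one>\<index>")
  Assoc :: "'o \<Rightarrow> 'o \<Rightarrow> 'o \<Rightarrow> 'a"
  LUnit :: "'o \<Rightarrow> 'a"
  RUnit :: "'o \<Rightarrow> 'a"

locale monoidal_category = category C for C :: "('o, 'a, 'x) moncat_scheme" (structure) +
  assumes Tens_in: "x \<in> Obj C \<Longrightarrow> y \<in> Obj C \<Longrightarrow> x \<otimes> y \<in> Obj C"
    and TensA_in: "f \<in> Hom C x x' \<Longrightarrow> g \<in> Hom C y y' \<Longrightarrow> f \<boxtimes> g \<in> Hom C (x \<otimes> y) (x' \<otimes> y')"
    and TensA_Id: "x \<in> Obj C \<Longrightarrow> y \<in> Obj C \<Longrightarrow> Idt C x \<boxtimes> Idt C y = Idt C (x \<otimes> y)"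
    and TensA_Comp:
      "f \<in> Hom C x x' \<Longrightarrow> f' \<in> Hom C x' x'' \<Longrightarrow> g \<in> Hom C y y' \<Longrightarrow> g' \<in> Hom C y' y'' \<Longrightarrow>
        (f' \<cdot> f) \<boxtimes> (g' \<cdot> g) = (f' \<boxtimes> g') \<cdot> (f \<boxtimes> g)"
    and Unit_in: "\<one> \<in> Obj C"
    and Assoc_in:
      "x \<in> Obj C \<Longrightarrow> y \<in> Obj C \<Longrightarrow> z \<in> Obj C \<Longrightarrow>
        Assoc C x y z \<in> Hom C ((x \<otimes> y) \<otimes> z) (x \<otimes> (y \<otimes> z))"
    and Assoc_iso:
      "x \<in> Obj C \<Longrightarrow> y \<in> Obj C \<Longrightarrow> z \<in> Obj C \<Longrightarrow> iso_in C (Assoc C x y z)"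
    and Assoc_nat:
      "f \<in> Hom C x x' \<Longrightarrow> g \<in> Hom C y y' \<Longrightarrow> h \<in> Hom C z z' \<Longrightarrow>
        Assoc C x' y' z' \<cdot> ((f \<boxtimes> g) \<boxtimes> h) = (f \<boxtimes> (g \<boxtimes> h)) \<cdot> Assoc C x y z"
    and LUnit_in: "x \<in> Obj C \<Longrightarrow> LUnit C x \<in> Hom C (\<one> \<otimes> x) x"
    and LUnit_iso: "x \<in> Obj C \<Longrightarrow> iso_in C (LUnit C x)"
    and LUnit_nat: "f \<in> Hom C x y \<Longrightarrow> LUnit C y \<cdot> (Idt C \<one> \<boxtimes> f) = f \<cdot> LUnit C x"
    and RUnit_in: "x \<in> Obj C \<Longrightarrow> RUnit C x \<in> Hom C (x \<otimes> \<one>) x"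
    and RUnit_iso: "x \<in> Obj C \<Longrightarrow> iso_in C (RUnit C x)"
    and RUnit_nat: "f \<in> Hom C x y \<Longrightarrow> RUnit C y \<cdot> (f \<boxtimes> Idt C \<one>) = f \<cdot> RUnit C x"
    and pentagon:
      "w \<in> Obj C \<Longrightarrow> x \<in> Obj C \<Longrightarrow> y \<in> Obj C \<Longrightarrow> z \<in> Obj C \<Longrightarrow>
        Assoc C w x (y \<otimes> z) \<cdot> Assoc C (w \<otimes> x) y z =
        (Idt C w \<boxtimes> Assoc C x y z) \<cdot> Assoc C w (x \<otimes> y) z \<cdot> (Assoc C w x y \<boxtimes> Idt C z)"
    and triangle:
      "x \<in> Obj C \<Longrightarrow> y \<in> Obj C \<Longrightarrow>
        (Idt C x \<boxtimes> LUnit C y) \<cdot> Assoc C x \<one> y = RUnit C x \<boxtimes> Idt C y"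

definition strict_monoidal :: "('o, 'a, 'x) moncat_scheme \<Rightarrow> bool" where
  "strict_monoidal C \<longleftrightarrow> monoidal_category C \<and>
    (\<forall>x \<in> Obj C. \<forall>y \<in> Obj C. \<forall>z \<in> Obj C. (x \<otimes>\<^bsub>C\<^esub> y) \<otimes>\<^bsub>C\<^esub> z = x \<otimes>\<^bsub>C\<^esub> (y \<otimes>\<^bsub>C\<^esub> z) \<and>
      Assoc C x y z = Idt C (x \<otimes>\<^bsub>C\<^esub> (y \<otimes>\<^bsub>C\<^esub> z))) \<and>
    (\<forall>x \<in> Obj C. \<one>\<^bsub>C\<^esub> \<otimes>\<^bsub>C\<^esub> x = x \<and> LUnit C x = Idt C x \<and>
      x \<otimes>\<^bsub>C\<^esub> \<one>\<^bsub>C\<^esub> = x \<and> RUnit C x = Idt C x)"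

text \<open>
  All operations are \<open>undefined\<close> outside their domain, so that equality of records is equality
  of monoidal categories; likewise for functors and transformations below.
\<close>

definition extensional_moncat :: "('o, 'a) moncat \<Rightarrow> bool" where
  "extensional_moncat C \<longleftrightarrow>
    Dom C \<in> extensional (Arr C) \<and> Cod C \<in> extensional (Arr C) \<and> Idt C \<in> extensional (Obj C) \<and>
    (\<forall>g f. \<not> (f \<in> Arr C \<and> g \<in> Arr C \<and> Dom C g = Cod C f) \<longrightarrow> Comp C g f = undefined) \<and>
    (\<forall>x y. \<not> (x \<in> Obj C \<and> y \<in> Obj C) \<longrightarrow> Tens C x y = undefined) \<and>
    (\<forall>f g. \<not> (f \<in> Arr C \<and> g \<in> Arr C) \<longrightarrow> TensA C f g = undefined) \<and>
    (\<forall>x y z. \<not> (x \<in> Obj C \<and> y \<in> Obj C \<and> z \<in> Obj C) \<longrightarrow> Assoc C x y z = undefined) \<and>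
    LUnit C \<in> extensional (Obj C) \<and> RUnit C \<in> extensional (Obj C)"

definition small_moncats :: "('u, 'u) moncat set" where
  "small_moncats = {C. monoidal_category C \<and> small_category C \<and> extensional_moncat C}"

text \<open>\<open>fmult\<close> and \<open>funit\<close> are the structure maps \<open>F x \<otimes> F y \<rightarrow> F (x \<otimes> y)\<close> and \<open>\<one> \<rightarrow> F \<one>\<close>.\<close>

record 'u mftor =
  fdom :: "('u, 'u) moncat"
  fcod :: "('u, 'u) moncat"
  fobj :: "'u \<Rightarrow> 'u"
  farr :: "'u \<Rightarrow> 'u"
  fmult :: "'u \<Rightarrow> 'u \<Rightarrow> 'u"
  funit :: "'u"

locale strong_monoidal_functor = A: monoidal_category A + B: monoidal_category B
  for A B :: "('u, 'u) moncat" +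
  fixes F :: "'u mftor"
  assumes fdom: "fdom F = A" and fcod: "fcod F = B"
    and is_functor: "is_functor A B (fobj F) (farr F)"
    and fmult_in: "x \<in> Obj A \<Longrightarrow> y \<in> Obj A \<Longrightarrow>
      fmult F x y \<in> Hom B (fobj F x \<otimes>\<^bsub>B\<^esub> fobj F y) (fobj F (x \<otimes>\<^bsub>A\<^esub> y))"
    and fmult_iso: "x \<in> Obj A \<Longrightarrow> y \<in> Obj A \<Longrightarrow> iso_in B (fmult F x y)"
    and fmult_nat: "f \<in> Hom A x x' \<Longrightarrow> g \<in> Hom A y y' \<Longrightarrow>
      fmult F x' y' \<cdot>\<^bsub>B\<^esub> (farr F f \<boxtimes>\<^bsub>B\<^esub> farr F g) = farr F (f \<boxtimes>\<^bsub>A\<^esub> g) \<cdot>\<^bsub>B\<^esub> fmult F x y"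
    and funit_in: "funit F \<in> Hom B \<one>\<^bsub>B\<^esub> (fobj F \<one>\<^bsub>A\<^esub>)"
    and funit_iso: "iso_in B (funit F)"
    and fmult_assoc: "x \<in> Obj A \<Longrightarrow> y \<in> Obj A \<Longrightarrow> z \<in> Obj A \<Longrightarrow>
      farr F (Assoc A x y z) \<cdot>\<^bsub>B\<^esub> fmult F (x \<otimes>\<^bsub>A\<^esub> y) z \<cdot>\<^bsub>B\<^esub> (fmult F x y \<boxtimes>\<^bsub>B\<^esub> Idt B (fobj F z)) =
      fmult F x (y \<otimes>\<^bsub>A\<^esub> z) \<cdot>\<^bsub>B\<^esub> (Idt B (fobj F x) \<boxtimes>\<^bsub>B\<^esub> fmult F y z)
        \<cdot>\<^bsub>B\<^esub> Assoc B (fobj F x) (fobj F y) (fobj F z)"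
    and fmult_LUnit: "x \<in> Obj A \<Longrightarrow>
      farr F (LUnit A x) \<cdot>\<^bsub>B\<^esub> fmult F \<one>\<^bsub>A\<^esub> x \<cdot>\<^bsub>B\<^esub> (funit F \<boxtimes>\<^bsub>B\<^esub> Idt B (fobj F x)) =
      LUnit B (fobj F x)"
    and fmult_RUnit: "x \<in> Obj A \<Longrightarrow>
      farr F (RUnit A x) \<cdot>\<^bsub>B\<^esub> fmult F x \<one>\<^bsub>A\<^esub> \<cdot>\<^bsub>B\<^esub> (Idt B (fobj F x) \<boxtimes>\<^bsub>B\<^esub> funit F) =
      RUnit B (fobj F x)"

definition extensional_mftor :: "'u mftor \<Rightarrow> bool" where
  "extensional_mftor F \<longleftrightarrow>
    fobj F \<in> extensional (Obj (fdom F)) \<and> farr F \<in> extensional (Arr (fdom F)) \<and>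
    (\<forall>x y. \<not> (x \<in> Obj (fdom F) \<and> y \<in> Obj (fdom F)) \<longrightarrow> fmult F x y = undefined)"

definition mftors :: "'u mftor set" where
  "mftors = {F. fdom F \<in> small_moncats \<and> fcod F \<in> small_moncats \<and>
    strong_monoidal_functor (fdom F) (fcod F) F \<and> extensional_mftor F}"

definition mftor_id :: "('u, 'u) moncat \<Rightarrow> 'u mftor" where
  "mftor_id A =
    \<lparr>fdom = A, fcod = A, fobj = (\<lambda>x \<in> Obj A. x), farr = (\<lambda>f \<in> Arr A. f),
     fmult = (\<lambda>x y. if x \<in> Obj A \<and> y \<in> Obj A then Idt A (x \<otimes>\<^bsub>A\<^esub> y) else undefined),
     funit = Idt A \<one>\<^bsub>A\<^esub>\<rparr>"

definition mftor_comp :: "'u mftor \<Rightarrow> 'u mftor \<Rightarrow> 'u mftor" where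
  "mftor_comp G F =
    \<lparr>fdom = fdom F, fcod = fcod G,
     fobj = compose (Obj (fdom F)) (fobj G) (fobj F),
     farr = compose (Arr (fdom F)) (farr G) (farr F),
     fmult = (\<lambda>x y. if x \<in> Obj (fdom F) \<and> y \<in> Obj (fdom F)
       then farr G (fmult F x y) \<cdot>\<^bsub>fcod G\<^esub> fmult G (fobj F x) (fobj F y) else undefined),
     funit = farr G (funit F) \<cdot>\<^bsub>fcod G\<^esub> funit G\<rparr>"

record 'u mntr =
  tdom :: "'u mftor"
  tcod :: "'u mftor"
  tmap :: "'u \<Rightarrow> 'u"

locale monoidal_transformation =
  F: strong_monoidal_functor A B F + G: strong_monoidal_functor A B G
  for A B :: "('u, 'u) moncat" and F G +
  fixes \<tau> :: "'u mntr"
  assumes tdom: "tdom \<tau> = F" and tcod: "tcod \<tau> = G"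
    and is_nat_trans: "is_nat_trans A B (fobj F) (farr F) (fobj G) (farr G) (tmap \<tau>)"
    and tmap_mult: "x \<in> Obj A \<Longrightarrow> y \<in> Obj A \<Longrightarrow>
      tmap \<tau> (x \<otimes>\<^bsub>A\<^esub> y) \<cdot>\<^bsub>B\<^esub> fmult F x y = fmult G x y \<cdot>\<^bsub>B\<^esub> (tmap \<tau> x \<boxtimes>\<^bsub>B\<^esub> tmap \<tau> y)"
    and tmap_unit: "tmap \<tau> \<one>\<^bsub>A\<^esub> \<cdot>\<^bsub>B\<^esub> funit F = funit G"

definition mntrs :: "'u mntr set" where
  "mntrs = {\<tau>. tdom \<tau> \<in> mftors \<and> tcod \<tau> \<in> mftors \<and>
    monoidal_transformation (fdom (tdom \<tau>)) (fcod (tdom \<tau>)) (tdom \<tau>) (tcod \<tau>) \<tau> \<and>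
    tmap \<tau> \<in> extensional (Obj (fdom (tdom \<tau>)))}"

definition mntr_id :: "'u mftor \<Rightarrow> 'u mntr" where
  "mntr_id F =
    \<lparr>tdom = F, tcod = F, tmap = (\<lambda>x \<in> Obj (fdom F). Idt (fcod F) (fobj F x))\<rparr>"

definition mntr_vcomp :: "'u mntr \<Rightarrow> 'u mntr \<Rightarrow> 'u mntr" where
  "mntr_vcomp \<sigma> \<tau> =
    \<lparr>tdom = tdom \<tau>, tcod = tcod \<sigma>,
     tmap = (\<lambda>x \<in> Obj (fdom (tdom \<tau>)). tmap \<sigma> x \<cdot>\<^bsub>fcod (tdom \<tau>)\<^esub> tmap \<tau> x)\<rparr>"

definition mntr_hcomp :: "'u mntr \<Rightarrow> 'u mntr \<Rightarrow> 'u mntr" where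
  "mntr_hcomp \<sigma> \<tau> =
    \<lparr>tdom = mftor_comp (tdom \<sigma>) (tdom \<tau>), tcod = mftor_comp (tcod \<sigma>) (tcod \<tau>),
     tmap = (\<lambda>x \<in> Obj (fdom (tdom \<tau>)).
       tmap \<sigma> (fobj (tcod \<tau>) x) \<cdot>\<^bsub>fcod (tdom \<sigma>)\<^esub> farr (tdom \<sigma>) (tmap \<tau> x))\<rparr>"

definition MonCat_p :: "(('u, 'u) moncat, 'u mftor, 'u mntr) twocat" where
  "MonCat_p =
    \<lparr>Obj0 = small_moncats, Mor = mftors, Cell = mntrs,
     src = fdom, trg = fcod, one = mftor_id, cmp = mftor_comp,
     cdom = tdom, ccod = tcod, cid = mntr_id, vcmp = mntr_vcomp, hcmp = mntr_hcomp\<rparr>"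

definition SMonCat_p :: "(('u, 'u) moncat, 'u mftor, 'u mntr) twocat" where
  "SMonCat_p = full_sub MonCat_p {A. strict_monoidal A}"


section \<open>\<open>MonCat_p\<close> and \<open>SMonCat_p\<close> are 2-categories\<close>

lemma HomI: "f \<in> Arr C \<Longrightarrow> Dom C f = x \<Longrightarrow> Cod C f = y \<Longrightarrow> f \<in> Hom C x y"
  by (simp add: Hom_def)

lemma HomD: assumes "f \<in> Hom C x y" shows "f \<in> Arr C" "Dom C f = x" "Cod C f = y"
  using assms by (simp_all add: Hom_def)

context category begin

lemma arr_simps:
  "f \<in> Arr C \<Longrightarrow> Dom C f \<in> Obj C"
  "f \<in> Arr C \<Longrightarrow> Cod C f \<in> Obj C"
  "x \<in> Obj C \<Longrightarrow> Idt C x \<in> Arr C"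
  "x \<in> Obj C \<Longrightarrow> Dom C (Idt C x) = x"
  "x \<in> Obj C \<Longrightarrow> Cod C (Idt C x) = x"
  "f \<in> Arr C \<Longrightarrow> g \<in> Arr C \<Longrightarrow> Dom C g = Cod C f \<Longrightarrow> g \<cdot> f \<in> Arr C"
  "f \<in> Arr C \<Longrightarrow> g \<in> Arr C \<Longrightarrow> Dom C g = Cod C f \<Longrightarrow> Dom C (g \<cdot> f) = Dom C f"
  "f \<in> Arr C \<Longrightarrow> g \<in> Arr C \<Longrightarrow> Dom C g = Cod C f \<Longrightarrow> Cod C (g \<cdot> f) = Cod C g"
  "f \<in> Arr C \<Longrightarrow> Dom C f = x \<Longrightarrow> f \<cdot> Idt C x = f"
  "f \<in> Arr C \<Longrightarrow> Cod C f = x \<Longrightarrow> Idt C x \<cdot> f = f"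
  using Dom_in Cod_in Id_in[THEN HomD(1)] Id_in[THEN HomD(2)] Id_in[THEN HomD(3)]
    Comp_in[OF HomI HomI, THEN HomD(1)] Comp_in[OF HomI HomI, THEN HomD(2)]
    Comp_in[OF HomI HomI, THEN HomD(3)] Comp_Id[OF HomI] Id_Comp[OF HomI] by auto

lemma assoc_simp:
  "f \<in> Arr C \<Longrightarrow> g \<in> Arr C \<Longrightarrow> h \<in> Arr C \<Longrightarrow> Dom C g = Cod C f \<Longrightarrow> Dom C h = Cod C g \<Longrightarrow>
    (h \<cdot> g) \<cdot> f = h \<cdot> (g \<cdot> f)"
  by (rule Comp_assoc[OF HomI HomI HomI]) auto

lemma iso_in_Idt: "x \<in> Obj C \<Longrightarrow> iso_in C (Idt C x)"
  unfolding iso_in_def by (auto intro!: bexI[of _ "Idt C x"] HomI simp: arr_simps)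

lemma iso_in_Comp:
  assumes "iso_in C f" "iso_in C g" "Dom C g = Cod C f"
  shows "iso_in C (g \<cdot> f)"
proof -
  obtain f' where f': "f' \<in> Arr C" "Dom C f' = Cod C f" "Cod C f' = Dom C f"
    "f' \<cdot> f = Idt C (Dom C f)" "f \<cdot> f' = Idt C (Cod C f)" and f: "f \<in> Arr C"
    using assms(1) unfolding iso_in_def Hom_def by auto
  obtain g' where g': "g' \<in> Arr C" "Dom C g' = Cod C g" "Cod C g' = Dom C g"
    "g' \<cdot> g = Idt C (Dom C g)" "g \<cdot> g' = Idt C (Cod C g)" and g: "g \<in> Arr C"
    using assms(2) unfolding iso_in_def Hom_def by auto
  have "(f' \<cdot> g') \<cdot> (g \<cdot> f) = f' \<cdot> ((g' \<cdot> g) \<cdot> f)"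
    using f g f'(1-3) g'(1-3) assms(3) by (simp add: arr_simps assoc_simp)
  also have "\<dots> = Idt C (Dom C f)" using f g f' g' assms(3) by (simp add: arr_simps)
  finally have 1: "(f' \<cdot> g') \<cdot> (g \<cdot> f) = Idt C (Dom C f)" .
  have "(g \<cdot> f) \<cdot> (f' \<cdot> g') = g \<cdot> ((f \<cdot> f') \<cdot> g')"
    using f g f'(1-3) g'(1-3) assms(3) by (simp add: arr_simps assoc_simp)
  also have "\<dots> = Idt C (Cod C g)" using f g f' g' assms(3) by (simp add: arr_simps)
  finally have 2: "(g \<cdot> f) \<cdot> (f' \<cdot> g') = Idt C (Cod C g)" .
  show ?thesis unfolding iso_in_def
    using 1 2 f g f'(1-3) g'(1-3) assms(3)
    by (auto intro!: bexI[of _ "f' \<cdot> g'"] HomI simp: arr_simps)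
qed

end

lemma functorD:
  assumes "is_functor A B F0 F1"
  shows "\<And>x. x \<in> Obj A \<Longrightarrow> F0 x \<in> Obj B"
    "\<And>x. x \<in> Obj A \<Longrightarrow> F1 (Idt A x) = Idt B (F0 x)"
    "\<And>f. f \<in> Arr A \<Longrightarrow> F1 f \<in> Arr B"
    "\<And>f. f \<in> Arr A \<Longrightarrow> Dom B (F1 f) = F0 (Dom A f)"
    "\<And>f. f \<in> Arr A \<Longrightarrow> Cod B (F1 f) = F0 (Cod A f)"
    "\<And>f g. f \<in> Arr A \<Longrightarrow> g \<in> Arr A \<Longrightarrow> Dom A g = Cod A f \<Longrightarrow>
      F1 (Comp A g f) = Comp B (F1 g) (F1 f)"
  using assms unfolding is_functor_def Hom_def by auto

lemma iso_in_functor: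
  assumes "category A" "is_functor A B F0 F1" "iso_in A f" shows "iso_in B (F1 f)"
proof -
  interpret category A by fact
  obtain f' where f': "f' \<in> Arr A" "Dom A f' = Cod A f" "Cod A f' = Dom A f"
    "Comp A f' f = Idt A (Dom A f)" "Comp A f f' = Idt A (Cod A f)" and f: "f \<in> Arr A"
    using assms(3) unfolding iso_in_def Hom_def by auto
  note F = functorD[OF assms(2)]
  have "Comp B (F1 f') (F1 f) = Idt B (F0 (Dom A f))"
    using f f'(1-3) by (simp add: F(6)[symmetric] f'(4) F(2) arr_simps)
  moreover have "Comp B (F1 f) (F1 f') = Idt B (F0 (Cod A f))"
    using f f'(1-3) by (simp add: F(6)[symmetric] f'(5) F(2) arr_simps)
  ultimately show ?thesis unfolding iso_in_def
    using f f' F by (auto intro!: bexI[of _ "F1 f'"] HomI simp: arr_simps)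
qed

lemma is_functor_compose:
  assumes "category A" "is_functor A B F0 F1" "is_functor B C G0 G1"
  shows "is_functor A C (compose (Obj A) G0 F0) (compose (Arr A) G1 F1)"
proof -
  interpret category A by fact
  show ?thesis using functorD[OF assms(2)] functorD[OF assms(3)]
    by (auto simp: is_functor_def compose_def arr_simps intro!: HomI)
qed

lemma nat_transD:
  assumes "is_nat_trans A B F0 F1 G0 G1 \<tau>"
  shows "\<And>x. x \<in> Obj A \<Longrightarrow> \<tau> x \<in> Arr B"
    "\<And>x. x \<in> Obj A \<Longrightarrow> Dom B (\<tau> x) = F0 x"
    "\<And>x. x \<in> Obj A \<Longrightarrow> Cod B (\<tau> x) = G0 x"
    "\<And>f. f \<in> Arr A \<Longrightarrow> Comp B (G1 f) (\<tau> (Dom A f)) = Comp B (\<tau> (Cod A f)) (F1 f)"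
  using assms unfolding is_nat_trans_def Hom_def by auto

context monoidal_category begin

lemma mon_simps:
  "x \<in> Obj C \<Longrightarrow> y \<in> Obj C \<Longrightarrow> x \<otimes> y \<in> Obj C"
  "\<one> \<in> Obj C"
  "f \<in> Arr C \<Longrightarrow> g \<in> Arr C \<Longrightarrow> f \<boxtimes> g \<in> Arr C"
  "f \<in> Arr C \<Longrightarrow> g \<in> Arr C \<Longrightarrow> Dom C (f \<boxtimes> g) = Dom C f \<otimes> Dom C g"
  "f \<in> Arr C \<Longrightarrow> g \<in> Arr C \<Longrightarrow> Cod C (f \<boxtimes> g) = Cod C f \<otimes> Cod C g"
  "x \<in> Obj C \<Longrightarrow> y \<in> Obj C \<Longrightarrow> Idt C x \<boxtimes> Idt C y = Idt C (x \<otimes> y)"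
  "x \<in> Obj C \<Longrightarrow> y \<in> Obj C \<Longrightarrow> z \<in> Obj C \<Longrightarrow> Assoc C x y z \<in> Arr C"
  "x \<in> Obj C \<Longrightarrow> y \<in> Obj C \<Longrightarrow> z \<in> Obj C \<Longrightarrow> Dom C (Assoc C x y z) = (x \<otimes> y) \<otimes> z"
  "x \<in> Obj C \<Longrightarrow> y \<in> Obj C \<Longrightarrow> z \<in> Obj C \<Longrightarrow> Cod C (Assoc C x y z) = x \<otimes> (y \<otimes> z)"
  "x \<in> Obj C \<Longrightarrow> LUnit C x \<in> Arr C"
  "x \<in> Obj C \<Longrightarrow> Dom C (LUnit C x) = \<one> \<otimes> x"
  "x \<in> Obj C \<Longrightarrow> Cod C (LUnit C x) = x"
  "x \<in> Obj C \<Longrightarrow> RUnit C x \<in> Arr C"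
  "x \<in> Obj C \<Longrightarrow> Dom C (RUnit C x) = x \<otimes> \<one>"
  "x \<in> Obj C \<Longrightarrow> Cod C (RUnit C x) = x"
  using Tens_in Unit_in TensA_in[OF HomI HomI, THEN HomD(1)] TensA_in[OF HomI HomI, THEN HomD(2)]
    TensA_in[OF HomI HomI, THEN HomD(3)] TensA_Id Assoc_in[THEN HomD(1)] Assoc_in[THEN HomD(2)]
    Assoc_in[THEN HomD(3)] LUnit_in[THEN HomD(1)] LUnit_in[THEN HomD(2)] LUnit_in[THEN HomD(3)]
    RUnit_in[THEN HomD(1)] RUnit_in[THEN HomD(2)] RUnit_in[THEN HomD(3)] by auto

lemma tens_comp:
  "f \<in> Arr C \<Longrightarrow> f' \<in> Arr C \<Longrightarrow> g \<in> Arr C \<Longrightarrow> g' \<in> Arr C \<Longrightarrow> Dom C f' = Cod C f \<Longrightarrow>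
    Dom C g' = Cod C g \<Longrightarrow> (f' \<boxtimes> g') \<cdot> (f \<boxtimes> g) = (f' \<cdot> f) \<boxtimes> (g' \<cdot> g)"
  by (rule TensA_Comp[OF HomI HomI HomI HomI, symmetric]) auto

lemmas cs = arr_simps mon_simps

end

context strong_monoidal_functor begin

lemmas Fs = functorD(1-5)[OF is_functor]
lemmas Fcomp = functorD(6)[OF is_functor]

lemma phi_simps:
  "x \<in> Obj A \<Longrightarrow> y \<in> Obj A \<Longrightarrow> fmult F x y \<in> Arr B"
  "x \<in> Obj A \<Longrightarrow> y \<in> Obj A \<Longrightarrow> Dom B (fmult F x y) = fobj F x \<otimes>\<^bsub>B\<^esub> fobj F y"
  "x \<in> Obj A \<Longrightarrow> y \<in> Obj A \<Longrightarrow> Cod B (fmult F x y) = fobj F (x \<otimes>\<^bsub>A\<^esub> y)"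
  "funit F \<in> Arr B" "Dom B (funit F) = \<one>\<^bsub>B\<^esub>" "Cod B (funit F) = fobj F \<one>\<^bsub>A\<^esub>"
  using fmult_in[THEN HomD(1)] fmult_in[THEN HomD(2)] fmult_in[THEN HomD(3)] funit_in[THEN HomD(1)]
    funit_in[THEN HomD(2)] funit_in[THEN HomD(3)] by auto

lemma phi_nat:
  "f \<in> Arr A \<Longrightarrow> g \<in> Arr A \<Longrightarrow> Dom A f = x \<Longrightarrow> Dom A g = y \<Longrightarrow> Cod A f = x' \<Longrightarrow> Cod A g = y' \<Longrightarrow>
    fmult F x' y' \<cdot>\<^bsub>B\<^esub> (farr F f \<boxtimes>\<^bsub>B\<^esub> farr F g) = farr F (f \<boxtimes>\<^bsub>A\<^esub> g) \<cdot>\<^bsub>B\<^esub> fmult F x y"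
  by (rule fmult_nat[OF HomI HomI]) auto

lemmas ss = A.cs B.cs Fs phi_simps

end

lemma mftor_id_strong:
  assumes "monoidal_category A" shows "strong_monoidal_functor A A (mftor_id A)"
proof -
  interpret monoidal_category A by fact
  show ?thesis
    apply unfold_locales
              apply (auto simp: mftor_id_def is_functor_def cs Hom_def iso_in_Idt)
    done
qed

lemma mftor_comp_strong:
  assumes "strong_monoidal_functor A B F" "strong_monoidal_functor B C G"
  shows "strong_monoidal_functor A C (mftor_comp G F)"
proof -
  interpret F: strong_monoidal_functor A B F by fact
  interpret G: strong_monoidal_functor B C G by fact
  note ss = F.ss G.ss
  note d = F.fdom F.fcod G.fdom G.fcod
  show ?thesis
  proof
    show "fdom (mftor_comp G F) = A" "fcod (mftor_comp G F) = C" by (simp_all add: mftor_comp_def d)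
    show "is_functor A C (fobj (mftor_comp G F)) (farr (mftor_comp G F))"
      using is_functor_compose[OF F.A.category_axioms F.is_functor G.is_functor]
      by (simp add: mftor_comp_def d)
    note m = mftor_comp_def d compose_def
    show "fmult (mftor_comp G F) x y \<in> Hom C (fobj (mftor_comp G F) x \<otimes>\<^bsub>C\<^esub> fobj (mftor_comp G F) y)
        (fobj (mftor_comp G F) (x \<otimes>\<^bsub>A\<^esub> y))" if "x \<in> Obj A" "y \<in> Obj A" for x y
      using that by (auto simp: m ss intro!: HomI)
    show "iso_in C (fmult (mftor_comp G F) x y)" if "x \<in> Obj A" "y \<in> Obj A" for x y
      using that
      by (auto simp: m ss intro!: G.B.iso_in_Comp G.fmult_iso iso_in_functor[OF F.B.category_axioms G.is_functor] F.fmult_iso)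
    show "funit (mftor_comp G F) \<in> Hom C \<one>\<^bsub>C\<^esub> (fobj (mftor_comp G F) \<one>\<^bsub>A\<^esub>)"
      by (auto simp: m ss intro!: HomI)
    show "iso_in C (funit (mftor_comp G F))"
      by (auto simp: m ss intro!: G.B.iso_in_Comp G.funit_iso iso_in_functor[OF F.B.category_axioms G.is_functor] F.funit_iso)
    show "fmult (mftor_comp G F) x' y' \<cdot>\<^bsub>C\<^esub> (farr (mftor_comp G F) f \<boxtimes>\<^bsub>C\<^esub> farr (mftor_comp G F) g) =
       farr (mftor_comp G F) (f \<boxtimes>\<^bsub>A\<^esub> g) \<cdot>\<^bsub>C\<^esub> fmult (mftor_comp G F) x y"
      if "f \<in> Hom A x x'" "g \<in> Hom A y y'" for f g x x' y y'
    proof -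
      note h = HomD[OF that(1)] HomD[OF that(2)]
      have o: "x \<in> Obj A" "x' \<in> Obj A" "y \<in> Obj A" "y' \<in> Obj A" using h by (auto simp: ss)
      have "(farr G (fmult F x' y') \<cdot>\<^bsub>C\<^esub> fmult G (fobj F x') (fobj F y')) \<cdot>\<^bsub>C\<^esub> (farr G (farr F f) \<boxtimes>\<^bsub>C\<^esub> farr G (farr F g))
        = farr G (fmult F x' y') \<cdot>\<^bsub>C\<^esub> (fmult G (fobj F x') (fobj F y') \<cdot>\<^bsub>C\<^esub> (farr G (farr F f) \<boxtimes>\<^bsub>C\<^esub> farr G (farr F g)))"
        using h o by (simp add: ss G.B.assoc_simp)
      also have "\<dots> = farr G (fmult F x' y') \<cdot>\<^bsub>C\<^esub> (farr G (farr F f \<boxtimes>\<^bsub>B\<^esub> farr F g) \<cdot>\<^bsub>C\<^esub> fmult G (fobj F x) (fobj F y))"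
        using h o G.phi_nat[of "farr F f" "farr F g"] by (simp add: ss)
      also have "\<dots> = farr G (fmult F x' y' \<cdot>\<^bsub>B\<^esub> (farr F f \<boxtimes>\<^bsub>B\<^esub> farr F g)) \<cdot>\<^bsub>C\<^esub> fmult G (fobj F x) (fobj F y)"
        using h o by (simp add: ss G.B.assoc_simp G.Fcomp)
      also have "\<dots> = farr G (farr F (f \<boxtimes>\<^bsub>A\<^esub> g) \<cdot>\<^bsub>B\<^esub> fmult F x y) \<cdot>\<^bsub>C\<^esub> fmult G (fobj F x) (fobj F y)"
        using h o F.phi_nat[of f g] by (simp add: ss)
      also have "\<dots> = farr G (farr F (f \<boxtimes>\<^bsub>A\<^esub> g)) \<cdot>\<^bsub>C\<^esub> (farr G (fmult F x y) \<cdot>\<^bsub>C\<^esub> fmult G (fobj F x) (fobj F y))"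
        using h o by (simp add: ss G.B.assoc_simp G.Fcomp)
      finally show ?thesis using h o by (simp add: m ss)
    qed
    show "farr (mftor_comp G F) (Assoc A x y z) \<cdot>\<^bsub>C\<^esub> fmult (mftor_comp G F) (x \<otimes>\<^bsub>A\<^esub> y) z \<cdot>\<^bsub>C\<^esub>
        (fmult (mftor_comp G F) x y \<boxtimes>\<^bsub>C\<^esub> Idt C (fobj (mftor_comp G F) z)) =
      fmult (mftor_comp G F) x (y \<otimes>\<^bsub>A\<^esub> z) \<cdot>\<^bsub>C\<^esub> (Idt C (fobj (mftor_comp G F) x) \<boxtimes>\<^bsub>C\<^esub> fmult (mftor_comp G F) y z)
        \<cdot>\<^bsub>C\<^esub> Assoc C (fobj (mftor_comp G F) x) (fobj (mftor_comp G F) y) (fobj (mftor_comp G F) z)"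
      if o: "x \<in> Obj A" "y \<in> Obj A" "z \<in> Obj A" for x y z
    proof -
      let ?G = "farr G" and ?X = "fobj F x" and ?Y = "fobj F y" and ?Z = "fobj F z"
      let ?f = "fmult F" and ?g = "fmult G"
      have i: "Idt C (fobj G ?Z) = ?G (Idt B ?Z)" "Idt C (fobj G ?X) = ?G (Idt B ?X)" using o by (simp_all add: ss)
      have ty: "?f x y \<cdot>\<^bsub>B\<^esub> Idt B (?X \<otimes>\<^bsub>B\<^esub> ?Y) = ?f x y" using o by (simp add: ss)
      have e1: "(?G (?f x y) \<cdot>\<^bsub>C\<^esub> ?g ?X ?Y) \<boxtimes>\<^bsub>C\<^esub> Idt C (fobj G ?Z)
         = (?G (?f x y) \<boxtimes>\<^bsub>C\<^esub> ?G (Idt B ?Z)) \<cdot>\<^bsub>C\<^esub> (?g ?X ?Y \<boxtimes>\<^bsub>C\<^esub> Idt C (fobj G ?Z))"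
        using o by (simp add: ss G.B.tens_comp)
      have e2: "Idt C (fobj G ?X) \<boxtimes>\<^bsub>C\<^esub> (?G (?f y z) \<cdot>\<^bsub>C\<^esub> ?g ?Y ?Z)
         = (?G (Idt B ?X) \<boxtimes>\<^bsub>C\<^esub> ?G (?f y z)) \<cdot>\<^bsub>C\<^esub> (Idt C (fobj G ?X) \<boxtimes>\<^bsub>C\<^esub> ?g ?Y ?Z)"
        using o by (simp add: ss G.B.tens_comp)
      have n1: "?g (fobj F (x \<otimes>\<^bsub>A\<^esub> y)) ?Z \<cdot>\<^bsub>C\<^esub> (?G (?f x y) \<boxtimes>\<^bsub>C\<^esub> ?G (Idt B ?Z))
         = ?G (?f x y \<boxtimes>\<^bsub>B\<^esub> Idt B ?Z) \<cdot>\<^bsub>C\<^esub> ?g (?X \<otimes>\<^bsub>B\<^esub> ?Y) ?Z"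
        by (rule G.phi_nat) (use o in \<open>simp_all add: ss\<close>)
      have n2: "?g ?X (fobj F (y \<otimes>\<^bsub>A\<^esub> z)) \<cdot>\<^bsub>C\<^esub> (?G (Idt B ?X) \<boxtimes>\<^bsub>C\<^esub> ?G (?f y z))
         = ?G (Idt B ?X \<boxtimes>\<^bsub>B\<^esub> ?f y z) \<cdot>\<^bsub>C\<^esub> ?g ?X (?Y \<otimes>\<^bsub>B\<^esub> ?Z)"
        by (rule G.phi_nat) (use o in \<open>simp_all add: ss\<close>)
      let ?ga = "?g ?X ?Y \<boxtimes>\<^bsub>C\<^esub> Idt C (fobj G ?Z)" and ?gb = "Idt C (fobj G ?X) \<boxtimes>\<^bsub>C\<^esub> ?g ?Y ?Z"
      let ?a = "Assoc C (fobj G ?X) (fobj G ?Y) (fobj G ?Z)"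
      have "?G (farr F (Assoc A x y z)) \<cdot>\<^bsub>C\<^esub> (?G (?f (x \<otimes>\<^bsub>A\<^esub> y) z) \<cdot>\<^bsub>C\<^esub> ?g (fobj F (x \<otimes>\<^bsub>A\<^esub> y)) ?Z) \<cdot>\<^bsub>C\<^esub>
           ((?G (?f x y) \<boxtimes>\<^bsub>C\<^esub> ?G (Idt B ?Z)) \<cdot>\<^bsub>C\<^esub> ?ga)
        = ?G (farr F (Assoc A x y z)) \<cdot>\<^bsub>C\<^esub> ?G (?f (x \<otimes>\<^bsub>A\<^esub> y) z) \<cdot>\<^bsub>C\<^esub>
          ((?g (fobj F (x \<otimes>\<^bsub>A\<^esub> y)) ?Z \<cdot>\<^bsub>C\<^esub> (?G (?f x y) \<boxtimes>\<^bsub>C\<^esub> ?G (Idt B ?Z))) \<cdot>\<^bsub>C\<^esub> ?ga)"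
        using o by (simp add: ss G.B.assoc_simp del: F.Fs(2) G.Fs(2))
      also have "\<dots> = ?G (farr F (Assoc A x y z) \<cdot>\<^bsub>B\<^esub> ?f (x \<otimes>\<^bsub>A\<^esub> y) z \<cdot>\<^bsub>B\<^esub> (?f x y \<boxtimes>\<^bsub>B\<^esub> Idt B ?Z))
          \<cdot>\<^bsub>C\<^esub> (?g (?X \<otimes>\<^bsub>B\<^esub> ?Y) ?Z \<cdot>\<^bsub>C\<^esub> ?ga)"
        unfolding n1 using o by (simp add: ss G.B.assoc_simp G.Fcomp)
      also have "\<dots> = ?G (?f x (y \<otimes>\<^bsub>A\<^esub> z) \<cdot>\<^bsub>B\<^esub> (Idt B ?X \<boxtimes>\<^bsub>B\<^esub> ?f y z) \<cdot>\<^bsub>B\<^esub> Assoc B ?X ?Y ?Z)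
          \<cdot>\<^bsub>C\<^esub> (?g (?X \<otimes>\<^bsub>B\<^esub> ?Y) ?Z \<cdot>\<^bsub>C\<^esub> ?ga)"
        using F.fmult_assoc[OF o] by simp
      also have "\<dots> = ?G (?f x (y \<otimes>\<^bsub>A\<^esub> z)) \<cdot>\<^bsub>C\<^esub> ?G (Idt B ?X \<boxtimes>\<^bsub>B\<^esub> ?f y z) \<cdot>\<^bsub>C\<^esub>
          (?G (Assoc B ?X ?Y ?Z) \<cdot>\<^bsub>C\<^esub> ?g (?X \<otimes>\<^bsub>B\<^esub> ?Y) ?Z \<cdot>\<^bsub>C\<^esub> ?ga)"
        using o by (simp add: ss G.B.assoc_simp G.Fcomp)
      also have "\<dots> = ?G (?f x (y \<otimes>\<^bsub>A\<^esub> z)) \<cdot>\<^bsub>C\<^esub> ?G (Idt B ?X \<boxtimes>\<^bsub>B\<^esub> ?f y z) \<cdot>\<^bsub>C\<^esub>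
          (?g ?X (?Y \<otimes>\<^bsub>B\<^esub> ?Z) \<cdot>\<^bsub>C\<^esub> ?gb \<cdot>\<^bsub>C\<^esub> ?a)"
        using G.fmult_assoc[of ?X ?Y ?Z] o by (simp add: ss)
      also have "\<dots> = ?G (?f x (y \<otimes>\<^bsub>A\<^esub> z)) \<cdot>\<^bsub>C\<^esub> (?G (Idt B ?X \<boxtimes>\<^bsub>B\<^esub> ?f y z) \<cdot>\<^bsub>C\<^esub>
          ?g ?X (?Y \<otimes>\<^bsub>B\<^esub> ?Z)) \<cdot>\<^bsub>C\<^esub> (?gb \<cdot>\<^bsub>C\<^esub> ?a)"
        using o by (simp add: ss G.B.assoc_simp)
      also have "\<dots> = (?G (?f x (y \<otimes>\<^bsub>A\<^esub> z)) \<cdot>\<^bsub>C\<^esub> ?g ?X (fobj F (y \<otimes>\<^bsub>A\<^esub> z))) \<cdot>\<^bsub>C\<^esub>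
          ((?G (Idt B ?X) \<boxtimes>\<^bsub>C\<^esub> ?G (?f y z)) \<cdot>\<^bsub>C\<^esub> ?gb) \<cdot>\<^bsub>C\<^esub> ?a"
        unfolding n2[symmetric] using o by (simp add: ss G.B.assoc_simp)
      finally show ?thesis
        unfolding e1[symmetric] e2[symmetric] using o by (simp add: m ss)
    qed
    show "farr (mftor_comp G F) (LUnit A x) \<cdot>\<^bsub>C\<^esub> fmult (mftor_comp G F) \<one>\<^bsub>A\<^esub> x \<cdot>\<^bsub>C\<^esub>
        (funit (mftor_comp G F) \<boxtimes>\<^bsub>C\<^esub> Idt C (fobj (mftor_comp G F) x)) = LUnit C (fobj (mftor_comp G F) x)"
      if o: "x \<in> Obj A" for x
    proof -
      let ?G = "farr G" and ?X = "fobj F x" and ?f = "fmult F" and ?g = "fmult G"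
      let ?ga = "funit G \<boxtimes>\<^bsub>C\<^esub> Idt C (fobj G ?X)"
      have e1: "(?G (funit F) \<cdot>\<^bsub>C\<^esub> funit G) \<boxtimes>\<^bsub>C\<^esub> Idt C (fobj G ?X)
         = (?G (funit F) \<boxtimes>\<^bsub>C\<^esub> ?G (Idt B ?X)) \<cdot>\<^bsub>C\<^esub> ?ga"
        using o by (simp add: ss G.B.tens_comp)
      have n1: "?g (fobj F \<one>\<^bsub>A\<^esub>) ?X \<cdot>\<^bsub>C\<^esub> (?G (funit F) \<boxtimes>\<^bsub>C\<^esub> ?G (Idt B ?X))
         = ?G (funit F \<boxtimes>\<^bsub>B\<^esub> Idt B ?X) \<cdot>\<^bsub>C\<^esub> ?g \<one>\<^bsub>B\<^esub> ?X"
        by (rule G.phi_nat) (use o in \<open>simp_all add: ss\<close>)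
      have "?G (farr F (LUnit A x)) \<cdot>\<^bsub>C\<^esub> (?G (?f \<one>\<^bsub>A\<^esub> x) \<cdot>\<^bsub>C\<^esub> ?g (fobj F \<one>\<^bsub>A\<^esub>) ?X) \<cdot>\<^bsub>C\<^esub>
          ((?G (funit F) \<boxtimes>\<^bsub>C\<^esub> ?G (Idt B ?X)) \<cdot>\<^bsub>C\<^esub> ?ga)
        = ?G (farr F (LUnit A x)) \<cdot>\<^bsub>C\<^esub> ?G (?f \<one>\<^bsub>A\<^esub> x) \<cdot>\<^bsub>C\<^esub>
          ((?g (fobj F \<one>\<^bsub>A\<^esub>) ?X \<cdot>\<^bsub>C\<^esub> (?G (funit F) \<boxtimes>\<^bsub>C\<^esub> ?G (Idt B ?X))) \<cdot>\<^bsub>C\<^esub> ?ga)"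
        using o by (simp add: ss G.B.assoc_simp)
      also have "\<dots> = ?G (farr F (LUnit A x) \<cdot>\<^bsub>B\<^esub> ?f \<one>\<^bsub>A\<^esub> x \<cdot>\<^bsub>B\<^esub> (funit F \<boxtimes>\<^bsub>B\<^esub> Idt B ?X))
          \<cdot>\<^bsub>C\<^esub> (?g \<one>\<^bsub>B\<^esub> ?X \<cdot>\<^bsub>C\<^esub> ?ga)"
        unfolding n1 using o by (simp add: ss G.B.assoc_simp G.Fcomp)
      also have "\<dots> = ?G (LUnit B ?X) \<cdot>\<^bsub>C\<^esub> ?g \<one>\<^bsub>B\<^esub> ?X \<cdot>\<^bsub>C\<^esub> ?ga"
        using F.fmult_LUnit[OF o] o by (simp add: ss G.B.assoc_simp)
      also have "\<dots> = LUnit C (fobj G ?X)" using G.fmult_LUnit[of ?X] o by (simp add: ss)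
      finally show ?thesis unfolding e1[symmetric] using o by (simp add: m ss)
    qed
    show "farr (mftor_comp G F) (RUnit A x) \<cdot>\<^bsub>C\<^esub> fmult (mftor_comp G F) x \<one>\<^bsub>A\<^esub> \<cdot>\<^bsub>C\<^esub>
        (Idt C (fobj (mftor_comp G F) x) \<boxtimes>\<^bsub>C\<^esub> funit (mftor_comp G F)) = RUnit C (fobj (mftor_comp G F) x)"
      if o: "x \<in> Obj A" for x
    proof -
      let ?G = "farr G" and ?X = "fobj F x" and ?f = "fmult F" and ?g = "fmult G"
      let ?ga = "Idt C (fobj G ?X) \<boxtimes>\<^bsub>C\<^esub> funit G"
      have e1: "Idt C (fobj G ?X) \<boxtimes>\<^bsub>C\<^esub> (?G (funit F) \<cdot>\<^bsub>C\<^esub> funit G)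
         = (?G (Idt B ?X) \<boxtimes>\<^bsub>C\<^esub> ?G (funit F)) \<cdot>\<^bsub>C\<^esub> ?ga"
        using o by (simp add: ss G.B.tens_comp)
      have n1: "?g ?X (fobj F \<one>\<^bsub>A\<^esub>) \<cdot>\<^bsub>C\<^esub> (?G (Idt B ?X) \<boxtimes>\<^bsub>C\<^esub> ?G (funit F))
         = ?G (Idt B ?X \<boxtimes>\<^bsub>B\<^esub> funit F) \<cdot>\<^bsub>C\<^esub> ?g ?X \<one>\<^bsub>B\<^esub>"
        by (rule G.phi_nat) (use o in \<open>simp_all add: ss\<close>)
      have "?G (farr F (RUnit A x)) \<cdot>\<^bsub>C\<^esub> (?G (?f x \<one>\<^bsub>A\<^esub>) \<cdot>\<^bsub>C\<^esub> ?g ?X (fobj F \<one>\<^bsub>A\<^esub>)) \<cdot>\<^bsub>C\<^esub>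
          ((?G (Idt B ?X) \<boxtimes>\<^bsub>C\<^esub> ?G (funit F)) \<cdot>\<^bsub>C\<^esub> ?ga)
        = ?G (farr F (RUnit A x)) \<cdot>\<^bsub>C\<^esub> ?G (?f x \<one>\<^bsub>A\<^esub>) \<cdot>\<^bsub>C\<^esub>
          ((?g ?X (fobj F \<one>\<^bsub>A\<^esub>) \<cdot>\<^bsub>C\<^esub> (?G (Idt B ?X) \<boxtimes>\<^bsub>C\<^esub> ?G (funit F))) \<cdot>\<^bsub>C\<^esub> ?ga)"
        using o by (simp add: ss G.B.assoc_simp)
      also have "\<dots> = ?G (farr F (RUnit A x) \<cdot>\<^bsub>B\<^esub> ?f x \<one>\<^bsub>A\<^esub> \<cdot>\<^bsub>B\<^esub> (Idt B ?X \<boxtimes>\<^bsub>B\<^esub> funit F))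
          \<cdot>\<^bsub>C\<^esub> (?g ?X \<one>\<^bsub>B\<^esub> \<cdot>\<^bsub>C\<^esub> ?ga)"
        unfolding n1 using o by (simp add: ss G.B.assoc_simp G.Fcomp)
      also have "\<dots> = ?G (RUnit B ?X) \<cdot>\<^bsub>C\<^esub> ?g ?X \<one>\<^bsub>B\<^esub> \<cdot>\<^bsub>C\<^esub> ?ga"
        using F.fmult_RUnit[OF o] o by (simp add: ss G.B.assoc_simp)
      also have "\<dots> = RUnit C (fobj G ?X)" using G.fmult_RUnit[of ?X] o by (simp add: ss)
      finally show ?thesis unfolding e1[symmetric] using o by (simp add: m ss)
    qed
  qed
qed


lemma mftor_comp_simps:
  "fdom (mftor_comp G F) = fdom F" "fcod (mftor_comp G F) = fcod G"
  "x \<in> Obj (fdom F) \<Longrightarrow> fobj (mftor_comp G F) x = fobj G (fobj F x)"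
  "f \<in> Arr (fdom F) \<Longrightarrow> farr (mftor_comp G F) f = farr G (farr F f)"
  "x \<in> Obj (fdom F) \<Longrightarrow> y \<in> Obj (fdom F) \<Longrightarrow> fmult (mftor_comp G F) x y =
     farr G (fmult F x y) \<cdot>\<^bsub>fcod G\<^esub> fmult G (fobj F x) (fobj F y)"
  "funit (mftor_comp G F) = farr G (funit F) \<cdot>\<^bsub>fcod G\<^esub> funit G"
  by (simp_all add: mftor_comp_def compose_def)

lemma mftorsD:
  assumes "F \<in> mftors"
  shows "strong_monoidal_functor (fdom F) (fcod F) F" "extensional_mftor F"
    "fdom F \<in> small_moncats" "fcod F \<in> small_moncats"
  using assms by (auto simp: mftors_def)

lemma mftor_id_in: assumes "A \<in> small_moncats" shows "mftor_id A \<in> mftors"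
  using assms mftor_id_strong[of A]
  by (auto simp: mftors_def small_moncats_def extensional_mftor_def mftor_id_def)

lemma mftor_comp_in:
  assumes "F \<in> mftors" "G \<in> mftors" "fdom G = fcod F" shows "mftor_comp G F \<in> mftors"
  using assms mftor_comp_strong[of "fdom F" "fcod F" F "fcod G" G]
  by (auto simp: mftors_def extensional_mftor_def mftor_comp_def)

lemma mftor_eqI:
  assumes "F \<in> mftors" "G \<in> mftors" "fdom F = fdom G" "fcod F = fcod G"
    "\<And>x. x \<in> Obj (fdom F) \<Longrightarrow> fobj F x = fobj G x"
    "\<And>f. f \<in> Arr (fdom F) \<Longrightarrow> farr F f = farr G f"
    "\<And>x y. x \<in> Obj (fdom F) \<Longrightarrow> y \<in> Obj (fdom F) \<Longrightarrow> fmult F x y = fmult G x y"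
    "funit F = funit G"
  shows "F = G"
proof -
  have "fobj F = fobj G" "farr F = farr G"
    using assms by (auto simp: mftors_def extensional_mftor_def intro: extensionalityI)
  moreover have "fmult F = fmult G"
  proof (intro ext)
    fix x y
    show "fmult F x y = fmult G x y"
      using assms by (cases "x \<in> Obj (fdom F) \<and> y \<in> Obj (fdom F)")
        (auto simp: mftors_def extensional_mftor_def)
  qed
  ultimately show ?thesis using assms by simp
qed

lemma mftor_comp_id:
  assumes "F \<in> mftors" shows "mftor_comp F (mftor_id (fdom F)) = F"
proof -
  interpret strong_monoidal_functor "fdom F" "fcod F" F using mftorsD[OF assms] by simp
  have i: "mftor_id (fdom F) \<in> mftors" "fcod (mftor_id (fdom F)) = fdom F"
    using mftor_id_in mftorsD[OF assms] by (auto simp: mftor_id_def)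
  show ?thesis
    by (rule mftor_eqI) (use i assms mftor_comp_in[OF i(1) assms] in
      \<open>auto simp: mftor_comp_simps mftor_id_def ss\<close>)
qed

lemma mftor_id_comp:
  assumes "F \<in> mftors" shows "mftor_comp (mftor_id (fcod F)) F = F"
proof -
  interpret strong_monoidal_functor "fdom F" "fcod F" F using mftorsD[OF assms] by simp
  have i: "mftor_id (fcod F) \<in> mftors" "fdom (mftor_id (fcod F)) = fcod F"
    using mftor_id_in mftorsD[OF assms] by (auto simp: mftor_id_def)
  show ?thesis
    by (rule mftor_eqI) (use i assms mftor_comp_in[OF assms i(1)] in
      \<open>auto simp: mftor_comp_simps mftor_id_def ss\<close>)
qed

lemma mftor_comp_assoc:
  assumes "F \<in> mftors" "G \<in> mftors" "H \<in> mftors" "fdom G = fcod F" "fdom H = fcod G"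
  shows "mftor_comp (mftor_comp H G) F = mftor_comp H (mftor_comp G F)"
proof -
  interpret F: strong_monoidal_functor "fdom F" "fcod F" F using mftorsD[OF assms(1)] by simp
  interpret G: strong_monoidal_functor "fcod F" "fcod G" G using mftorsD[OF assms(2)] assms by simp
  interpret H: strong_monoidal_functor "fcod G" "fcod H" H using mftorsD[OF assms(3)] assms by simp
  show ?thesis
    by (rule mftor_eqI)
      (use assms in \<open>auto simp: mftor_comp_simps mftor_comp_in F.ss G.ss H.ss G.Fcomp H.Fcomp
        H.B.assoc_simp\<close>)
qed

locale mntr_in = monoidal_transformation begin
lemmas ts = nat_transD(1-3)[OF is_nat_trans]
lemmas tnat = nat_transD(4)[OF is_nat_trans]
end

lemma mntrsD:
  assumes "\<tau> \<in> mntrs"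
  shows "mntr_in (fdom (tdom \<tau>)) (fcod (tdom \<tau>)) (tdom \<tau>) (tcod \<tau>) \<tau>"
    "tdom \<tau> \<in> mftors" "tcod \<tau> \<in> mftors" "fdom (tcod \<tau>) = fdom (tdom \<tau>)"
    "fcod (tcod \<tau>) = fcod (tdom \<tau>)" "tmap \<tau> \<in> extensional (Obj (fdom (tdom \<tau>)))"
proof -
  have m: "monoidal_transformation (fdom (tdom \<tau>)) (fcod (tdom \<tau>)) (tdom \<tau>) (tcod \<tau>) \<tau>"
    using assms by (simp add: mntrs_def)
  interpret monoidal_transformation "fdom (tdom \<tau>)" "fcod (tdom \<tau>)" "tdom \<tau>" "tcod \<tau>" \<tau> by fact
  show "fdom (tcod \<tau>) = fdom (tdom \<tau>)" "fcod (tcod \<tau>) = fcod (tdom \<tau>)" by (fact G.fdom G.fcod)+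
qed (use assms in \<open>auto simp: mntrs_def mntr_in_def\<close>)

lemma mntr_eqI:
  assumes "\<sigma> \<in> mntrs" "\<tau> \<in> mntrs" "tdom \<sigma> = tdom \<tau>" "tcod \<sigma> = tcod \<tau>"
    "\<And>x. x \<in> Obj (fdom (tdom \<sigma>)) \<Longrightarrow> tmap \<sigma> x = tmap \<tau> x"
  shows "\<sigma> = \<tau>"
proof -
  have "tmap \<sigma> = tmap \<tau>"
    using assms mntrsD(6)[OF assms(1)] mntrsD(6)[OF assms(2)] by (auto intro: extensionalityI)
  then show ?thesis using assms by simp
qed

lemma mntrsI:
  assumes "F \<in> mftors" "G \<in> mftors" "fdom G = fdom F" "fcod G = fcod F" "tdom \<tau> = F" "tcod \<tau> = G"
    "\<And>x. x \<in> Obj (fdom F) \<Longrightarrow> tmap \<tau> x \<in> Hom (fcod F) (fobj F x) (fobj G x)"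
    "\<And>f. f \<in> Arr (fdom F) \<Longrightarrow> farr G f \<cdot>\<^bsub>fcod F\<^esub> tmap \<tau> (Dom (fdom F) f) = tmap \<tau> (Cod (fdom F) f) \<cdot>\<^bsub>fcod F\<^esub> farr F f"
    "\<And>x y. x \<in> Obj (fdom F) \<Longrightarrow> y \<in> Obj (fdom F) \<Longrightarrow>
      tmap \<tau> (x \<otimes>\<^bsub>fdom F\<^esub> y) \<cdot>\<^bsub>fcod F\<^esub> fmult F x y = fmult G x y \<cdot>\<^bsub>fcod F\<^esub> (tmap \<tau> x \<boxtimes>\<^bsub>fcod F\<^esub> tmap \<tau> y)"
    "tmap \<tau> \<one>\<^bsub>fdom F\<^esub> \<cdot>\<^bsub>fcod F\<^esub> funit F = funit G"
    "tmap \<tau> \<in> extensional (Obj (fdom F))"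
  shows "\<tau> \<in> mntrs"
proof -
  have "monoidal_transformation (fdom F) (fcod F) F G \<tau>"
    using assms mftorsD[OF assms(1)] mftorsD[OF assms(2)]
    by (auto simp: monoidal_transformation_def monoidal_transformation_axioms_def is_nat_trans_def)
  then show ?thesis using assms by (auto simp: mntrs_def)
qed

lemma mntr_id_in: assumes "F \<in> mftors" shows "mntr_id F \<in> mntrs"
proof -
  interpret strong_monoidal_functor "fdom F" "fcod F" F using mftorsD[OF assms] by simp
  show ?thesis
    by (rule mntrsI) (use assms in \<open>auto simp: mntr_id_def ss intro!: HomI\<close>)
qed

lemma mntr_vcomp_in:
  assumes "\<sigma> \<in> mntrs" "\<tau> \<in> mntrs" "tdom \<sigma> = tcod \<tau>" shows "mntr_vcomp \<sigma> \<tau> \<in> mntrs"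
proof -
  define A B where "A = fdom (tdom \<tau>)" and "B = fcod (tdom \<tau>)"
  note \<tau> = mntrsD[OF assms(2)] note \<sigma> = mntrsD[OF assms(1), unfolded assms(3) \<tau>(4,5)]
  interpret t: mntr_in A B "tdom \<tau>" "tcod \<tau>" \<tau> using \<tau> by (simp add: A_def B_def)
  interpret s: mntr_in A B "tcod \<tau>" "tcod \<sigma>" \<sigma> using \<sigma> by (simp add: A_def B_def)
  note ss = t.F.ss t.G.ss s.G.ss t.ts s.ts
  have [simp]: "fdom (tdom \<tau>) = A" "fcod (tdom \<tau>) = B" "fdom (tcod \<sigma>) = A" "fcod (tcod \<sigma>) = B"
    using \<sigma> \<tau> by (simp_all add: A_def B_def)
  have v: "tdom (mntr_vcomp \<sigma> \<tau>) = tdom \<tau>" "tcod (mntr_vcomp \<sigma> \<tau>) = tcod \<sigma>"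
    "\<And>x. x \<in> Obj A \<Longrightarrow> tmap (mntr_vcomp \<sigma> \<tau>) x = tmap \<sigma> x \<cdot>\<^bsub>B\<^esub> tmap \<tau> x"
    "tmap (mntr_vcomp \<sigma> \<tau>) \<in> extensional (Obj A)"
    by (auto simp: mntr_vcomp_def)
  show ?thesis
  proof (rule mntrsI[OF \<tau>(2) \<sigma>(3)], simp_all add: v)
    show "tmap \<sigma> x \<cdot>\<^bsub>B\<^esub> tmap \<tau> x \<in> Hom B (fobj (tdom \<tau>) x) (fobj (tcod \<sigma>) x)" if "x \<in> Obj A" for x
      using that by (auto simp: ss intro!: HomI)
  next
    fix f assume f: "f \<in> Arr A"
    let ?x = "Dom A f" and ?y = "Cod A f"
    have o: "?x \<in> Obj A" "?y \<in> Obj A" using f by (auto simp: ss)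
    have "farr (tcod \<sigma>) f \<cdot>\<^bsub>B\<^esub> (tmap \<sigma> ?x \<cdot>\<^bsub>B\<^esub> tmap \<tau> ?x) = (farr (tcod \<sigma>) f \<cdot>\<^bsub>B\<^esub> tmap \<sigma> ?x) \<cdot>\<^bsub>B\<^esub> tmap \<tau> ?x"
      using f o by (simp add: ss t.F.B.assoc_simp)
    also have "\<dots> = tmap \<sigma> ?y \<cdot>\<^bsub>B\<^esub> (farr (tcod \<tau>) f \<cdot>\<^bsub>B\<^esub> tmap \<tau> ?x)"
      using f o by (simp add: s.tnat ss t.F.B.assoc_simp)
    also have "\<dots> = (tmap \<sigma> ?y \<cdot>\<^bsub>B\<^esub> tmap \<tau> ?y) \<cdot>\<^bsub>B\<^esub> farr (tdom \<tau>) f"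
      using f o by (simp add: t.tnat ss t.F.B.assoc_simp)
    finally show "farr (tcod \<sigma>) f \<cdot>\<^bsub>B\<^esub> tmap (mntr_vcomp \<sigma> \<tau>) ?x = tmap (mntr_vcomp \<sigma> \<tau>) ?y \<cdot>\<^bsub>B\<^esub> farr (tdom \<tau>) f"
      using o by (simp add: v)
  next
    fix x y assume o: "x \<in> Obj A" "y \<in> Obj A"
    let ?xy = "x \<otimes>\<^bsub>A\<^esub> y"
    have "(tmap \<sigma> ?xy \<cdot>\<^bsub>B\<^esub> tmap \<tau> ?xy) \<cdot>\<^bsub>B\<^esub> fmult (tdom \<tau>) x y = tmap \<sigma> ?xy \<cdot>\<^bsub>B\<^esub> (tmap \<tau> ?xy \<cdot>\<^bsub>B\<^esub> fmult (tdom \<tau>) x y)"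
      using o by (simp add: ss t.F.B.assoc_simp)
    also have "\<dots> = (tmap \<sigma> ?xy \<cdot>\<^bsub>B\<^esub> fmult (tcod \<tau>) x y) \<cdot>\<^bsub>B\<^esub> (tmap \<tau> x \<boxtimes>\<^bsub>B\<^esub> tmap \<tau> y)"
      using o by (simp add: ss t.F.B.assoc_simp t.tmap_mult)
    also have "\<dots> = fmult (tcod \<sigma>) x y \<cdot>\<^bsub>B\<^esub> ((tmap \<sigma> x \<cdot>\<^bsub>B\<^esub> tmap \<tau> x) \<boxtimes>\<^bsub>B\<^esub> (tmap \<sigma> y \<cdot>\<^bsub>B\<^esub> tmap \<tau> y))"
      using o by (simp add: ss t.F.B.assoc_simp s.tmap_mult t.F.B.tens_comp)
    finally show "tmap (mntr_vcomp \<sigma> \<tau>) ?xy \<cdot>\<^bsub>B\<^esub> fmult (tdom \<tau>) x y =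
      fmult (tcod \<sigma>) x y \<cdot>\<^bsub>B\<^esub> ((tmap \<sigma> x \<cdot>\<^bsub>B\<^esub> tmap \<tau> x) \<boxtimes>\<^bsub>B\<^esub> (tmap \<sigma> y \<cdot>\<^bsub>B\<^esub> tmap \<tau> y))"
      using o by (simp add: v ss)
  next
    have "(tmap \<sigma> \<one>\<^bsub>A\<^esub> \<cdot>\<^bsub>B\<^esub> tmap \<tau> \<one>\<^bsub>A\<^esub>) \<cdot>\<^bsub>B\<^esub> funit (tdom \<tau>) = tmap \<sigma> \<one>\<^bsub>A\<^esub> \<cdot>\<^bsub>B\<^esub> (tmap \<tau> \<one>\<^bsub>A\<^esub> \<cdot>\<^bsub>B\<^esub> funit (tdom \<tau>))"
      by (simp add: ss t.F.B.assoc_simp)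
    then show "tmap (mntr_vcomp \<sigma> \<tau>) \<one>\<^bsub>A\<^esub> \<cdot>\<^bsub>B\<^esub> funit (tdom \<tau>) = funit (tcod \<sigma>)"
      by (simp add: v ss t.tmap_unit s.tmap_unit)
  qed
qed

lemma mntr_hcomp_in:
  assumes "\<sigma> \<in> mntrs" "\<tau> \<in> mntrs" "fdom (tdom \<sigma>) = fcod (tdom \<tau>)" shows "mntr_hcomp \<sigma> \<tau> \<in> mntrs"
proof -
  define A B C where "A = fdom (tdom \<tau>)" and "B = fcod (tdom \<tau>)" and "C = fcod (tdom \<sigma>)"
  define F F' G G' where "F = tdom \<tau>" and "F' = tcod \<tau>" and "G = tdom \<sigma>" and "G' = tcod \<sigma>"
  note \<tau> = mntrsD[OF assms(2)] note \<sigma> = mntrsD[OF assms(1), unfolded assms(3)]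
  note defs = A_def B_def C_def F_def F'_def G_def G'_def
  interpret t: mntr_in A B F F' \<tau> using \<tau> by (simp add: defs)
  interpret s: mntr_in B C G G' \<sigma> using \<sigma> by (simp add: defs)
  note ss = t.F.ss t.G.ss s.F.ss s.G.ss t.ts s.ts
  have d: "fdom F = A" "fcod F = B" "fdom F' = A" "fcod F' = B" "fdom G = B" "fcod G = C"
    "fdom G' = B" "fcod G' = C" and m: "F \<in> mftors" "F' \<in> mftors" "G \<in> mftors" "G' \<in> mftors"
    using \<sigma> \<tau> assms(3) by (simp_all add: defs)
  note ms = mftor_comp_simps d
  have v: "tdom (mntr_hcomp \<sigma> \<tau>) = mftor_comp G F" "tcod (mntr_hcomp \<sigma> \<tau>) = mftor_comp G' F'"
    "\<And>x. x \<in> Obj A \<Longrightarrow> tmap (mntr_hcomp \<sigma> \<tau>) x = tmap \<sigma> (fobj F' x) \<cdot>\<^bsub>C\<^esub> farr G (tmap \<tau> x)"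
    "tmap (mntr_hcomp \<sigma> \<tau>) \<in> extensional (Obj A)"
    by (auto simp: mntr_hcomp_def defs)
  have a: "\<And>f g h. f \<in> Arr C \<Longrightarrow> g \<in> Arr C \<Longrightarrow> h \<in> Arr C \<Longrightarrow> Dom C g = Cod C f \<Longrightarrow> Dom C h = Cod C g \<Longrightarrow>
      (h \<cdot>\<^bsub>C\<^esub> g) \<cdot>\<^bsub>C\<^esub> f = h \<cdot>\<^bsub>C\<^esub> (g \<cdot>\<^bsub>C\<^esub> f)" by (rule s.F.B.assoc_simp)
  show ?thesis
  proof (rule mntrsI[OF mftor_comp_in mftor_comp_in], (simp_all add: v ms m)[10])
    show "tmap (mntr_hcomp \<sigma> \<tau>) x \<in> Hom (fcod (mftor_comp G F)) (fobj (mftor_comp G F) x) (fobj (mftor_comp G' F') x)"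
      if "x \<in> Obj (fdom (mftor_comp G F))" for x
      using that by (auto simp: ss ms v intro!: HomI)
  next
    fix f assume "f \<in> Arr (fdom (mftor_comp G F))"
    then have f: "f \<in> Arr A" by (simp add: ms)
    let ?x = "Dom A f" and ?y = "Cod A f"
    have o: "?x \<in> Obj A" "?y \<in> Obj A" using f by (auto simp: ss)
    have "farr G' (farr F' f) \<cdot>\<^bsub>C\<^esub> (tmap \<sigma> (fobj F' ?x) \<cdot>\<^bsub>C\<^esub> farr G (tmap \<tau> ?x))
      = (farr G' (farr F' f) \<cdot>\<^bsub>C\<^esub> tmap \<sigma> (fobj F' ?x)) \<cdot>\<^bsub>C\<^esub> farr G (tmap \<tau> ?x)"
      using f o by (simp add: ss a)
    also have "\<dots> = (tmap \<sigma> (fobj F' ?y) \<cdot>\<^bsub>C\<^esub> farr G (farr F' f)) \<cdot>\<^bsub>C\<^esub> farr G (tmap \<tau> ?x)"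
      using f o s.tnat[of "farr F' f"] by (simp add: ss)
    also have "\<dots> = tmap \<sigma> (fobj F' ?y) \<cdot>\<^bsub>C\<^esub> farr G (farr F' f \<cdot>\<^bsub>B\<^esub> tmap \<tau> ?x)"
      using f o by (simp add: ss a s.F.Fcomp)
    also have "\<dots> = tmap \<sigma> (fobj F' ?y) \<cdot>\<^bsub>C\<^esub> farr G (tmap \<tau> ?y \<cdot>\<^bsub>B\<^esub> farr F f)"
      using f by (simp add: t.tnat)
    also have "\<dots> = (tmap \<sigma> (fobj F' ?y) \<cdot>\<^bsub>C\<^esub> farr G (tmap \<tau> ?y)) \<cdot>\<^bsub>C\<^esub> farr G (farr F f)"
      using f o by (simp add: ss a s.F.Fcomp)
    finally show "farr (mftor_comp G' F') f \<cdot>\<^bsub>fcod (mftor_comp G F)\<^esub> tmap (mntr_hcomp \<sigma> \<tau>) (Dom (fdom (mftor_comp G F)) f) =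
         tmap (mntr_hcomp \<sigma> \<tau>) (Cod (fdom (mftor_comp G F)) f) \<cdot>\<^bsub>fcod (mftor_comp G F)\<^esub> farr (mftor_comp G F) f"
      using o f by (simp add: v ms)
  next
    fix x y assume "x \<in> Obj (fdom (mftor_comp G F))" "y \<in> Obj (fdom (mftor_comp G F))"
    then have o: "x \<in> Obj A" "y \<in> Obj A" by (simp_all add: ms)
    let ?xy = "x \<otimes>\<^bsub>A\<^esub> y"
    have n: "fmult G (fobj F' x) (fobj F' y) \<cdot>\<^bsub>C\<^esub> (farr G (tmap \<tau> x) \<boxtimes>\<^bsub>C\<^esub> farr G (tmap \<tau> y))
       = farr G (tmap \<tau> x \<boxtimes>\<^bsub>B\<^esub> tmap \<tau> y) \<cdot>\<^bsub>C\<^esub> fmult G (fobj F x) (fobj F y)"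
      by (rule s.F.phi_nat) (use o in \<open>simp_all add: ss\<close>)
    have "(tmap \<sigma> (fobj F' ?xy) \<cdot>\<^bsub>C\<^esub> farr G (tmap \<tau> ?xy)) \<cdot>\<^bsub>C\<^esub> (farr G (fmult F x y) \<cdot>\<^bsub>C\<^esub> fmult G (fobj F x) (fobj F y))
      = tmap \<sigma> (fobj F' ?xy) \<cdot>\<^bsub>C\<^esub> farr G (tmap \<tau> ?xy \<cdot>\<^bsub>B\<^esub> fmult F x y) \<cdot>\<^bsub>C\<^esub> fmult G (fobj F x) (fobj F y)"
      using o by (simp add: ss a s.F.Fcomp)
    also have "\<dots> = tmap \<sigma> (fobj F' ?xy) \<cdot>\<^bsub>C\<^esub> farr G (fmult F' x y \<cdot>\<^bsub>B\<^esub> (tmap \<tau> x \<boxtimes>\<^bsub>B\<^esub> tmap \<tau> y)) \<cdot>\<^bsub>C\<^esub> fmult G (fobj F x) (fobj F y)"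
      using o by (simp add: t.tmap_mult)
    also have "\<dots> = (tmap \<sigma> (fobj F' ?xy) \<cdot>\<^bsub>C\<^esub> farr G (fmult F' x y)) \<cdot>\<^bsub>C\<^esub>
        (farr G (tmap \<tau> x \<boxtimes>\<^bsub>B\<^esub> tmap \<tau> y) \<cdot>\<^bsub>C\<^esub> fmult G (fobj F x) (fobj F y))"
      using o by (simp add: ss a s.F.Fcomp)
    also have "\<dots> = (farr G' (fmult F' x y) \<cdot>\<^bsub>C\<^esub> tmap \<sigma> (fobj F' x \<otimes>\<^bsub>B\<^esub> fobj F' y)) \<cdot>\<^bsub>C\<^esub>
        (fmult G (fobj F' x) (fobj F' y) \<cdot>\<^bsub>C\<^esub> (farr G (tmap \<tau> x) \<boxtimes>\<^bsub>C\<^esub> farr G (tmap \<tau> y)))"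
      using o s.tnat[of "fmult F' x y"] n by (simp add: ss)
    also have "\<dots> = farr G' (fmult F' x y) \<cdot>\<^bsub>C\<^esub> ((tmap \<sigma> (fobj F' x \<otimes>\<^bsub>B\<^esub> fobj F' y) \<cdot>\<^bsub>C\<^esub>
        fmult G (fobj F' x) (fobj F' y)) \<cdot>\<^bsub>C\<^esub> (farr G (tmap \<tau> x) \<boxtimes>\<^bsub>C\<^esub> farr G (tmap \<tau> y)))"
      using o by (simp add: ss a)
    also have "\<dots> = (farr G' (fmult F' x y) \<cdot>\<^bsub>C\<^esub> fmult G' (fobj F' x) (fobj F' y)) \<cdot>\<^bsub>C\<^esub>
       ((tmap \<sigma> (fobj F' x) \<cdot>\<^bsub>C\<^esub> farr G (tmap \<tau> x)) \<boxtimes>\<^bsub>C\<^esub> (tmap \<sigma> (fobj F' y) \<cdot>\<^bsub>C\<^esub> farr G (tmap \<tau> y)))"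
      using o s.tmap_mult[of "fobj F' x" "fobj F' y"] by (simp add: ss a s.F.B.tens_comp)
    finally show "tmap (mntr_hcomp \<sigma> \<tau>) (x \<otimes>\<^bsub>fdom (mftor_comp G F)\<^esub> y) \<cdot>\<^bsub>fcod (mftor_comp G F)\<^esub> fmult (mftor_comp G F) x y =
       fmult (mftor_comp G' F') x y \<cdot>\<^bsub>fcod (mftor_comp G F)\<^esub>
       (tmap (mntr_hcomp \<sigma> \<tau>) x \<boxtimes>\<^bsub>fcod (mftor_comp G F)\<^esub> tmap (mntr_hcomp \<sigma> \<tau>) y)"
      using o by (simp add: v ms ss)
  next
    let ?i = "\<one>\<^bsub>A\<^esub>"
    have "(tmap \<sigma> (fobj F' ?i) \<cdot>\<^bsub>C\<^esub> farr G (tmap \<tau> ?i)) \<cdot>\<^bsub>C\<^esub> (farr G (funit F) \<cdot>\<^bsub>C\<^esub> funit G)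
      = (tmap \<sigma> (fobj F' ?i) \<cdot>\<^bsub>C\<^esub> farr G (tmap \<tau> ?i \<cdot>\<^bsub>B\<^esub> funit F)) \<cdot>\<^bsub>C\<^esub> funit G"
      by (simp add: ss a s.F.Fcomp)
    also have "\<dots> = (tmap \<sigma> (fobj F' ?i) \<cdot>\<^bsub>C\<^esub> farr G (funit F')) \<cdot>\<^bsub>C\<^esub> funit G"
      by (simp add: t.tmap_unit)
    also have "\<dots> = farr G' (funit F') \<cdot>\<^bsub>C\<^esub> (tmap \<sigma> \<one>\<^bsub>B\<^esub> \<cdot>\<^bsub>C\<^esub> funit G)"
      using s.tnat[of "funit F'", symmetric] by (simp add: ss a)
    finally show "tmap (mntr_hcomp \<sigma> \<tau>) \<one>\<^bsub>fdom (mftor_comp G F)\<^esub> \<cdot>\<^bsub>fcod (mftor_comp G F)\<^esub> funit (mftor_comp G F)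
       = funit (mftor_comp G' F')"
      by (simp add: v ms ss s.tmap_unit)
  qed (simp_all add: ms m v)
qed

lemma mor_MonCat: "f \<in> mor MonCat_p X Y \<longleftrightarrow> f \<in> mftors \<and> fdom f = X \<and> fcod f = Y"
  by (simp add: mor_def MonCat_p_def)

lemma hom_MonCat: "\<alpha> \<in> Arr (hom MonCat_p X Y) \<longleftrightarrow>
  \<alpha> \<in> mntrs \<and> fdom (tdom \<alpha>) = X \<and> fcod (tdom \<alpha>) = Y"
  using mntrsD[of \<alpha>] by (auto simp: hom_def mor_def MonCat_p_def)

lemma Hom_hom_MonCat: "\<alpha> \<in> Hom (hom MonCat_p X Y) f g \<longleftrightarrow>
  \<alpha> \<in> mntrs \<and> fdom (tdom \<alpha>) = X \<and> fcod (tdom \<alpha>) = Y \<and> tdom \<alpha> = f \<and> tcod \<alpha> = g"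
  by (auto simp: Hom_def hom_MonCat) (auto simp: hom_def MonCat_p_def)

lemma MonCat_simps: "Obj0 MonCat_p = small_moncats" "Mor MonCat_p = mftors" "Cell MonCat_p = mntrs"
  "src MonCat_p = fdom" "trg MonCat_p = fcod" "one MonCat_p = mftor_id" "cmp MonCat_p = mftor_comp"
  "cdom MonCat_p = tdom" "ccod MonCat_p = tcod" "cid MonCat_p = mntr_id"
  "vcmp MonCat_p = mntr_vcomp" "hcmp MonCat_p = mntr_hcomp"
  by (simp_all add: MonCat_p_def)

lemma hom_simps: "Obj (hom C X Y) = mor C X Y" "Dom (hom C X Y) = cdom C" "Cod (hom C X Y) = ccod C"
  "Idt (hom C X Y) = cid C" "Comp (hom C X Y) = vcmp C"
  by (simp_all add: hom_def)

lemma mntr_vcomp_simps: "tdom (mntr_vcomp \<sigma> \<tau>) = tdom \<tau>" "tcod (mntr_vcomp \<sigma> \<tau>) = tcod \<sigma>"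
    "x \<in> Obj (fdom (tdom \<tau>)) \<Longrightarrow> tmap (mntr_vcomp \<sigma> \<tau>) x = tmap \<sigma> x \<cdot>\<^bsub>fcod (tdom \<tau>)\<^esub> tmap \<tau> x"
  by (simp_all add: mntr_vcomp_def)

lemma mntr_hcomp_simps: "tdom (mntr_hcomp \<sigma> \<tau>) = mftor_comp (tdom \<sigma>) (tdom \<tau>)"
    "tcod (mntr_hcomp \<sigma> \<tau>) = mftor_comp (tcod \<sigma>) (tcod \<tau>)"
    "x \<in> Obj (fdom (tdom \<tau>)) \<Longrightarrow> tmap (mntr_hcomp \<sigma> \<tau>) x =
       tmap \<sigma> (fobj (tcod \<tau>) x) \<cdot>\<^bsub>fcod (tdom \<sigma>)\<^esub> farr (tdom \<sigma>) (tmap \<tau> x)"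
  by (simp_all add: mntr_hcomp_def)

lemma mntr_id_simps: "tdom (mntr_id F) = F" "tcod (mntr_id F) = F"
   "x \<in> Obj (fdom F) \<Longrightarrow> tmap (mntr_id F) x = Idt (fcod F) (fobj F x)"
  by (simp_all add: mntr_id_def)

lemma mftor_id_simps: "fdom (mftor_id A) = A" "fcod (mftor_id A) = A"
   "x \<in> Obj A \<Longrightarrow> fobj (mftor_id A) x = x" "f \<in> Arr A \<Longrightarrow> farr (mftor_id A) f = f"
  by (simp_all add: mftor_id_def)

lemmas all_simps = mntr_vcomp_simps mntr_hcomp_simps mntr_id_simps mftor_id_simps mftor_comp_simps
lemmas in_intros = mntr_vcomp_in mntr_hcomp_in mntr_id_in mftor_id_in mftor_comp_in

lemma category_underlying_MonCat: "category (underlying MonCat_p)"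
  by unfold_locales
    (auto simp: underlying_def MonCat_simps Hom_def all_simps mftor_comp_id mftor_id_comp
      mftor_comp_assoc in_intros mftorsD)

lemma mntr_vcomp_id: assumes "\<tau> \<in> mntrs" shows "mntr_vcomp \<tau> (mntr_id (tdom \<tau>)) = \<tau>"
proof -
  note \<tau> = mntrsD[OF assms]
  interpret t: mntr_in "fdom (tdom \<tau>)" "fcod (tdom \<tau>)" "tdom \<tau>" "tcod \<tau>" \<tau> using \<tau> by simp
  show ?thesis by (rule mntr_eqI) (use \<tau> assms in \<open>auto simp: all_simps in_intros t.F.ss t.ts\<close>)
qed

lemma mntr_id_vcomp: assumes "\<tau> \<in> mntrs" shows "mntr_vcomp (mntr_id (tcod \<tau>)) \<tau> = \<tau>"
proof -
  note \<tau> = mntrsD[OF assms]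
  interpret t: mntr_in "fdom (tdom \<tau>)" "fcod (tdom \<tau>)" "tdom \<tau>" "tcod \<tau>" \<tau> using \<tau> by simp
  show ?thesis by (rule mntr_eqI) (use \<tau> assms in \<open>auto simp: all_simps in_intros t.F.ss t.ts\<close>)
qed

lemma mntr_vcomp_assoc: assumes "\<tau> \<in> mntrs" "\<sigma> \<in> mntrs" "\<rho> \<in> mntrs" "tdom \<sigma> = tcod \<tau>" "tdom \<rho> = tcod \<sigma>"
  shows "mntr_vcomp (mntr_vcomp \<rho> \<sigma>) \<tau> = mntr_vcomp \<rho> (mntr_vcomp \<sigma> \<tau>)"
proof -
  note \<tau> = mntrsD[OF assms(1)]
  note \<sigma> = mntrsD[OF assms(2), unfolded assms(4) \<tau>(4,5)]
  note \<rho> = mntrsD[OF assms(3), unfolded assms(5) \<sigma>(4,5)]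
  interpret t: mntr_in "fdom (tdom \<tau>)" "fcod (tdom \<tau>)" "tdom \<tau>" "tcod \<tau>" \<tau> using \<tau> by simp
  interpret s: mntr_in "fdom (tdom \<tau>)" "fcod (tdom \<tau>)" "tcod \<tau>" "tcod \<sigma>" \<sigma> using \<sigma> by simp
  interpret r: mntr_in "fdom (tdom \<tau>)" "fcod (tdom \<tau>)" "tcod \<sigma>" "tcod \<rho>" \<rho> using \<rho> by simp
  show ?thesis
    by (rule mntr_eqI) (use \<tau> \<sigma> \<rho> assms in
      \<open>auto simp: all_simps in_intros t.F.ss t.ts s.ts r.ts t.F.B.assoc_simp\<close>)
qed

lemma category_hom_MonCat: "category (hom MonCat_p X Y)"
  apply unfold_locales
  apply (auto simp: Hom_hom_MonCat hom_MonCat mor_MonCat hom_simps MonCat_simps all_simps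
      mntr_vcomp_id mntr_id_vcomp mntr_vcomp_assoc in_intros mntrsD)
  done

lemma mntr_interchange:
  assumes "\<alpha> \<in> mntrs" "\<alpha>' \<in> mntrs" "\<beta> \<in> mntrs" "\<beta>' \<in> mntrs" "tdom \<alpha>' = tcod \<alpha>" "tdom \<beta>' = tcod \<beta>"
    "fdom (tdom \<beta>) = fcod (tdom \<alpha>)"
  shows "mntr_hcomp (mntr_vcomp \<beta>' \<beta>) (mntr_vcomp \<alpha>' \<alpha>) = mntr_vcomp (mntr_hcomp \<beta>' \<alpha>') (mntr_hcomp \<beta> \<alpha>)"
proof -
  define A B C where "A = fdom (tdom \<alpha>)" and "B = fcod (tdom \<alpha>)" and "C = fcod (tdom \<beta>)"
  note a = mntrsD[OF assms(1)]
  note a' = mntrsD[OF assms(2), unfolded assms(5) a(4,5)]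
  note b = mntrsD[OF assms(3), unfolded assms(7)]
  note b' = mntrsD[OF assms(4), unfolded assms(6) b(4,5)]
  interpret a: mntr_in A B "tdom \<alpha>" "tcod \<alpha>" \<alpha> using a by (simp add: A_def B_def)
  interpret a': mntr_in A B "tcod \<alpha>" "tcod \<alpha>'" \<alpha>' using a' by (simp add: A_def B_def)
  interpret b: mntr_in B C "tdom \<beta>" "tcod \<beta>" \<beta> using b by (simp add: C_def B_def)
  interpret b': mntr_in B C "tcod \<beta>" "tcod \<beta>'" \<beta>' using b' by (simp add: C_def B_def)
  note ss = a.F.ss a.G.ss a'.G.ss b.F.ss b.G.ss b'.G.ss a.ts a'.ts b.ts b'.ts
  have d: "fdom (tdom \<alpha>) = A" "fcod (tdom \<alpha>) = B" "fdom (tcod \<alpha>) = A" "fcod (tcod \<alpha>) = B"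
    "fdom (tcod \<alpha>') = A" "fcod (tcod \<alpha>') = B" "fdom (tdom \<beta>) = B" "fcod (tdom \<beta>) = C"
    "fdom (tcod \<beta>) = B" "fcod (tcod \<beta>) = C" "fdom (tcod \<beta>') = B" "fcod (tcod \<beta>') = C"
    using a b a' b' assms by (simp_all add: A_def B_def C_def)
  note s = all_simps d assms
  show ?thesis
  proof (rule mntr_eqI)
    show "mntr_hcomp (mntr_vcomp \<beta>' \<beta>) (mntr_vcomp \<alpha>' \<alpha>) \<in> mntrs"
      "mntr_vcomp (mntr_hcomp \<beta>' \<alpha>') (mntr_hcomp \<beta> \<alpha>) \<in> mntrs"
      by (intro in_intros, simp_all add: s)+
    fix x assume "x \<in> Obj (fdom (tdom (mntr_hcomp (mntr_vcomp \<beta>' \<beta>) (mntr_vcomp \<alpha>' \<alpha>))))"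
    then have x: "x \<in> Obj A" by (simp add: s)
    have n: "tmap \<beta> (fobj (tcod \<alpha>') x) \<cdot>\<^bsub>C\<^esub> farr (tdom \<beta>) (tmap \<alpha>' x) =
      farr (tcod \<beta>) (tmap \<alpha>' x) \<cdot>\<^bsub>C\<^esub> tmap \<beta> (fobj (tcod \<alpha>) x)"
      using b.tnat[of "tmap \<alpha>' x"] x by (simp add: ss)
    have "(tmap \<beta>' (fobj (tcod \<alpha>') x) \<cdot>\<^bsub>C\<^esub> tmap \<beta> (fobj (tcod \<alpha>') x)) \<cdot>\<^bsub>C\<^esub> (farr (tdom \<beta>) (tmap \<alpha>' x) \<cdot>\<^bsub>C\<^esub> farr (tdom \<beta>) (tmap \<alpha> x))
      = tmap \<beta>' (fobj (tcod \<alpha>') x) \<cdot>\<^bsub>C\<^esub> ((tmap \<beta> (fobj (tcod \<alpha>') x) \<cdot>\<^bsub>C\<^esub> farr (tdom \<beta>) (tmap \<alpha>' x)) \<cdot>\<^bsub>C\<^esub> farr (tdom \<beta>) (tmap \<alpha> x))"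
      using x by (simp add: ss b.F.B.assoc_simp)
    also have "\<dots> = (tmap \<beta>' (fobj (tcod \<alpha>') x) \<cdot>\<^bsub>C\<^esub> farr (tcod \<beta>) (tmap \<alpha>' x)) \<cdot>\<^bsub>C\<^esub> (tmap \<beta> (fobj (tcod \<alpha>) x) \<cdot>\<^bsub>C\<^esub> farr (tdom \<beta>) (tmap \<alpha> x))"
      unfolding n using x by (simp add: ss b.F.B.assoc_simp)
    finally show "tmap (mntr_hcomp (mntr_vcomp \<beta>' \<beta>) (mntr_vcomp \<alpha>' \<alpha>)) x =
      tmap (mntr_vcomp (mntr_hcomp \<beta>' \<alpha>') (mntr_hcomp \<beta> \<alpha>)) x"
      using x by (simp add: s ss b.F.Fcomp)
  qed (simp_all add: s)
qed

lemma mntr_hcomp_id_id: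
  assumes "F \<in> mftors" "G \<in> mftors" "fdom G = fcod F"
  shows "mntr_hcomp (mntr_id G) (mntr_id F) = mntr_id (mftor_comp G F)"
proof -
  interpret F: strong_monoidal_functor "fdom F" "fcod F" F using mftorsD[OF assms(1)] by simp
  interpret G: strong_monoidal_functor "fcod F" "fcod G" G using mftorsD[OF assms(2)] assms by simp
  show ?thesis
    by (rule mntr_eqI) (use assms in \<open>auto simp: all_simps in_intros F.ss G.ss\<close>)
qed

lemma mntr_hcomp_one:
  assumes "\<alpha> \<in> mntrs" shows "mntr_hcomp \<alpha> (mntr_id (mftor_id (fdom (tdom \<alpha>)))) = \<alpha>"
proof -
  note \<alpha> = mntrsD[OF assms]
  interpret t: mntr_in "fdom (tdom \<alpha>)" "fcod (tdom \<alpha>)" "tdom \<alpha>" "tcod \<alpha>" \<alpha> using \<alpha> by simp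
  have i: "mftor_id (fdom (tdom \<alpha>)) \<in> mftors" using \<alpha> by (simp add: in_intros mftorsD)
  have u: "mftor_comp (tcod \<alpha>) (mftor_id (fdom (tdom \<alpha>))) = tcod \<alpha>" using mftor_comp_id[OF \<alpha>(3)] \<alpha>(4) by simp
  show ?thesis
    by (rule mntr_eqI)
      (use \<alpha> assms i in \<open>auto simp: all_simps in_intros t.F.ss t.ts mftor_comp_id u\<close>)
qed

lemma mntr_one_hcomp:
  assumes "\<alpha> \<in> mntrs" shows "mntr_hcomp (mntr_id (mftor_id (fcod (tdom \<alpha>)))) \<alpha> = \<alpha>"
proof -
  note \<alpha> = mntrsD[OF assms]
  interpret t: mntr_in "fdom (tdom \<alpha>)" "fcod (tdom \<alpha>)" "tdom \<alpha>" "tcod \<alpha>" \<alpha> using \<alpha> by simp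
  have i: "mftor_id (fcod (tdom \<alpha>)) \<in> mftors" using \<alpha> by (simp add: in_intros mftorsD)
  have u: "mftor_comp (mftor_id (fcod (tdom \<alpha>))) (tcod \<alpha>) = tcod \<alpha>" using mftor_id_comp[OF \<alpha>(3)] \<alpha>(5) by simp
  show ?thesis
    by (rule mntr_eqI)
      (use \<alpha> assms i in \<open>auto simp: all_simps in_intros t.F.ss t.G.ss t.ts mftor_id_comp u\<close>)
qed

lemma mntr_hcomp_assoc:
  assumes "\<alpha> \<in> mntrs" "\<beta> \<in> mntrs" "\<gamma> \<in> mntrs" "fdom (tdom \<beta>) = fcod (tdom \<alpha>)" "fdom (tdom \<gamma>) = fcod (tdom \<beta>)"
  shows "mntr_hcomp (mntr_hcomp \<gamma> \<beta>) \<alpha> = mntr_hcomp \<gamma> (mntr_hcomp \<beta> \<alpha>)"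
proof -
  define A B C D where "A = fdom (tdom \<alpha>)" and "B = fcod (tdom \<alpha>)" and "C = fcod (tdom \<beta>)" and "D = fcod (tdom \<gamma>)"
  note a = mntrsD[OF assms(1)]
  note b = mntrsD[OF assms(2), unfolded assms(4)]
  note c = mntrsD[OF assms(3), unfolded assms(5)]
  interpret a: mntr_in A B "tdom \<alpha>" "tcod \<alpha>" \<alpha> using a by (simp add: A_def B_def)
  interpret b: mntr_in B C "tdom \<beta>" "tcod \<beta>" \<beta> using b by (simp add: C_def B_def)
  interpret c: mntr_in C D "tdom \<gamma>" "tcod \<gamma>" \<gamma> using c by (simp add: C_def D_def)
  note ss = a.F.ss a.G.ss b.F.ss b.G.ss c.F.ss c.G.ss a.ts b.ts c.ts
  have d: "fdom (tdom \<alpha>) = A" "fcod (tdom \<alpha>) = B" "fdom (tcod \<alpha>) = A" "fcod (tcod \<alpha>) = B"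
    "fdom (tdom \<beta>) = B" "fcod (tdom \<beta>) = C" "fdom (tcod \<beta>) = B" "fcod (tcod \<beta>) = C"
    "fdom (tdom \<gamma>) = C" "fcod (tdom \<gamma>) = D" "fdom (tcod \<gamma>) = C" "fcod (tcod \<gamma>) = D"
    using a b c assms by (simp_all add: A_def B_def C_def D_def)
  note s = all_simps d assms(1-3) mftor_comp_assoc a b c
  show ?thesis
  proof (rule mntr_eqI)
    show "mntr_hcomp (mntr_hcomp \<gamma> \<beta>) \<alpha> \<in> mntrs" "mntr_hcomp \<gamma> (mntr_hcomp \<beta> \<alpha>) \<in> mntrs"
      by (intro in_intros, simp_all add: all_simps d assms(1-3))+
    show "tdom (mntr_hcomp (mntr_hcomp \<gamma> \<beta>) \<alpha>) = tdom (mntr_hcomp \<gamma> (mntr_hcomp \<beta> \<alpha>))"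
      "tcod (mntr_hcomp (mntr_hcomp \<gamma> \<beta>) \<alpha>) = tcod (mntr_hcomp \<gamma> (mntr_hcomp \<beta> \<alpha>))"
      by (simp_all add: all_simps, (rule mftor_comp_assoc; use a b c in \<open>simp add: d\<close>)+)
    fix x assume "x \<in> Obj (fdom (tdom (mntr_hcomp (mntr_hcomp \<gamma> \<beta>) \<alpha>)))"
    then have x: "x \<in> Obj A" by (simp add: all_simps d)
    then show "tmap (mntr_hcomp (mntr_hcomp \<gamma> \<beta>) \<alpha>) x = tmap (mntr_hcomp \<gamma> (mntr_hcomp \<beta> \<alpha>)) x"
      by (simp add: all_simps d ss c.F.Fcomp c.F.B.assoc_simp)
  qed
qed

lemma two_category_MonCat_p: "two_category MonCat_p"
proof (rule two_category.intro)
  show "category (underlying MonCat_p)" "category (hom MonCat_p X Y)" for X Y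
    by (rule category_underlying_MonCat category_hom_MonCat)+
  show "\<exists>X \<in> Obj0 MonCat_p. \<exists>Y \<in> Obj0 MonCat_p. \<alpha> \<in> Arr (hom MonCat_p X Y)"
    if "\<alpha> \<in> Cell MonCat_p" for \<alpha>
    using that mntrsD[of \<alpha>] mftorsD[of "tdom \<alpha>"] by (auto simp: hom_MonCat MonCat_simps)
qed (auto simp: Hom_hom_MonCat hom_MonCat mor_MonCat MonCat_simps all_simps in_intros mntrsD
  mntr_interchange mntr_hcomp_id_id mntr_hcomp_one mntr_one_hcomp mntr_hcomp_assoc)

lemma hom_full_sub:
  assumes "X \<in> S" "Y \<in> S" shows "hom (full_sub C S) X Y = hom C X Y"
  using assms by (auto simp: hom_def full_sub_def mor_def)

lemma two_category_full_sub:
  assumes "two_category C" shows "two_category (full_sub C S)"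
proof -
  interpret two_category C by fact
  interpret U: category "underlying C" by (rule category_underlying)
  have fs: "cmp (full_sub C S) = cmp C" "vcmp (full_sub C S) = vcmp C" "hcmp (full_sub C S) = hcmp C"
     "cid (full_sub C S) = cid C" "one (full_sub C S) = one C" "cdom (full_sub C S) = cdom C" "ccod (full_sub C S) = ccod C"
     "Obj0 (full_sub C S) = Obj0 C \<inter> S" 
    by (simp_all add: full_sub_def)
  have m: "f \<in> mor (full_sub C S) X Y \<longleftrightarrow> f \<in> mor C X Y \<and> X \<in> S \<and> Y \<in> S" for f X Y
    by (auto simp: mor_def full_sub_def)
  have h: "f \<in> Arr (hom (full_sub C S) X Y) \<longleftrightarrow> f \<in> Arr (hom C X Y) \<and> X \<in> S \<and> Y \<in> S" for f X Y
    by (auto simp: mor_def full_sub_def hom_def)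
  have hh: "f \<in> Hom (hom (full_sub C S) X Y) u v \<longleftrightarrow> f \<in> Hom (hom C X Y) u v \<and> X \<in> S \<and> Y \<in> S" for f X Y u v
    by (auto simp: Hom_def h) (auto simp: hom_def fs)
  show ?thesis
  proof (rule two_category.intro)
    show "category (underlying (full_sub C S))"
      using U.category_axioms
      by (auto simp: category_def underlying_def full_sub_def Hom_def)
    show "category (hom (full_sub C S) X Y)" if "X \<in> Obj0 (full_sub C S)" "Y \<in> Obj0 (full_sub C S)" for X Y
      using that category_hom[of X Y] by (simp add: hom_full_sub fs)
    show "\<exists>X \<in> Obj0 (full_sub C S). \<exists>Y \<in> Obj0 (full_sub C S). \<alpha> \<in> Arr (hom (full_sub C S) X Y)"
      if "\<alpha> \<in> Cell (full_sub C S)" for \<alpha>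
      using Cell_hom[of \<alpha>] that unfolding h
      by (auto simp: full_sub_def hom_def mor_def)
  qed (auto simp: fs m h hh intro: hcmp_in hcmp_cid interchange hcmp_one one_hcmp hcmp_assoc)
qed

lemma two_category_SMonCat_p: "two_category SMonCat_p"
  unfolding SMonCat_p_def by (rule two_category_full_sub[OF two_category_MonCat_p])

end

theory Submission
  imports Defs
begin

text \<open>
  Write \<open>\<phi>\<^sub>x\<^sub>y\<close> for the structure maps \<open>fmult F x y\<close> of a strong monoidal functor \<open>F\<close>.

  Idempotents split in \<open>MonCat_p\<close>. Let \<open>E\<close> be an idempotent on \<open>A\<close>. The objects and arrows fixed
  by \<open>E\<close> form a category \<open>B\<close>, which becomes monoidal under \<open>E (x \<otimes> y)\<close>. The inclusion of \<open>B\<close> is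
  strong monoidal with structure maps \<open>\<phi>\<^sub>x\<^sub>y\<close>, and \<open>E\<close> itself, seen as a functor to \<open>B\<close>, is strong
  monoidal with structure maps \<open>E \<phi>\<^sub>x\<^sub>y\<close>. The equation \<open>E \<circ> E = E\<close> between monoidal functors contains
  the equation \<open>E \<phi>\<^sub>x\<^sub>y \<circ> \<phi>\<^sub>x\<^sub>y = \<phi>\<^sub>x\<^sub>y\<close> for fixed \<open>x\<close> and \<open>y\<close>. As \<open>\<phi>\<^sub>x\<^sub>y\<close> is invertible, \<open>E \<phi>\<^sub>x\<^sub>y\<close> is an
  identity there, and this makes the retraction a strict left inverse of the inclusion
  (\<open>idempotents_split_MonCat_p\<close>).

  Every monoidal category \<open>X\<close> is a retract of a strict one, namely of its strictification by words
  (\<open>retract_of_strict\<close>). A word evaluates to the product of its letters bracketed to the right, with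
  no unit appended, so that the word with the single letter \<open>x\<close> evaluates to \<open>x\<close> itself. Hence the
  composite from \<open>X\<close> to words and back is the identity, not merely isomorphic to it.

  Idempotents do not split in \<open>SMonCat_p\<close>. Two splittings of one idempotent are isomorphic; so if
  the idempotent on the strictification of \<open>X\<close> split through a strict monoidal category, then \<open>X\<close>
  would be isomorphic to a strict monoidal category. This fails for the preorder with three objects
  \<open>i\<close>, \<open>a\<close>, \<open>b\<close> in which \<open>a\<close> and \<open>b\<close> are isomorphic, with unit \<open>i\<close> and all products of
  \<open>a\<close> and \<open>b\<close> equal to \<open>i\<close>: an isomorphic strict structure would satisfy
  \<open>a = a(bb) = (ab)b = b\<close> (\<open>not_iso_strict\<close>).

  An accessible 2-category has \<open>\<lambda>\<close>-filtered colimits for some \<open>\<lambda>\<close>. An idempotent is a diagram on a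
  category with one object and one further arrow. That category is \<open>\<lambda>\<close>-filtered for every \<open>\<lambda>\<close>, and
  a colimit of the diagram splits the idempotent (\<open>filtered_colimits_split_idempotents\<close>).

  Both constructions of monoidal categories rest on \<open>monoidal_creation\<close>: a faithful functor which
  satisfies the coherence equations of a strong monoidal functor forces the axioms of a monoidal
  category on its domain.
\<close>

section \<open>Isomorphisms\<close>

definition arr_inv :: "('o, 'a, 'x) cat_scheme \<Rightarrow> 'a \<Rightarrow> 'a" where
  "arr_inv C f = (SOME g. g \<in> Hom C (Cod C f) (Dom C f) \<and>
    Comp C g f = Idt C (Dom C f) \<and> Comp C f g = Idt C (Cod C f))"

context category begin

lemma arr_inv:
  assumes "iso_in C f"
  shows "f \<in> Arr C" "arr_inv C f \<in> Arr C" "Dom C (arr_inv C f) = Cod C f"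
    "Cod C (arr_inv C f) = Dom C f"
    "arr_inv C f \<cdot> f = Idt C (Dom C f)" "f \<cdot> arr_inv C f = Idt C (Cod C f)"
    "iso_in C (arr_inv C f)"
proof -
  have "arr_inv C f \<in> Hom C (Cod C f) (Dom C f) \<and>
    arr_inv C f \<cdot> f = Idt C (Dom C f) \<and> f \<cdot> arr_inv C f = Idt C (Cod C f)"
    using assms unfolding iso_in_def arr_inv_def by (intro someI_ex[where P = "\<lambda>g. _ g \<and> _ g \<and> _ g"]) blast
  then show 1: "f \<in> Arr C" "arr_inv C f \<in> Arr C" "Dom C (arr_inv C f) = Cod C f"
    "Cod C (arr_inv C f) = Dom C f" "arr_inv C f \<cdot> f = Idt C (Dom C f)"
    "f \<cdot> arr_inv C f = Idt C (Cod C f)"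
    using assms by (auto simp: Hom_def iso_in_def)
  then show "iso_in C (arr_inv C f)" unfolding iso_in_def by (auto intro!: bexI[of _ f] HomI)
qed

lemma iso_cancel_right:
  assumes "iso_in C p" "g \<in> Arr C" "h \<in> Arr C" "Dom C g = Cod C p" "Dom C h = Cod C p"
    and "g \<cdot> p = h \<cdot> p"
  shows "g = h"
proof -
  have "g = (g \<cdot> p) \<cdot> arr_inv C p" using assms(2,4) arr_inv[OF assms(1)] by (simp add: assoc_simp arr_simps)
  also have "\<dots> = h" unfolding assms(6) using assms(3,5) arr_inv[OF assms(1)] by (simp add: assoc_simp arr_simps)
  finally show ?thesis .
qed

lemma iso_cancel_left:
  assumes "iso_in C p" "g \<in> Arr C" "h \<in> Arr C" "Cod C g = Dom C p" "Cod C h = Dom C p"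
    and "p \<cdot> g = p \<cdot> h"
  shows "g = h"
proof -
  have a: "arr_inv C p \<cdot> (p \<cdot> k) = k" if "k \<in> Arr C" "Cod C k = Dom C p" for k
  proof -
    have "arr_inv C p \<cdot> (p \<cdot> k) = (arr_inv C p \<cdot> p) \<cdot> k"
      using that arr_inv(1-4)[OF assms(1)] by (simp add: assoc_simp)
    also have "\<dots> = k" using that arr_inv[OF assms(1)] by (simp add: arr_simps)
    finally show ?thesis .
  qed
  show ?thesis using a[OF assms(2,4)] a[OF assms(3,5)] assms(6) by metis
qed

end

section \<open>Kelly's unit coherences\<close>

context monoidal_category begin

lemma tens_iso:
  assumes "iso_in C f" "iso_in C g" shows "iso_in C (f \<boxtimes> g)"
proof -
  note i = arr_inv[OF assms(1)] arr_inv[OF assms(2)]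
  show ?thesis unfolding iso_in_def using i
    by (auto intro!: bexI[of _ "arr_inv C f \<boxtimes> arr_inv C g"] HomI simp: cs tens_comp)
qed

lemma id_tens_comp:
  "x \<in> Obj C \<Longrightarrow> f \<in> Arr C \<Longrightarrow> g \<in> Arr C \<Longrightarrow> Dom C g = Cod C f \<Longrightarrow>
    Idt C x \<boxtimes> (g \<cdot> f) = (Idt C x \<boxtimes> g) \<cdot> (Idt C x \<boxtimes> f)"
  by (simp add: tens_comp cs)

lemma tens_id_comp:
  "x \<in> Obj C \<Longrightarrow> f \<in> Arr C \<Longrightarrow> g \<in> Arr C \<Longrightarrow> Dom C g = Cod C f \<Longrightarrow>
    (g \<cdot> f) \<boxtimes> Idt C x = (g \<boxtimes> Idt C x) \<cdot> (f \<boxtimes> Idt C x)"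
  by (simp add: tens_comp cs)

lemma assoc_nat:
  "f \<in> Arr C \<Longrightarrow> g \<in> Arr C \<Longrightarrow> h \<in> Arr C \<Longrightarrow> Dom C f = x \<Longrightarrow> Dom C g = y \<Longrightarrow> Dom C h = z \<Longrightarrow>
    Cod C f = x' \<Longrightarrow> Cod C g = y' \<Longrightarrow> Cod C h = z' \<Longrightarrow>
    Assoc C x' y' z' \<cdot> ((f \<boxtimes> g) \<boxtimes> h) = (f \<boxtimes> (g \<boxtimes> h)) \<cdot> Assoc C x y z"
  by (rule Assoc_nat[OF HomI HomI HomI])

lemma lunit_nat:
  "f \<in> Arr C \<Longrightarrow> Dom C f = x \<Longrightarrow> Cod C f = y \<Longrightarrow> LUnit C y \<cdot> (Idt C \<one> \<boxtimes> f) = f \<cdot> LUnit C x"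
  by (rule LUnit_nat[OF HomI])

lemma runit_nat:
  "f \<in> Arr C \<Longrightarrow> Dom C f = x \<Longrightarrow> Cod C f = y \<Longrightarrow> RUnit C y \<cdot> (f \<boxtimes> Idt C \<one>) = f \<cdot> RUnit C x"
  by (rule RUnit_nat[OF HomI])

text \<open>
  The unitors are natural isomorphisms from tensoring with the unit to the identity functor, so
  tensoring with the unit is faithful.
\<close>

lemma unit_tens_faithful:
  assumes "f \<in> Arr C" "g \<in> Arr C" "Dom C f = Dom C g" "Cod C f = Cod C g"
    and "Idt C \<one> \<boxtimes> f = Idt C \<one> \<boxtimes> g"
  shows "f = g"
  by (rule iso_cancel_right[OF LUnit_iso[of "Dom C f"]])
    (use assms lunit_nat[of f] lunit_nat[of g] in \<open>simp_all add: cs\<close>)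

lemma tens_unit_faithful:
  assumes "f \<in> Arr C" "g \<in> Arr C" "Dom C f = Dom C g" "Cod C f = Cod C g"
    and "f \<boxtimes> Idt C \<one> = g \<boxtimes> Idt C \<one>"
  shows "f = g"
  by (rule iso_cancel_right[OF RUnit_iso[of "Dom C f"]])
    (use assms runit_nat[of f] runit_nat[of g] in \<open>simp_all add: cs\<close>)

text \<open>
  After tensoring with the unit on the left and composing with two associators, both sides are
  brought together by the pentagon for \<open>\<one>, \<one>, x, y\<close> and two instances of the triangle.
\<close>

lemma LUnit_tens:
  assumes o: "x \<in> Obj C" "y \<in> Obj C"
  shows "LUnit C (x \<otimes> y) \<cdot> Assoc C \<one> x y = LUnit C x \<boxtimes> Idt C y"
proof (rule unit_tens_faithful)
  let ?i = "Idt C \<one>" and ?a = "Assoc C"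
  show "?i \<boxtimes> (LUnit C (x \<otimes> y) \<cdot> ?a \<one> x y) = ?i \<boxtimes> (LUnit C x \<boxtimes> Idt C y)"
  proof (rule iso_cancel_right)
    show "iso_in C (?a \<one> (\<one> \<otimes> x) y \<cdot> (?a \<one> \<one> x \<boxtimes> Idt C y))"
      using o by (intro iso_in_Comp tens_iso Assoc_iso iso_in_Idt) (simp_all add: cs)
    have "(?i \<boxtimes> (LUnit C (x \<otimes> y) \<cdot> ?a \<one> x y)) \<cdot> (?a \<one> (\<one> \<otimes> x) y \<cdot> (?a \<one> \<one> x \<boxtimes> Idt C y))
      = (?i \<boxtimes> LUnit C (x \<otimes> y)) \<cdot> ((?i \<boxtimes> ?a \<one> x y) \<cdot> ?a \<one> (\<one> \<otimes> x) y \<cdot> (?a \<one> \<one> x \<boxtimes> Idt C y))"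
      using o by (simp add: cs id_tens_comp assoc_simp)
    also have "\<dots> = ((?i \<boxtimes> LUnit C (x \<otimes> y)) \<cdot> ?a \<one> \<one> (x \<otimes> y)) \<cdot> ?a (\<one> \<otimes> \<one>) x y"
      using o pentagon[of \<one> \<one> x y] by (simp add: cs assoc_simp)
    also have "\<dots> = (RUnit C \<one> \<boxtimes> (Idt C x \<boxtimes> Idt C y)) \<cdot> ?a (\<one> \<otimes> \<one>) x y"
      using o triangle[of \<one> "x \<otimes> y"] by (simp add: cs)
    also have "\<dots> = ?a \<one> x y \<cdot> ((RUnit C \<one> \<boxtimes> Idt C x) \<boxtimes> Idt C y)"
      using o by (intro assoc_nat[symmetric]) (simp_all add: cs)
    also have "\<dots> = (?a \<one> x y \<cdot> ((?i \<boxtimes> LUnit C x) \<boxtimes> Idt C y)) \<cdot> (?a \<one> \<one> x \<boxtimes> Idt C y)"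
      using o triangle[of \<one> x, symmetric] by (simp add: cs tens_id_comp assoc_simp)
    also have "?a \<one> x y \<cdot> ((?i \<boxtimes> LUnit C x) \<boxtimes> Idt C y) = (?i \<boxtimes> (LUnit C x \<boxtimes> Idt C y)) \<cdot> ?a \<one> (\<one> \<otimes> x) y"
      using o by (intro assoc_nat) (simp_all add: cs)
    finally show "(?i \<boxtimes> (LUnit C (x \<otimes> y) \<cdot> ?a \<one> x y)) \<cdot> (?a \<one> (\<one> \<otimes> x) y \<cdot> (?a \<one> \<one> x \<boxtimes> Idt C y)) =
      (?i \<boxtimes> (LUnit C x \<boxtimes> Idt C y)) \<cdot> (?a \<one> (\<one> \<otimes> x) y \<cdot> (?a \<one> \<one> x \<boxtimes> Idt C y))"
      using o by (simp add: cs assoc_simp)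
  qed (use o in \<open>simp_all add: cs\<close>)
qed (use o in \<open>simp_all add: cs\<close>)

text \<open>
  The mirror image of the preceding argument, with the pentagon for \<open>x, y, \<one>, \<one>\<close>.
\<close>

lemma RUnit_tens:
  assumes o: "x \<in> Obj C" "y \<in> Obj C"
  shows "(Idt C x \<boxtimes> RUnit C y) \<cdot> Assoc C x y \<one> = RUnit C (x \<otimes> y)"
proof (rule tens_unit_faithful)
  let ?i = "Idt C \<one>" and ?a = "Assoc C"
  show "((Idt C x \<boxtimes> RUnit C y) \<cdot> ?a x y \<one>) \<boxtimes> ?i = RUnit C (x \<otimes> y) \<boxtimes> ?i"
  proof (rule iso_cancel_left)
    show "iso_in C (?a x y \<one>)" using o by (intro Assoc_iso) (simp_all add: cs)
    have "?a x y \<one> \<cdot> (((Idt C x \<boxtimes> RUnit C y) \<cdot> ?a x y \<one>) \<boxtimes> ?i)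
      = (?a x y \<one> \<cdot> ((Idt C x \<boxtimes> RUnit C y) \<boxtimes> ?i)) \<cdot> (?a x y \<one> \<boxtimes> ?i)"
      using o by (simp add: cs tens_id_comp assoc_simp)
    also have "?a x y \<one> \<cdot> ((Idt C x \<boxtimes> RUnit C y) \<boxtimes> ?i) = (Idt C x \<boxtimes> (RUnit C y \<boxtimes> ?i)) \<cdot> ?a x (y \<otimes> \<one>) \<one>"
      using o by (intro assoc_nat) (simp_all add: cs)
    also have "Idt C x \<boxtimes> (RUnit C y \<boxtimes> ?i) = (Idt C x \<boxtimes> (Idt C y \<boxtimes> LUnit C \<one>)) \<cdot> (Idt C x \<boxtimes> ?a y \<one> \<one>)"
      using o triangle[of y \<one>, symmetric] by (simp add: cs id_tens_comp)
    also have "\<dots> \<cdot> ?a x (y \<otimes> \<one>) \<one> \<cdot> (?a x y \<one> \<boxtimes> ?i)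
      = (Idt C x \<boxtimes> (Idt C y \<boxtimes> LUnit C \<one>)) \<cdot> ((Idt C x \<boxtimes> ?a y \<one> \<one>) \<cdot> ?a x (y \<otimes> \<one>) \<one> \<cdot> (?a x y \<one> \<boxtimes> ?i))"
      using o by (simp add: cs assoc_simp)
    also have "\<dots> = ((Idt C x \<boxtimes> (Idt C y \<boxtimes> LUnit C \<one>)) \<cdot> ?a x y (\<one> \<otimes> \<one>)) \<cdot> ?a (x \<otimes> y) \<one> \<one>"
      using o pentagon[of x y \<one> \<one>] by (simp add: cs assoc_simp)
    also have "(Idt C x \<boxtimes> (Idt C y \<boxtimes> LUnit C \<one>)) \<cdot> ?a x y (\<one> \<otimes> \<one>) = ?a x y \<one> \<cdot> ((Idt C x \<boxtimes> Idt C y) \<boxtimes> LUnit C \<one>)"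
      using o by (intro assoc_nat[symmetric]) (simp_all add: cs)
    also have "\<dots> \<cdot> ?a (x \<otimes> y) \<one> \<one> = ?a x y \<one> \<cdot> (RUnit C (x \<otimes> y) \<boxtimes> ?i)"
      using o triangle[of "x \<otimes> y" \<one>] by (simp add: cs assoc_simp)
    finally show "?a x y \<one> \<cdot> (((Idt C x \<boxtimes> RUnit C y) \<cdot> ?a x y \<one>) \<boxtimes> ?i) = ?a x y \<one> \<cdot> (RUnit C (x \<otimes> y) \<boxtimes> ?i)" .
  qed (use o in \<open>simp_all add: cs\<close>)
qed (use o in \<open>simp_all add: cs\<close>)

text \<open>
  Naturality of the left unitor at itself identifies \<open>LUnit C (\<one> \<otimes> \<one>)\<close> with
  \<open>Idt C \<one> \<boxtimes> LUnit C \<one>\<close>; then \<open>LUnit_tens\<close> and the triangle have the same left-hand side.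
\<close>

lemma LUnit_unit: "LUnit C \<one> = RUnit C \<one>"
proof (rule tens_unit_faithful)
  have "LUnit C (\<one> \<otimes> \<one>) = Idt C \<one> \<boxtimes> LUnit C \<one>"
    by (rule iso_cancel_left[OF LUnit_iso[of \<one>]]) (simp_all add: cs lunit_nat)
  then show "LUnit C \<one> \<boxtimes> Idt C \<one> = RUnit C \<one> \<boxtimes> Idt C \<one>"
    using LUnit_tens[of \<one> \<one>] triangle[of \<one> \<one>] by (simp add: cs)
qed (simp_all add: cs)

end

section \<open>Creating monoidal structure along a faithful functor\<close>

text \<open>
  \<open>B\<close> carries the operations of a monoidal category, but of the axioms only the typing and the
  invertibility of the structure maps are assumed. The remaining assumptions say that \<open>F\<close> is
  faithful and satisfies the equations of a strong monoidal functor; those equations express the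
  image under \<open>F\<close> of each operation of \<open>B\<close> through the corresponding operation of \<open>A\<close>.
\<close>

locale monoidal_creation = A: monoidal_category A + B: category B
  for A B :: "('u, 'u) moncat" +
  fixes F :: "'u mftor"
  assumes fdom: "fdom F = B" and fcod: "fcod F = A"
    and is_functor: "is_functor B A (fobj F) (farr F)"
    and faithful: "f \<in> Arr B \<Longrightarrow> g \<in> Arr B \<Longrightarrow> Dom B f = Dom B g \<Longrightarrow> Cod B f = Cod B g \<Longrightarrow>
      farr F f = farr F g \<Longrightarrow> f = g"
    and Tens_in: "x \<in> Obj B \<Longrightarrow> y \<in> Obj B \<Longrightarrow> x \<otimes>\<^bsub>B\<^esub> y \<in> Obj B"
    and TensA_in: "f \<in> Arr B \<Longrightarrow> g \<in> Arr B \<Longrightarrow>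
      f \<boxtimes>\<^bsub>B\<^esub> g \<in> Hom B (Dom B f \<otimes>\<^bsub>B\<^esub> Dom B g) (Cod B f \<otimes>\<^bsub>B\<^esub> Cod B g)"
    and Unit_in: "\<one>\<^bsub>B\<^esub> \<in> Obj B"
    and Assoc_in: "x \<in> Obj B \<Longrightarrow> y \<in> Obj B \<Longrightarrow> z \<in> Obj B \<Longrightarrow>
      Assoc B x y z \<in> Hom B ((x \<otimes>\<^bsub>B\<^esub> y) \<otimes>\<^bsub>B\<^esub> z) (x \<otimes>\<^bsub>B\<^esub> (y \<otimes>\<^bsub>B\<^esub> z))"
    and Assoc_iso: "x \<in> Obj B \<Longrightarrow> y \<in> Obj B \<Longrightarrow> z \<in> Obj B \<Longrightarrow> iso_in B (Assoc B x y z)"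
    and LUnit_in: "x \<in> Obj B \<Longrightarrow> LUnit B x \<in> Hom B (\<one>\<^bsub>B\<^esub> \<otimes>\<^bsub>B\<^esub> x) x"
    and LUnit_iso: "x \<in> Obj B \<Longrightarrow> iso_in B (LUnit B x)"
    and RUnit_in: "x \<in> Obj B \<Longrightarrow> RUnit B x \<in> Hom B (x \<otimes>\<^bsub>B\<^esub> \<one>\<^bsub>B\<^esub>) x"
    and RUnit_iso: "x \<in> Obj B \<Longrightarrow> iso_in B (RUnit B x)"
    and fmult_in: "x \<in> Obj B \<Longrightarrow> y \<in> Obj B \<Longrightarrow>
      fmult F x y \<in> Hom A (fobj F x \<otimes>\<^bsub>A\<^esub> fobj F y) (fobj F (x \<otimes>\<^bsub>B\<^esub> y))"
    and fmult_iso: "x \<in> Obj B \<Longrightarrow> y \<in> Obj B \<Longrightarrow> iso_in A (fmult F x y)"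
    and fmult_nat: "f \<in> Arr B \<Longrightarrow> g \<in> Arr B \<Longrightarrow>
      fmult F (Cod B f) (Cod B g) \<cdot>\<^bsub>A\<^esub> (farr F f \<boxtimes>\<^bsub>A\<^esub> farr F g) =
      farr F (f \<boxtimes>\<^bsub>B\<^esub> g) \<cdot>\<^bsub>A\<^esub> fmult F (Dom B f) (Dom B g)"
    and funit_in: "funit F \<in> Hom A \<one>\<^bsub>A\<^esub> (fobj F \<one>\<^bsub>B\<^esub>)"
    and funit_iso: "iso_in A (funit F)"
    and fmult_assoc: "x \<in> Obj B \<Longrightarrow> y \<in> Obj B \<Longrightarrow> z \<in> Obj B \<Longrightarrow>
      farr F (Assoc B x y z) \<cdot>\<^bsub>A\<^esub> fmult F (x \<otimes>\<^bsub>B\<^esub> y) z \<cdot>\<^bsub>A\<^esub> (fmult F x y \<boxtimes>\<^bsub>A\<^esub> Idt A (fobj F z)) =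
      fmult F x (y \<otimes>\<^bsub>B\<^esub> z) \<cdot>\<^bsub>A\<^esub> (Idt A (fobj F x) \<boxtimes>\<^bsub>A\<^esub> fmult F y z)
        \<cdot>\<^bsub>A\<^esub> Assoc A (fobj F x) (fobj F y) (fobj F z)"
    and fmult_LUnit: "x \<in> Obj B \<Longrightarrow>
      farr F (LUnit B x) \<cdot>\<^bsub>A\<^esub> fmult F \<one>\<^bsub>B\<^esub> x \<cdot>\<^bsub>A\<^esub> (funit F \<boxtimes>\<^bsub>A\<^esub> Idt A (fobj F x)) = LUnit A (fobj F x)"
    and fmult_RUnit: "x \<in> Obj B \<Longrightarrow>
      farr F (RUnit B x) \<cdot>\<^bsub>A\<^esub> fmult F x \<one>\<^bsub>B\<^esub> \<cdot>\<^bsub>A\<^esub> (Idt A (fobj F x) \<boxtimes>\<^bsub>A\<^esub> funit F) = RUnit A (fobj F x)"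
begin

lemmas Fs = functorD(1-5)[OF is_functor]
lemmas Fcomp = functorD(6)[OF is_functor]

lemma phi:
  "x \<in> Obj B \<Longrightarrow> y \<in> Obj B \<Longrightarrow> fmult F x y \<in> Arr A"
  "x \<in> Obj B \<Longrightarrow> y \<in> Obj B \<Longrightarrow> Dom A (fmult F x y) = fobj F x \<otimes>\<^bsub>A\<^esub> fobj F y"
  "x \<in> Obj B \<Longrightarrow> y \<in> Obj B \<Longrightarrow> Cod A (fmult F x y) = fobj F (x \<otimes>\<^bsub>B\<^esub> y)"
  "funit F \<in> Arr A" "Dom A (funit F) = \<one>\<^bsub>A\<^esub>" "Cod A (funit F) = fobj F \<one>\<^bsub>B\<^esub>"
  using fmult_in funit_in by (auto simp: Hom_def)

lemma structure_simps:
  "f \<in> Arr B \<Longrightarrow> g \<in> Arr B \<Longrightarrow> f \<boxtimes>\<^bsub>B\<^esub> g \<in> Arr B"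
  "f \<in> Arr B \<Longrightarrow> g \<in> Arr B \<Longrightarrow> Dom B (f \<boxtimes>\<^bsub>B\<^esub> g) = Dom B f \<otimes>\<^bsub>B\<^esub> Dom B g"
  "f \<in> Arr B \<Longrightarrow> g \<in> Arr B \<Longrightarrow> Cod B (f \<boxtimes>\<^bsub>B\<^esub> g) = Cod B f \<otimes>\<^bsub>B\<^esub> Cod B g"
  "x \<in> Obj B \<Longrightarrow> y \<in> Obj B \<Longrightarrow> z \<in> Obj B \<Longrightarrow> Assoc B x y z \<in> Arr B"
  "x \<in> Obj B \<Longrightarrow> y \<in> Obj B \<Longrightarrow> z \<in> Obj B \<Longrightarrow> Dom B (Assoc B x y z) = (x \<otimes>\<^bsub>B\<^esub> y) \<otimes>\<^bsub>B\<^esub> z"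
  "x \<in> Obj B \<Longrightarrow> y \<in> Obj B \<Longrightarrow> z \<in> Obj B \<Longrightarrow> Cod B (Assoc B x y z) = x \<otimes>\<^bsub>B\<^esub> (y \<otimes>\<^bsub>B\<^esub> z)"
  "x \<in> Obj B \<Longrightarrow> LUnit B x \<in> Arr B" "x \<in> Obj B \<Longrightarrow> Dom B (LUnit B x) = \<one>\<^bsub>B\<^esub> \<otimes>\<^bsub>B\<^esub> x"
  "x \<in> Obj B \<Longrightarrow> Cod B (LUnit B x) = x"
  "x \<in> Obj B \<Longrightarrow> RUnit B x \<in> Arr B" "x \<in> Obj B \<Longrightarrow> Dom B (RUnit B x) = x \<otimes>\<^bsub>B\<^esub> \<one>\<^bsub>B\<^esub>"
  "x \<in> Obj B \<Longrightarrow> Cod B (RUnit B x) = x"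
  using TensA_in Assoc_in LUnit_in RUnit_in by (auto simp: Hom_def)

lemmas ss = A.cs B.arr_simps Tens_in Unit_in structure_simps Fs phi

lemma phi_nat:
  "f \<in> Arr B \<Longrightarrow> g \<in> Arr B \<Longrightarrow> Dom B f = x \<Longrightarrow> Dom B g = y \<Longrightarrow> Cod B f = x' \<Longrightarrow> Cod B g = y' \<Longrightarrow>
    fmult F x' y' \<cdot>\<^bsub>A\<^esub> (farr F f \<boxtimes>\<^bsub>A\<^esub> farr F g) = farr F (f \<boxtimes>\<^bsub>B\<^esub> g) \<cdot>\<^bsub>A\<^esub> fmult F x y"
  using fmult_nat by blast

text \<open>
  Each axiom of \<open>B\<close> below is an equation between parallel arrows. Its image under \<open>F\<close> is compared
  with the corresponding axiom of \<open>A\<close> after precomposition with an isomorphism \<open>p\<close> assembled from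
  \<open>fmult F\<close> and \<open>funit F\<close>; then \<open>p\<close> is cancelled and faithfulness applied.
\<close>

lemma eqI:
  assumes "iso_in A p" "farr F f \<cdot>\<^bsub>A\<^esub> p = farr F g \<cdot>\<^bsub>A\<^esub> p"
    "f \<in> Arr B" "g \<in> Arr B" "Dom B f = Dom B g" "Cod B f = Cod B g" "Cod A p = fobj F (Dom B f)"
  shows "f = g"
  by (rule faithful[OF assms(3-6)], rule A.iso_cancel_right[OF assms(1)])
    (use assms in \<open>simp_all add: ss\<close>)

lemma TensA_Id: 
  assumes "x \<in> Obj B" "y \<in> Obj B" shows "Idt B x \<boxtimes>\<^bsub>B\<^esub> Idt B y = Idt B (x \<otimes>\<^bsub>B\<^esub> y)"
  by (rule eqI[OF fmult_iso[OF assms]])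
    (use assms phi_nat[of "Idt B x" "Idt B y", symmetric] in \<open>simp_all add: ss\<close>)

lemma TensA_Comp:
  assumes "f \<in> Arr B" "f' \<in> Arr B" "g \<in> Arr B" "g' \<in> Arr B" "Dom B f' = Cod B f" "Dom B g' = Cod B g"
  shows "(f' \<cdot>\<^bsub>B\<^esub> f) \<boxtimes>\<^bsub>B\<^esub> (g' \<cdot>\<^bsub>B\<^esub> g) = (f' \<boxtimes>\<^bsub>B\<^esub> g') \<cdot>\<^bsub>B\<^esub> (f \<boxtimes>\<^bsub>B\<^esub> g)"
proof (rule eqI[OF fmult_iso[of "Dom B f" "Dom B g"]])
  let ?p = "fmult F (Dom B f) (Dom B g)"
  have "farr F ((f' \<boxtimes>\<^bsub>B\<^esub> g') \<cdot>\<^bsub>B\<^esub> (f \<boxtimes>\<^bsub>B\<^esub> g)) \<cdot>\<^bsub>A\<^esub> ?p = farr F (f' \<boxtimes>\<^bsub>B\<^esub> g') \<cdot>\<^bsub>A\<^esub> (farr F (f \<boxtimes>\<^bsub>B\<^esub> g) \<cdot>\<^bsub>A\<^esub> ?p)"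
    using assms by (simp add: ss Fcomp A.assoc_simp)
  also have "\<dots> = farr F (f' \<boxtimes>\<^bsub>B\<^esub> g') \<cdot>\<^bsub>A\<^esub> (fmult F (Cod B f) (Cod B g) \<cdot>\<^bsub>A\<^esub> (farr F f \<boxtimes>\<^bsub>A\<^esub> farr F g))"
    using assms by (simp add: fmult_nat)
  also have "\<dots> = (farr F (f' \<boxtimes>\<^bsub>B\<^esub> g') \<cdot>\<^bsub>A\<^esub> fmult F (Dom B f') (Dom B g')) \<cdot>\<^bsub>A\<^esub> (farr F f \<boxtimes>\<^bsub>A\<^esub> farr F g)"
    using assms by (simp add: ss A.assoc_simp)
  also have "\<dots> = fmult F (Cod B f') (Cod B g') \<cdot>\<^bsub>A\<^esub> (farr F (f' \<cdot>\<^bsub>B\<^esub> f) \<boxtimes>\<^bsub>A\<^esub> farr F (g' \<cdot>\<^bsub>B\<^esub> g))"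
    unfolding fmult_nat[OF assms(2,4), symmetric] using assms by (simp add: ss A.assoc_simp A.tens_comp Fcomp)
  also have "\<dots> = farr F ((f' \<cdot>\<^bsub>B\<^esub> f) \<boxtimes>\<^bsub>B\<^esub> (g' \<cdot>\<^bsub>B\<^esub> g)) \<cdot>\<^bsub>A\<^esub> ?p"
    using assms by (intro phi_nat) (simp_all add: ss)
  finally show "farr F ((f' \<cdot>\<^bsub>B\<^esub> f) \<boxtimes>\<^bsub>B\<^esub> (g' \<cdot>\<^bsub>B\<^esub> g)) \<cdot>\<^bsub>A\<^esub> ?p = farr F ((f' \<boxtimes>\<^bsub>B\<^esub> g') \<cdot>\<^bsub>B\<^esub> (f \<boxtimes>\<^bsub>B\<^esub> g)) \<cdot>\<^bsub>A\<^esub> ?p" ..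
qed (use assms in \<open>simp_all add: ss\<close>)

lemma Assoc_nat:
  assumes a: "f \<in> Arr B" "g \<in> Arr B" "h \<in> Arr B"
  shows "Assoc B (Cod B f) (Cod B g) (Cod B h) \<cdot>\<^bsub>B\<^esub> ((f \<boxtimes>\<^bsub>B\<^esub> g) \<boxtimes>\<^bsub>B\<^esub> h) =
    (f \<boxtimes>\<^bsub>B\<^esub> (g \<boxtimes>\<^bsub>B\<^esub> h)) \<cdot>\<^bsub>B\<^esub> Assoc B (Dom B f) (Dom B g) (Dom B h)"
proof -
  define x y z x' y' z' where d: "x = Dom B f" "y = Dom B g" "z = Dom B h" "x' = Cod B f" "y' = Cod B g" "z' = Cod B h"
  have o: "x \<in> Obj B" "y \<in> Obj B" "z \<in> Obj B" "x' \<in> Obj B" "y' \<in> Obj B" "z' \<in> Obj B"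
    and e: "Dom B f = x" "Dom B g = y" "Dom B h = z" "Cod B f = x'" "Cod B g = y'" "Cod B h = z'"
    using a by (simp_all add: d ss)
  note s = a o e ss
  let ?F = "farr F" and ?m = "fmult F" and ?p = "fmult F (x \<otimes>\<^bsub>B\<^esub> y) z \<cdot>\<^bsub>A\<^esub> (fmult F x y \<boxtimes>\<^bsub>A\<^esub> Idt A (fobj F z))"
  have i: "iso_in A ?p"
    using o by (intro A.iso_in_Comp A.tens_iso fmult_iso A.iso_in_Idt) (simp_all add: ss)
  have "?F (Assoc B x' y' z' \<cdot>\<^bsub>B\<^esub> ((f \<boxtimes>\<^bsub>B\<^esub> g) \<boxtimes>\<^bsub>B\<^esub> h)) \<cdot>\<^bsub>A\<^esub> ?p
    = ?F (Assoc B x' y' z') \<cdot>\<^bsub>A\<^esub> (?F ((f \<boxtimes>\<^bsub>B\<^esub> g) \<boxtimes>\<^bsub>B\<^esub> h) \<cdot>\<^bsub>A\<^esub> ?m (x \<otimes>\<^bsub>B\<^esub> y) z) \<cdot>\<^bsub>A\<^esub> (?m x y \<boxtimes>\<^bsub>A\<^esub> Idt A (fobj F z))"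
    by (simp add: s A.assoc_simp Fcomp)
  also have "?F ((f \<boxtimes>\<^bsub>B\<^esub> g) \<boxtimes>\<^bsub>B\<^esub> h) \<cdot>\<^bsub>A\<^esub> ?m (x \<otimes>\<^bsub>B\<^esub> y) z = ?m (x' \<otimes>\<^bsub>B\<^esub> y') z' \<cdot>\<^bsub>A\<^esub> (?F (f \<boxtimes>\<^bsub>B\<^esub> g) \<boxtimes>\<^bsub>A\<^esub> ?F h)"
    by (intro phi_nat[symmetric]) (simp_all add: s)
  also have "?F (Assoc B x' y' z') \<cdot>\<^bsub>A\<^esub> (?m (x' \<otimes>\<^bsub>B\<^esub> y') z' \<cdot>\<^bsub>A\<^esub> (?F (f \<boxtimes>\<^bsub>B\<^esub> g) \<boxtimes>\<^bsub>A\<^esub> ?F h)) \<cdot>\<^bsub>A\<^esub> (?m x y \<boxtimes>\<^bsub>A\<^esub> Idt A (fobj F z))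
    = ?F (Assoc B x' y' z') \<cdot>\<^bsub>A\<^esub> ?m (x' \<otimes>\<^bsub>B\<^esub> y') z' \<cdot>\<^bsub>A\<^esub> ((?F (f \<boxtimes>\<^bsub>B\<^esub> g) \<cdot>\<^bsub>A\<^esub> ?m x y) \<boxtimes>\<^bsub>A\<^esub> ?F h)"
    by (simp add: s A.assoc_simp A.tens_comp)
  also have "?F (f \<boxtimes>\<^bsub>B\<^esub> g) \<cdot>\<^bsub>A\<^esub> ?m x y = ?m x' y' \<cdot>\<^bsub>A\<^esub> (?F f \<boxtimes>\<^bsub>A\<^esub> ?F g)"
    by (intro phi_nat[symmetric]) (simp_all add: s)
  also have "?F (Assoc B x' y' z') \<cdot>\<^bsub>A\<^esub> ?m (x' \<otimes>\<^bsub>B\<^esub> y') z' \<cdot>\<^bsub>A\<^esub> ((?m x' y' \<cdot>\<^bsub>A\<^esub> (?F f \<boxtimes>\<^bsub>A\<^esub> ?F g)) \<boxtimes>\<^bsub>A\<^esub> ?F h)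
    = (?F (Assoc B x' y' z') \<cdot>\<^bsub>A\<^esub> ?m (x' \<otimes>\<^bsub>B\<^esub> y') z' \<cdot>\<^bsub>A\<^esub> (?m x' y' \<boxtimes>\<^bsub>A\<^esub> Idt A (fobj F z'))) \<cdot>\<^bsub>A\<^esub> ((?F f \<boxtimes>\<^bsub>A\<^esub> ?F g) \<boxtimes>\<^bsub>A\<^esub> ?F h)"
    by (simp add: s A.assoc_simp A.tens_comp)
  also have "\<dots> = ?m x' (y' \<otimes>\<^bsub>B\<^esub> z') \<cdot>\<^bsub>A\<^esub> (Idt A (fobj F x') \<boxtimes>\<^bsub>A\<^esub> ?m y' z') \<cdot>\<^bsub>A\<^esub>
      (Assoc A (fobj F x') (fobj F y') (fobj F z') \<cdot>\<^bsub>A\<^esub> ((?F f \<boxtimes>\<^bsub>A\<^esub> ?F g) \<boxtimes>\<^bsub>A\<^esub> ?F h))"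
    unfolding fmult_assoc[OF o(4-6)] by (simp add: s A.assoc_simp)
  also have "Assoc A (fobj F x') (fobj F y') (fobj F z') \<cdot>\<^bsub>A\<^esub> ((?F f \<boxtimes>\<^bsub>A\<^esub> ?F g) \<boxtimes>\<^bsub>A\<^esub> ?F h)
    = (?F f \<boxtimes>\<^bsub>A\<^esub> (?F g \<boxtimes>\<^bsub>A\<^esub> ?F h)) \<cdot>\<^bsub>A\<^esub> Assoc A (fobj F x) (fobj F y) (fobj F z)"
    by (intro A.assoc_nat) (simp_all add: s)
  also have "?m x' (y' \<otimes>\<^bsub>B\<^esub> z') \<cdot>\<^bsub>A\<^esub> (Idt A (fobj F x') \<boxtimes>\<^bsub>A\<^esub> ?m y' z') \<cdot>\<^bsub>A\<^esub> \<dots>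
    = ?m x' (y' \<otimes>\<^bsub>B\<^esub> z') \<cdot>\<^bsub>A\<^esub> (?F f \<boxtimes>\<^bsub>A\<^esub> (?m y' z' \<cdot>\<^bsub>A\<^esub> (?F g \<boxtimes>\<^bsub>A\<^esub> ?F h))) \<cdot>\<^bsub>A\<^esub> Assoc A (fobj F x) (fobj F y) (fobj F z)"
  proof -
    have "(Idt A (fobj F x') \<boxtimes>\<^bsub>A\<^esub> ?m y' z') \<cdot>\<^bsub>A\<^esub> (?F f \<boxtimes>\<^bsub>A\<^esub> (?F g \<boxtimes>\<^bsub>A\<^esub> ?F h)) = ?F f \<boxtimes>\<^bsub>A\<^esub> (?m y' z' \<cdot>\<^bsub>A\<^esub> (?F g \<boxtimes>\<^bsub>A\<^esub> ?F h))"
      by (simp add: s A.tens_comp)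
    from this[symmetric] show ?thesis by (simp add: s A.assoc_simp)
  qed
  also have "?m y' z' \<cdot>\<^bsub>A\<^esub> (?F g \<boxtimes>\<^bsub>A\<^esub> ?F h) = ?F (g \<boxtimes>\<^bsub>B\<^esub> h) \<cdot>\<^bsub>A\<^esub> ?m y z"
    by (intro phi_nat) (simp_all add: s)
  also have "?m x' (y' \<otimes>\<^bsub>B\<^esub> z') \<cdot>\<^bsub>A\<^esub> (?F f \<boxtimes>\<^bsub>A\<^esub> (?F (g \<boxtimes>\<^bsub>B\<^esub> h) \<cdot>\<^bsub>A\<^esub> ?m y z))
    = (?m x' (y' \<otimes>\<^bsub>B\<^esub> z') \<cdot>\<^bsub>A\<^esub> (?F f \<boxtimes>\<^bsub>A\<^esub> ?F (g \<boxtimes>\<^bsub>B\<^esub> h))) \<cdot>\<^bsub>A\<^esub> (Idt A (fobj F x) \<boxtimes>\<^bsub>A\<^esub> ?m y z)"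
    by (simp add: s A.assoc_simp A.tens_comp)
  also have "?m x' (y' \<otimes>\<^bsub>B\<^esub> z') \<cdot>\<^bsub>A\<^esub> (?F f \<boxtimes>\<^bsub>A\<^esub> ?F (g \<boxtimes>\<^bsub>B\<^esub> h)) = ?F (f \<boxtimes>\<^bsub>B\<^esub> (g \<boxtimes>\<^bsub>B\<^esub> h)) \<cdot>\<^bsub>A\<^esub> ?m x (y \<otimes>\<^bsub>B\<^esub> z)"
    by (intro phi_nat) (simp_all add: s)
  also have "\<dots> \<cdot>\<^bsub>A\<^esub> (Idt A (fobj F x) \<boxtimes>\<^bsub>A\<^esub> ?m y z) \<cdot>\<^bsub>A\<^esub> Assoc A (fobj F x) (fobj F y) (fobj F z)
    = ?F (f \<boxtimes>\<^bsub>B\<^esub> (g \<boxtimes>\<^bsub>B\<^esub> h)) \<cdot>\<^bsub>A\<^esub> (?m x (y \<otimes>\<^bsub>B\<^esub> z) \<cdot>\<^bsub>A\<^esub> (Idt A (fobj F x) \<boxtimes>\<^bsub>A\<^esub> ?m y z) \<cdot>\<^bsub>A\<^esub> Assoc A (fobj F x) (fobj F y) (fobj F z))"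
    by (simp add: s A.assoc_simp)
  also have "\<dots> = ?F ((f \<boxtimes>\<^bsub>B\<^esub> (g \<boxtimes>\<^bsub>B\<^esub> h)) \<cdot>\<^bsub>B\<^esub> Assoc B x y z) \<cdot>\<^bsub>A\<^esub> ?p"
    unfolding fmult_assoc[OF o(1-3), symmetric] by (simp add: s A.assoc_simp Fcomp)
  finally show ?thesis unfolding e by (rule eqI[OF i]) (simp_all add: s)
qed

lemma LUnit_nat:
  assumes a: "f \<in> Arr B"
  shows "LUnit B (Cod B f) \<cdot>\<^bsub>B\<^esub> (Idt B \<one>\<^bsub>B\<^esub> \<boxtimes>\<^bsub>B\<^esub> f) = f \<cdot>\<^bsub>B\<^esub> LUnit B (Dom B f)"
proof -
  define x y where d: "x = Dom B f" "y = Cod B f"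
  have o: "x \<in> Obj B" "y \<in> Obj B" and e: "Dom B f = x" "Cod B f = y" using a by (simp_all add: d ss)
  note s = a o e ss
  let ?F = "farr F" and ?m = "fmult F"
  let ?p = "?m \<one>\<^bsub>B\<^esub> x \<cdot>\<^bsub>A\<^esub> (funit F \<boxtimes>\<^bsub>A\<^esub> Idt A (fobj F x))"
  have i: "iso_in A ?p"
    using o by (intro A.iso_in_Comp A.tens_iso fmult_iso funit_iso A.iso_in_Idt) (simp_all add: ss)
  have n: "?F (Idt B \<one>\<^bsub>B\<^esub> \<boxtimes>\<^bsub>B\<^esub> f) \<cdot>\<^bsub>A\<^esub> ?m \<one>\<^bsub>B\<^esub> x = ?m \<one>\<^bsub>B\<^esub> y \<cdot>\<^bsub>A\<^esub> (Idt A (fobj F \<one>\<^bsub>B\<^esub>) \<boxtimes>\<^bsub>A\<^esub> ?F f)"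
    using fmult_nat[of "Idt B \<one>\<^bsub>B\<^esub>" f] by (simp add: s)
  have "?F (LUnit B y \<cdot>\<^bsub>B\<^esub> (Idt B \<one>\<^bsub>B\<^esub> \<boxtimes>\<^bsub>B\<^esub> f)) \<cdot>\<^bsub>A\<^esub> ?p
    = ?F (LUnit B y) \<cdot>\<^bsub>A\<^esub> (?F (Idt B \<one>\<^bsub>B\<^esub> \<boxtimes>\<^bsub>B\<^esub> f) \<cdot>\<^bsub>A\<^esub> ?m \<one>\<^bsub>B\<^esub> x) \<cdot>\<^bsub>A\<^esub> (funit F \<boxtimes>\<^bsub>A\<^esub> Idt A (fobj F x))"
    by (simp add: s A.assoc_simp Fcomp)
  also have "\<dots> = (?F (LUnit B y) \<cdot>\<^bsub>A\<^esub> ?m \<one>\<^bsub>B\<^esub> y \<cdot>\<^bsub>A\<^esub> (funit F \<boxtimes>\<^bsub>A\<^esub> Idt A (fobj F y))) \<cdot>\<^bsub>A\<^esub> (Idt A \<one>\<^bsub>A\<^esub> \<boxtimes>\<^bsub>A\<^esub> ?F f)"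
    unfolding n by (simp add: s A.assoc_simp A.tens_comp)
  also have "\<dots> = ?F f \<cdot>\<^bsub>A\<^esub> LUnit A (fobj F x)"
    unfolding fmult_LUnit[OF o(2)] by (intro A.lunit_nat) (simp_all add: s)
  also have "\<dots> = ?F (f \<cdot>\<^bsub>B\<^esub> LUnit B x) \<cdot>\<^bsub>A\<^esub> ?p"
    unfolding fmult_LUnit[OF o(1), symmetric] by (simp add: s A.assoc_simp Fcomp)
  finally show ?thesis unfolding e by (rule eqI[OF i]) (simp_all add: s)
qed

lemma RUnit_nat:
  assumes a: "f \<in> Arr B"
  shows "RUnit B (Cod B f) \<cdot>\<^bsub>B\<^esub> (f \<boxtimes>\<^bsub>B\<^esub> Idt B \<one>\<^bsub>B\<^esub>) = f \<cdot>\<^bsub>B\<^esub> RUnit B (Dom B f)"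
proof -
  define x y where d: "x = Dom B f" "y = Cod B f"
  have o: "x \<in> Obj B" "y \<in> Obj B" and e: "Dom B f = x" "Cod B f = y" using a by (simp_all add: d ss)
  note s = a o e ss
  let ?F = "farr F" and ?m = "fmult F"
  let ?p = "?m x \<one>\<^bsub>B\<^esub> \<cdot>\<^bsub>A\<^esub> (Idt A (fobj F x) \<boxtimes>\<^bsub>A\<^esub> funit F)"
  have i: "iso_in A ?p"
    using o by (intro A.iso_in_Comp A.tens_iso fmult_iso funit_iso A.iso_in_Idt) (simp_all add: ss)
  have n: "?F (f \<boxtimes>\<^bsub>B\<^esub> Idt B \<one>\<^bsub>B\<^esub>) \<cdot>\<^bsub>A\<^esub> ?m x \<one>\<^bsub>B\<^esub> = ?m y \<one>\<^bsub>B\<^esub> \<cdot>\<^bsub>A\<^esub> (?F f \<boxtimes>\<^bsub>A\<^esub> Idt A (fobj F \<one>\<^bsub>B\<^esub>))"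
    using fmult_nat[of f "Idt B \<one>\<^bsub>B\<^esub>"] by (simp add: s)
  have "?F (RUnit B y \<cdot>\<^bsub>B\<^esub> (f \<boxtimes>\<^bsub>B\<^esub> Idt B \<one>\<^bsub>B\<^esub>)) \<cdot>\<^bsub>A\<^esub> ?p
    = ?F (RUnit B y) \<cdot>\<^bsub>A\<^esub> (?F (f \<boxtimes>\<^bsub>B\<^esub> Idt B \<one>\<^bsub>B\<^esub>) \<cdot>\<^bsub>A\<^esub> ?m x \<one>\<^bsub>B\<^esub>) \<cdot>\<^bsub>A\<^esub> (Idt A (fobj F x) \<boxtimes>\<^bsub>A\<^esub> funit F)"
    by (simp add: s A.assoc_simp Fcomp)
  also have "\<dots> = (?F (RUnit B y) \<cdot>\<^bsub>A\<^esub> ?m y \<one>\<^bsub>B\<^esub> \<cdot>\<^bsub>A\<^esub> (Idt A (fobj F y) \<boxtimes>\<^bsub>A\<^esub> funit F)) \<cdot>\<^bsub>A\<^esub> (?F f \<boxtimes>\<^bsub>A\<^esub> Idt A \<one>\<^bsub>A\<^esub>)"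
    unfolding n by (simp add: s A.assoc_simp A.tens_comp)
  also have "\<dots> = ?F f \<cdot>\<^bsub>A\<^esub> RUnit A (fobj F x)"
    unfolding fmult_RUnit[OF o(2)] by (intro A.runit_nat) (simp_all add: s)
  also have "\<dots> = ?F (f \<cdot>\<^bsub>B\<^esub> RUnit B x) \<cdot>\<^bsub>A\<^esub> ?p"
    unfolding fmult_RUnit[OF o(1), symmetric] by (simp add: s A.assoc_simp Fcomp)
  finally show ?thesis unfolding e by (rule eqI[OF i]) (simp_all add: s)
qed

lemma triangle:
  assumes o: "x \<in> Obj B" "y \<in> Obj B"
  shows "(Idt B x \<boxtimes>\<^bsub>B\<^esub> LUnit B y) \<cdot>\<^bsub>B\<^esub> Assoc B x \<one>\<^bsub>B\<^esub> y = RUnit B x \<boxtimes>\<^bsub>B\<^esub> Idt B y"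
proof -
  let ?F = "farr F" and ?m = "fmult F" and ?X = "fobj F x" and ?Y = "fobj F y" and ?u = "funit F"
  let ?I = "fobj F \<one>\<^bsub>B\<^esub>"
  let ?q = "(Idt A ?X \<boxtimes>\<^bsub>A\<^esub> ?u) \<boxtimes>\<^bsub>A\<^esub> Idt A ?Y"
  let ?p = "?m (x \<otimes>\<^bsub>B\<^esub> \<one>\<^bsub>B\<^esub>) y \<cdot>\<^bsub>A\<^esub> (?m x \<one>\<^bsub>B\<^esub> \<boxtimes>\<^bsub>A\<^esub> Idt A ?Y) \<cdot>\<^bsub>A\<^esub> ?q"
  note s = o ss
  have i: "iso_in A ?p"
    using o by (intro A.iso_in_Comp A.tens_iso fmult_iso funit_iso A.iso_in_Idt) (simp_all add: ss)
  have n1: "?F (Idt B x \<boxtimes>\<^bsub>B\<^esub> LUnit B y) \<cdot>\<^bsub>A\<^esub> ?m x (\<one>\<^bsub>B\<^esub> \<otimes>\<^bsub>B\<^esub> y) = ?m x y \<cdot>\<^bsub>A\<^esub> (Idt A ?X \<boxtimes>\<^bsub>A\<^esub> ?F (LUnit B y))"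
    using fmult_nat[of "Idt B x" "LUnit B y"] by (simp add: s)
  have n2: "?F (RUnit B x \<boxtimes>\<^bsub>B\<^esub> Idt B y) \<cdot>\<^bsub>A\<^esub> ?m (x \<otimes>\<^bsub>B\<^esub> \<one>\<^bsub>B\<^esub>) y = ?m x y \<cdot>\<^bsub>A\<^esub> (?F (RUnit B x) \<boxtimes>\<^bsub>A\<^esub> Idt A ?Y)"
    using fmult_nat[of "RUnit B x" "Idt B y"] by (simp add: s)
  have n3: "Assoc A ?X ?I ?Y \<cdot>\<^bsub>A\<^esub> ?q = (Idt A ?X \<boxtimes>\<^bsub>A\<^esub> (?u \<boxtimes>\<^bsub>A\<^esub> Idt A ?Y)) \<cdot>\<^bsub>A\<^esub> Assoc A ?X \<one>\<^bsub>A\<^esub> ?Y"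
    by (intro A.assoc_nat) (simp_all add: s)
  have "?F ((Idt B x \<boxtimes>\<^bsub>B\<^esub> LUnit B y) \<cdot>\<^bsub>B\<^esub> Assoc B x \<one>\<^bsub>B\<^esub> y) \<cdot>\<^bsub>A\<^esub> ?p
    = ?F (Idt B x \<boxtimes>\<^bsub>B\<^esub> LUnit B y) \<cdot>\<^bsub>A\<^esub> (?F (Assoc B x \<one>\<^bsub>B\<^esub> y) \<cdot>\<^bsub>A\<^esub> ?m (x \<otimes>\<^bsub>B\<^esub> \<one>\<^bsub>B\<^esub>) y \<cdot>\<^bsub>A\<^esub> (?m x \<one>\<^bsub>B\<^esub> \<boxtimes>\<^bsub>A\<^esub> Idt A ?Y)) \<cdot>\<^bsub>A\<^esub> ?q"
    by (simp add: s A.assoc_simp Fcomp)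
  also have "\<dots> = (?F (Idt B x \<boxtimes>\<^bsub>B\<^esub> LUnit B y) \<cdot>\<^bsub>A\<^esub> ?m x (\<one>\<^bsub>B\<^esub> \<otimes>\<^bsub>B\<^esub> y)) \<cdot>\<^bsub>A\<^esub> (Idt A ?X \<boxtimes>\<^bsub>A\<^esub> ?m \<one>\<^bsub>B\<^esub> y) \<cdot>\<^bsub>A\<^esub> (Assoc A ?X ?I ?Y \<cdot>\<^bsub>A\<^esub> ?q)"
    unfolding fmult_assoc[OF o(1) Unit_in o(2)] by (simp add: s A.assoc_simp)
  also have "\<dots> = ?m x y \<cdot>\<^bsub>A\<^esub> ((Idt A ?X \<boxtimes>\<^bsub>A\<^esub> ?F (LUnit B y)) \<cdot>\<^bsub>A\<^esub> (Idt A ?X \<boxtimes>\<^bsub>A\<^esub> ?m \<one>\<^bsub>B\<^esub> y) \<cdot>\<^bsub>A\<^esub> (Idt A ?X \<boxtimes>\<^bsub>A\<^esub> (?u \<boxtimes>\<^bsub>A\<^esub> Idt A ?Y))) \<cdot>\<^bsub>A\<^esub> Assoc A ?X \<one>\<^bsub>A\<^esub> ?Y"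
    unfolding n1 n3 by (simp add: s A.assoc_simp)
  also have "(Idt A ?X \<boxtimes>\<^bsub>A\<^esub> ?F (LUnit B y)) \<cdot>\<^bsub>A\<^esub> (Idt A ?X \<boxtimes>\<^bsub>A\<^esub> ?m \<one>\<^bsub>B\<^esub> y) \<cdot>\<^bsub>A\<^esub> (Idt A ?X \<boxtimes>\<^bsub>A\<^esub> (?u \<boxtimes>\<^bsub>A\<^esub> Idt A ?Y))
    = Idt A ?X \<boxtimes>\<^bsub>A\<^esub> LUnit A ?Y"
    unfolding fmult_LUnit[OF o(2), symmetric] by (simp add: s A.tens_comp)
  also have "?m x y \<cdot>\<^bsub>A\<^esub> (Idt A ?X \<boxtimes>\<^bsub>A\<^esub> LUnit A ?Y) \<cdot>\<^bsub>A\<^esub> Assoc A ?X \<one>\<^bsub>A\<^esub> ?Y = ?m x y \<cdot>\<^bsub>A\<^esub> (RUnit A ?X \<boxtimes>\<^bsub>A\<^esub> Idt A ?Y)"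
    using A.triangle[of ?X ?Y] by (simp add: s A.assoc_simp)
  also have "RUnit A ?X \<boxtimes>\<^bsub>A\<^esub> Idt A ?Y = (?F (RUnit B x) \<boxtimes>\<^bsub>A\<^esub> Idt A ?Y) \<cdot>\<^bsub>A\<^esub> (?m x \<one>\<^bsub>B\<^esub> \<boxtimes>\<^bsub>A\<^esub> Idt A ?Y) \<cdot>\<^bsub>A\<^esub> ?q"
    unfolding fmult_RUnit[OF o(1), symmetric] by (simp add: s A.tens_comp)
  also have "?m x y \<cdot>\<^bsub>A\<^esub> \<dots> = (?m x y \<cdot>\<^bsub>A\<^esub> (?F (RUnit B x) \<boxtimes>\<^bsub>A\<^esub> Idt A ?Y)) \<cdot>\<^bsub>A\<^esub> (?m x \<one>\<^bsub>B\<^esub> \<boxtimes>\<^bsub>A\<^esub> Idt A ?Y) \<cdot>\<^bsub>A\<^esub> ?q"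
    by (simp add: s A.assoc_simp)
  also have "\<dots> = ?F (RUnit B x \<boxtimes>\<^bsub>B\<^esub> Idt B y) \<cdot>\<^bsub>A\<^esub> ?p"
    unfolding n2[symmetric] by (simp add: s A.assoc_simp)
  finally show ?thesis by (rule eqI[OF i]) (simp_all add: s)
qed

lemma pentagon:
  assumes o: "w \<in> Obj B" "x \<in> Obj B" "y \<in> Obj B" "z \<in> Obj B"
  shows "Assoc B w x (y \<otimes>\<^bsub>B\<^esub> z) \<cdot>\<^bsub>B\<^esub> Assoc B (w \<otimes>\<^bsub>B\<^esub> x) y z =
    (Idt B w \<boxtimes>\<^bsub>B\<^esub> Assoc B x y z) \<cdot>\<^bsub>B\<^esub> Assoc B w (x \<otimes>\<^bsub>B\<^esub> y) z \<cdot>\<^bsub>B\<^esub> (Assoc B w x y \<boxtimes>\<^bsub>B\<^esub> Idt B z)"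
proof -
  let ?F = "farr F" and ?m = "fmult F" and ?W = "fobj F w" and ?X = "fobj F x" and ?Y = "fobj F y" and ?Z = "fobj F z"
  let ?wx = "w \<otimes>\<^bsub>B\<^esub> x" and ?xy = "x \<otimes>\<^bsub>B\<^esub> y" and ?yz = "y \<otimes>\<^bsub>B\<^esub> z" and ?a = "Assoc A" and ?b = "Assoc B"
  let ?i = "Idt A"
  let ?q = "(?m w x \<boxtimes>\<^bsub>A\<^esub> ?i ?Y) \<boxtimes>\<^bsub>A\<^esub> ?i ?Z"
  let ?p = "?m (?wx \<otimes>\<^bsub>B\<^esub> y) z \<cdot>\<^bsub>A\<^esub> (?m ?wx y \<boxtimes>\<^bsub>A\<^esub> ?i ?Z) \<cdot>\<^bsub>A\<^esub> ?q"
  note s = o ss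
  have i: "iso_in A ?p"
    using o by (intro A.iso_in_Comp A.tens_iso fmult_iso A.iso_in_Idt) (simp_all add: ss)
  have a1: "?a (fobj F ?wx) ?Y ?Z \<cdot>\<^bsub>A\<^esub> ?q = (?m w x \<boxtimes>\<^bsub>A\<^esub> (?i ?Y \<boxtimes>\<^bsub>A\<^esub> ?i ?Z)) \<cdot>\<^bsub>A\<^esub> ?a (?W \<otimes>\<^bsub>A\<^esub> ?X) ?Y ?Z"
    by (intro A.assoc_nat) (simp_all add: s)
  have a2: "?a ?W ?X (fobj F ?yz) \<cdot>\<^bsub>A\<^esub> ((?i ?W \<boxtimes>\<^bsub>A\<^esub> ?i ?X) \<boxtimes>\<^bsub>A\<^esub> ?m y z) = (?i ?W \<boxtimes>\<^bsub>A\<^esub> (?i ?X \<boxtimes>\<^bsub>A\<^esub> ?m y z)) \<cdot>\<^bsub>A\<^esub> ?a ?W ?X (?Y \<otimes>\<^bsub>A\<^esub> ?Z)"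
    by (intro A.assoc_nat) (simp_all add: s)
  have a3: "?a ?W (fobj F ?xy) ?Z \<cdot>\<^bsub>A\<^esub> ((?i ?W \<boxtimes>\<^bsub>A\<^esub> ?m x y) \<boxtimes>\<^bsub>A\<^esub> ?i ?Z) = (?i ?W \<boxtimes>\<^bsub>A\<^esub> (?m x y \<boxtimes>\<^bsub>A\<^esub> ?i ?Z)) \<cdot>\<^bsub>A\<^esub> ?a ?W (?X \<otimes>\<^bsub>A\<^esub> ?Y) ?Z"
    by (intro A.assoc_nat) (simp_all add: s)
  have n1: "?F (Idt B w \<boxtimes>\<^bsub>B\<^esub> ?b x y z) \<cdot>\<^bsub>A\<^esub> ?m w (?xy \<otimes>\<^bsub>B\<^esub> z) = ?m w (x \<otimes>\<^bsub>B\<^esub> ?yz) \<cdot>\<^bsub>A\<^esub> (?i ?W \<boxtimes>\<^bsub>A\<^esub> ?F (?b x y z))"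
    using fmult_nat[of "Idt B w" "?b x y z"] by (simp add: s)
  have n2: "?F (?b w x y \<boxtimes>\<^bsub>B\<^esub> Idt B z) \<cdot>\<^bsub>A\<^esub> ?m (?wx \<otimes>\<^bsub>B\<^esub> y) z = ?m (w \<otimes>\<^bsub>B\<^esub> ?xy) z \<cdot>\<^bsub>A\<^esub> (?F (?b w x y) \<boxtimes>\<^bsub>A\<^esub> ?i ?Z)"
    using fmult_nat[of "?b w x y" "Idt B z"] by (simp add: s)
  have "?F (?b w x ?yz \<cdot>\<^bsub>B\<^esub> ?b ?wx y z) \<cdot>\<^bsub>A\<^esub> ?p
    = ?F (?b w x ?yz) \<cdot>\<^bsub>A\<^esub> (?F (?b ?wx y z) \<cdot>\<^bsub>A\<^esub> ?m (?wx \<otimes>\<^bsub>B\<^esub> y) z \<cdot>\<^bsub>A\<^esub> (?m ?wx y \<boxtimes>\<^bsub>A\<^esub> ?i ?Z)) \<cdot>\<^bsub>A\<^esub> ?q"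
    by (simp add: s A.assoc_simp Fcomp)
  also have "\<dots> = ?F (?b w x ?yz) \<cdot>\<^bsub>A\<^esub> ?m ?wx ?yz \<cdot>\<^bsub>A\<^esub> (?i (fobj F ?wx) \<boxtimes>\<^bsub>A\<^esub> ?m y z) \<cdot>\<^bsub>A\<^esub> (?a (fobj F ?wx) ?Y ?Z \<cdot>\<^bsub>A\<^esub> ?q)"
    unfolding fmult_assoc[OF Tens_in[OF o(1,2)] o(3,4)] by (simp add: s A.assoc_simp)
  also have "\<dots> = ?F (?b w x ?yz) \<cdot>\<^bsub>A\<^esub> ?m ?wx ?yz \<cdot>\<^bsub>A\<^esub> ((?i (fobj F ?wx) \<boxtimes>\<^bsub>A\<^esub> ?m y z) \<cdot>\<^bsub>A\<^esub> (?m w x \<boxtimes>\<^bsub>A\<^esub> (?i ?Y \<boxtimes>\<^bsub>A\<^esub> ?i ?Z))) \<cdot>\<^bsub>A\<^esub> ?a (?W \<otimes>\<^bsub>A\<^esub> ?X) ?Y ?Z"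
    unfolding a1 by (simp add: s A.assoc_simp)
  also have "(?i (fobj F ?wx) \<boxtimes>\<^bsub>A\<^esub> ?m y z) \<cdot>\<^bsub>A\<^esub> (?m w x \<boxtimes>\<^bsub>A\<^esub> (?i ?Y \<boxtimes>\<^bsub>A\<^esub> ?i ?Z)) = (?m w x \<boxtimes>\<^bsub>A\<^esub> ?i (fobj F ?yz)) \<cdot>\<^bsub>A\<^esub> ((?i ?W \<boxtimes>\<^bsub>A\<^esub> ?i ?X) \<boxtimes>\<^bsub>A\<^esub> ?m y z)"
    by (simp add: s A.tens_comp)
  also have "?F (?b w x ?yz) \<cdot>\<^bsub>A\<^esub> ?m ?wx ?yz \<cdot>\<^bsub>A\<^esub> \<dots> \<cdot>\<^bsub>A\<^esub> ?a (?W \<otimes>\<^bsub>A\<^esub> ?X) ?Y ?Z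
    = (?F (?b w x ?yz) \<cdot>\<^bsub>A\<^esub> ?m ?wx ?yz \<cdot>\<^bsub>A\<^esub> (?m w x \<boxtimes>\<^bsub>A\<^esub> ?i (fobj F ?yz))) \<cdot>\<^bsub>A\<^esub> (((?i ?W \<boxtimes>\<^bsub>A\<^esub> ?i ?X) \<boxtimes>\<^bsub>A\<^esub> ?m y z) \<cdot>\<^bsub>A\<^esub> ?a (?W \<otimes>\<^bsub>A\<^esub> ?X) ?Y ?Z)"
    by (simp add: s A.assoc_simp)
  also have "\<dots> = ?m w (x \<otimes>\<^bsub>B\<^esub> ?yz) \<cdot>\<^bsub>A\<^esub> (?i ?W \<boxtimes>\<^bsub>A\<^esub> ?m x ?yz) \<cdot>\<^bsub>A\<^esub> (?a ?W ?X (fobj F ?yz) \<cdot>\<^bsub>A\<^esub> ((?i ?W \<boxtimes>\<^bsub>A\<^esub> ?i ?X) \<boxtimes>\<^bsub>A\<^esub> ?m y z)) \<cdot>\<^bsub>A\<^esub> ?a (?W \<otimes>\<^bsub>A\<^esub> ?X) ?Y ?Z"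
    unfolding fmult_assoc[OF o(1,2) Tens_in[OF o(3,4)]] by (simp add: s A.assoc_simp)
  also have "\<dots> = ?m w (x \<otimes>\<^bsub>B\<^esub> ?yz) \<cdot>\<^bsub>A\<^esub> (?i ?W \<boxtimes>\<^bsub>A\<^esub> ?m x ?yz) \<cdot>\<^bsub>A\<^esub> (?i ?W \<boxtimes>\<^bsub>A\<^esub> (?i ?X \<boxtimes>\<^bsub>A\<^esub> ?m y z)) \<cdot>\<^bsub>A\<^esub> (?a ?W ?X (?Y \<otimes>\<^bsub>A\<^esub> ?Z) \<cdot>\<^bsub>A\<^esub> ?a (?W \<otimes>\<^bsub>A\<^esub> ?X) ?Y ?Z)"
    unfolding a2 by (simp add: s A.assoc_simp)
  also have "?a ?W ?X (?Y \<otimes>\<^bsub>A\<^esub> ?Z) \<cdot>\<^bsub>A\<^esub> ?a (?W \<otimes>\<^bsub>A\<^esub> ?X) ?Y ?Z = (?i ?W \<boxtimes>\<^bsub>A\<^esub> ?a ?X ?Y ?Z) \<cdot>\<^bsub>A\<^esub> ?a ?W (?X \<otimes>\<^bsub>A\<^esub> ?Y) ?Z \<cdot>\<^bsub>A\<^esub> (?a ?W ?X ?Y \<boxtimes>\<^bsub>A\<^esub> ?i ?Z)"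
    by (rule A.pentagon) (simp_all add: s)
  also have "?m w (x \<otimes>\<^bsub>B\<^esub> ?yz) \<cdot>\<^bsub>A\<^esub> (?i ?W \<boxtimes>\<^bsub>A\<^esub> ?m x ?yz) \<cdot>\<^bsub>A\<^esub> (?i ?W \<boxtimes>\<^bsub>A\<^esub> (?i ?X \<boxtimes>\<^bsub>A\<^esub> ?m y z)) \<cdot>\<^bsub>A\<^esub> \<dots>
    = ?m w (x \<otimes>\<^bsub>B\<^esub> ?yz) \<cdot>\<^bsub>A\<^esub> (?i ?W \<boxtimes>\<^bsub>A\<^esub> (?m x ?yz \<cdot>\<^bsub>A\<^esub> (?i ?X \<boxtimes>\<^bsub>A\<^esub> ?m y z) \<cdot>\<^bsub>A\<^esub> ?a ?X ?Y ?Z)) \<cdot>\<^bsub>A\<^esub> ?a ?W (?X \<otimes>\<^bsub>A\<^esub> ?Y) ?Z \<cdot>\<^bsub>A\<^esub> (?a ?W ?X ?Y \<boxtimes>\<^bsub>A\<^esub> ?i ?Z)"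
    by (simp add: s A.assoc_simp A.id_tens_comp)
  also have "?m x ?yz \<cdot>\<^bsub>A\<^esub> (?i ?X \<boxtimes>\<^bsub>A\<^esub> ?m y z) \<cdot>\<^bsub>A\<^esub> ?a ?X ?Y ?Z = ?F (?b x y z) \<cdot>\<^bsub>A\<^esub> ?m ?xy z \<cdot>\<^bsub>A\<^esub> (?m x y \<boxtimes>\<^bsub>A\<^esub> ?i ?Z)"
    by (rule fmult_assoc[OF o(2-4), symmetric])
  also have "?m w (x \<otimes>\<^bsub>B\<^esub> ?yz) \<cdot>\<^bsub>A\<^esub> (?i ?W \<boxtimes>\<^bsub>A\<^esub> \<dots>) \<cdot>\<^bsub>A\<^esub> ?a ?W (?X \<otimes>\<^bsub>A\<^esub> ?Y) ?Z \<cdot>\<^bsub>A\<^esub> (?a ?W ?X ?Y \<boxtimes>\<^bsub>A\<^esub> ?i ?Z)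
    = (?m w (x \<otimes>\<^bsub>B\<^esub> ?yz) \<cdot>\<^bsub>A\<^esub> (?i ?W \<boxtimes>\<^bsub>A\<^esub> ?F (?b x y z))) \<cdot>\<^bsub>A\<^esub> (?i ?W \<boxtimes>\<^bsub>A\<^esub> ?m ?xy z) \<cdot>\<^bsub>A\<^esub> ((?i ?W \<boxtimes>\<^bsub>A\<^esub> (?m x y \<boxtimes>\<^bsub>A\<^esub> ?i ?Z)) \<cdot>\<^bsub>A\<^esub> ?a ?W (?X \<otimes>\<^bsub>A\<^esub> ?Y) ?Z) \<cdot>\<^bsub>A\<^esub> (?a ?W ?X ?Y \<boxtimes>\<^bsub>A\<^esub> ?i ?Z)"
    by (simp add: s A.assoc_simp A.id_tens_comp)
  also have "\<dots> = ?F (Idt B w \<boxtimes>\<^bsub>B\<^esub> ?b x y z) \<cdot>\<^bsub>A\<^esub> (?m w (?xy \<otimes>\<^bsub>B\<^esub> z) \<cdot>\<^bsub>A\<^esub> (?i ?W \<boxtimes>\<^bsub>A\<^esub> ?m ?xy z) \<cdot>\<^bsub>A\<^esub> ?a ?W (fobj F ?xy) ?Z) \<cdot>\<^bsub>A\<^esub> (((?i ?W \<boxtimes>\<^bsub>A\<^esub> ?m x y) \<boxtimes>\<^bsub>A\<^esub> ?i ?Z) \<cdot>\<^bsub>A\<^esub> (?a ?W ?X ?Y \<boxtimes>\<^bsub>A\<^esub> ?i ?Z))"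
    unfolding a3[symmetric] n1[symmetric] by (simp add: s A.assoc_simp)
  also have "\<dots> = ?F (Idt B w \<boxtimes>\<^bsub>B\<^esub> ?b x y z) \<cdot>\<^bsub>A\<^esub> ?F (?b w ?xy z) \<cdot>\<^bsub>A\<^esub> ?m (w \<otimes>\<^bsub>B\<^esub> ?xy) z \<cdot>\<^bsub>A\<^esub> ((?m w ?xy \<cdot>\<^bsub>A\<^esub> (?i ?W \<boxtimes>\<^bsub>A\<^esub> ?m x y) \<cdot>\<^bsub>A\<^esub> ?a ?W ?X ?Y) \<boxtimes>\<^bsub>A\<^esub> ?i ?Z)"
    unfolding fmult_assoc[OF o(1) Tens_in[OF o(2,3)] o(4), symmetric] by (simp add: s A.assoc_simp A.tens_id_comp)
  also have "\<dots> = ?F (Idt B w \<boxtimes>\<^bsub>B\<^esub> ?b x y z) \<cdot>\<^bsub>A\<^esub> ?F (?b w ?xy z) \<cdot>\<^bsub>A\<^esub> (?m (w \<otimes>\<^bsub>B\<^esub> ?xy) z \<cdot>\<^bsub>A\<^esub> (?F (?b w x y) \<boxtimes>\<^bsub>A\<^esub> ?i ?Z)) \<cdot>\<^bsub>A\<^esub> ((?m ?wx y \<boxtimes>\<^bsub>A\<^esub> ?i ?Z) \<cdot>\<^bsub>A\<^esub> ?q)"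
    unfolding fmult_assoc[OF o(1-3), symmetric] by (simp add: s A.assoc_simp A.tens_id_comp)
  also have "\<dots> = ?F ((Idt B w \<boxtimes>\<^bsub>B\<^esub> ?b x y z) \<cdot>\<^bsub>B\<^esub> ?b w ?xy z \<cdot>\<^bsub>B\<^esub> (?b w x y \<boxtimes>\<^bsub>B\<^esub> Idt B z)) \<cdot>\<^bsub>A\<^esub> ?p"
    unfolding n2[symmetric] by (simp add: s A.assoc_simp Fcomp)
  finally show ?thesis by (rule eqI[OF i]) (simp_all add: s)
qed

lemma monoidal: "monoidal_category B"
proof (unfold_locales, goal_cases)
  case (2 f x x' g y y')
  then show ?case using TensA_in[of f g] by (simp add: Hom_def)
next
  case (4 f x x' f' x'' g y y' g' y'')
  then show ?case by (intro TensA_Comp) (simp_all add: Hom_def)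
next
  case (8 f x x' g y y' h z z')
  then show ?case using Assoc_nat[of f g h] by (simp add: Hom_def)
next
  case (11 f x y)
  then show ?case using LUnit_nat[of f] by (simp add: Hom_def)
next
  case (14 f x y)
  then show ?case using RUnit_nat[of f] by (simp add: Hom_def)
qed (fact Tens_in TensA_Id Unit_in Assoc_in Assoc_iso LUnit_in LUnit_iso RUnit_in RUnit_iso pentagon triangle)+

theorem strong_monoidal: "strong_monoidal_functor B A F"
proof -
  interpret B: monoidal_category B by (rule monoidal)
  show ?thesis
    by unfold_locales (auto simp: fdom fcod is_functor fmult_iso fmult_in funit_in funit_iso
      fmult_assoc fmult_LUnit fmult_RUnit Hom_def fmult_nat phi)
qed

end

section \<open>Idempotents split among monoidal categories\<close>

text \<open>
  The associator is the composite that \<open>fmult_assoc\<close> forces on the inclusion functor. It is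
  \<open>E\<close> applied to an isomorphism of \<open>A\<close>, which makes it a fixed arrow with a fixed inverse.
  The same holds for the unitors.
\<close>

definition fixed_moncat :: "'u mftor \<Rightarrow> ('u, 'u) moncat" where
  "fixed_moncat E = (let A = fdom E; S = {x \<in> Obj A. fobj E x = x}; T = {f \<in> Arr A. farr E f = f} in
    \<lparr>Obj = S, Arr = T, Dom = restrict (Dom A) T, Cod = restrict (Cod A) T, Idt = restrict (Idt A) S,
     Comp = (\<lambda>g f. if f \<in> T \<and> g \<in> T \<and> Dom A g = Cod A f then g \<cdot>\<^bsub>A\<^esub> f else undefined),
     Tens = (\<lambda>x y. if x \<in> S \<and> y \<in> S then fobj E (x \<otimes>\<^bsub>A\<^esub> y) else undefined),
     TensA = (\<lambda>f g. if f \<in> T \<and> g \<in> T then farr E (f \<boxtimes>\<^bsub>A\<^esub> g) else undefined),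
     Unit = fobj E \<one>\<^bsub>A\<^esub>,
     Assoc = (\<lambda>x y z. if x \<in> S \<and> y \<in> S \<and> z \<in> S then
       farr E ((Idt A x \<boxtimes>\<^bsub>A\<^esub> fmult E y z) \<cdot>\<^bsub>A\<^esub> Assoc A x y z \<cdot>\<^bsub>A\<^esub> arr_inv A (fmult E x y \<boxtimes>\<^bsub>A\<^esub> Idt A z))
       else undefined),
     LUnit = (\<lambda>x \<in> S. farr E (LUnit A x \<cdot>\<^bsub>A\<^esub> arr_inv A (funit E \<boxtimes>\<^bsub>A\<^esub> Idt A x))),
     RUnit = (\<lambda>x \<in> S. farr E (RUnit A x \<cdot>\<^bsub>A\<^esub> arr_inv A (Idt A x \<boxtimes>\<^bsub>A\<^esub> funit E)))\<rparr>)"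

definition fixed_inclusion :: "'u mftor \<Rightarrow> 'u mftor" where
  "fixed_inclusion E = (let B = fixed_moncat E in
    \<lparr>fdom = B, fcod = fdom E, fobj = (\<lambda>x \<in> Obj B. x), farr = (\<lambda>f \<in> Arr B. f),
     fmult = (\<lambda>x y. if x \<in> Obj B \<and> y \<in> Obj B then fmult E x y else undefined), funit = funit E\<rparr>)"

definition fixed_retraction :: "'u mftor \<Rightarrow> 'u mftor" where
  "fixed_retraction E = E\<lparr>fcod := fixed_moncat E,
     fmult := (\<lambda>x y. if x \<in> Obj (fdom E) \<and> y \<in> Obj (fdom E) then farr E (fmult E x y) else undefined),
     funit := farr E (funit E)\<rparr>"

lemma small_set_subset:
  assumes "small_set U S" "T \<subseteq> S" shows "small_set U T"
  using assms card_of_mono1 ordLeq_ordLess_trans unfolding small_set_def by blast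

locale monoidal_idempotent = strong_monoidal_functor A A E
  for A :: "('u, 'u) moncat" and E :: "'u mftor" +
  assumes idem: "mftor_comp E E = E"
begin

abbreviation "B \<equiv> fixed_moncat E"

lemma E_obj: "x \<in> Obj A \<Longrightarrow> fobj E (fobj E x) = fobj E x"
  using arg_cong[OF idem, of "\<lambda>G. fobj G x"] by (simp add: mftor_comp_simps fdom)

lemma E_arr: "f \<in> Arr A \<Longrightarrow> farr E (farr E f) = farr E f"
  using arg_cong[OF idem, of "\<lambda>G. farr G f"] by (simp add: mftor_comp_simps fdom)

lemma E_mult: "x \<in> Obj A \<Longrightarrow> y \<in> Obj A \<Longrightarrow>
    farr E (fmult E x y) \<cdot>\<^bsub>A\<^esub> fmult E (fobj E x) (fobj E y) = fmult E x y"
  using arg_cong[OF idem, of "\<lambda>G. fmult G x y"] by (simp add: mftor_comp_simps fdom fcod)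

lemma E_unit: "farr E (funit E) \<cdot>\<^bsub>A\<^esub> funit E = funit E"
  using arg_cong[OF idem, of "\<lambda>G. funit G"] by (simp add: mftor_comp_simps fdom fcod)

lemmas es = ss E_obj E_arr

text \<open>
  \<open>E_mult\<close> says that \<open>E \<phi>\<^sub>x\<^sub>y\<close> composed with the isomorphism \<open>\<phi>\<^sub>x\<^sub>y\<close> is \<open>\<phi>\<^sub>x\<^sub>y\<close> again.
\<close>

lemma E_mult_fixed:
  assumes "x \<in> Obj A" "y \<in> Obj A" "fobj E x = x" "fobj E y = y"
  shows "farr E (fmult E x y) = Idt A (fobj E (x \<otimes>\<^bsub>A\<^esub> y))"
  by (rule A.iso_cancel_right[OF fmult_iso[OF assms(1,2)]])
    (use assms E_mult[OF assms(1,2)] in \<open>simp_all add: es\<close>)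

lemma E_unit_fixed: "farr E (funit E) = Idt A (fobj E \<one>\<^bsub>A\<^esub>)"
  by (rule A.iso_cancel_right[OF funit_iso]) (use E_unit in \<open>simp_all add: es\<close>)

lemma fixed_sets: "Obj B = {x \<in> Obj A. fobj E x = x}" "Arr B = {f \<in> Arr A. farr E f = f}"
  by (simp_all add: fixed_moncat_def fdom Let_def)

lemma fixed_dom_cod:
  assumes "f \<in> Arr A" "farr E f = f"
  shows "fobj E (Dom A f) = Dom A f" "fobj E (Cod A f) = Cod A f"
  using Fs(4,5)[OF assms(1)] assms(2) by simp_all

lemma fixed_simps:
  "f \<in> Arr A \<Longrightarrow> farr E f = f \<Longrightarrow> Dom B f = Dom A f"
  "f \<in> Arr A \<Longrightarrow> farr E f = f \<Longrightarrow> Cod B f = Cod A f"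
  "x \<in> Obj A \<Longrightarrow> fobj E x = x \<Longrightarrow> Idt B x = Idt A x"
  "f \<in> Arr A \<Longrightarrow> farr E f = f \<Longrightarrow> g \<in> Arr A \<Longrightarrow> farr E g = g \<Longrightarrow> Dom A g = Cod A f \<Longrightarrow>
    g \<cdot>\<^bsub>B\<^esub> f = g \<cdot>\<^bsub>A\<^esub> f"
  "x \<in> Obj A \<Longrightarrow> fobj E x = x \<Longrightarrow> y \<in> Obj A \<Longrightarrow> fobj E y = y \<Longrightarrow> x \<otimes>\<^bsub>B\<^esub> y = fobj E (x \<otimes>\<^bsub>A\<^esub> y)"
  "f \<in> Arr A \<Longrightarrow> farr E f = f \<Longrightarrow> g \<in> Arr A \<Longrightarrow> farr E g = g \<Longrightarrow> f \<boxtimes>\<^bsub>B\<^esub> g = farr E (f \<boxtimes>\<^bsub>A\<^esub> g)"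
  "\<one>\<^bsub>B\<^esub> = fobj E \<one>\<^bsub>A\<^esub>"
  "x \<in> Obj A \<Longrightarrow> fobj E x = x \<Longrightarrow> y \<in> Obj A \<Longrightarrow> fobj E y = y \<Longrightarrow> z \<in> Obj A \<Longrightarrow> fobj E z = z \<Longrightarrow>
    Assoc B x y z = farr E ((Idt A x \<boxtimes>\<^bsub>A\<^esub> fmult E y z) \<cdot>\<^bsub>A\<^esub> Assoc A x y z \<cdot>\<^bsub>A\<^esub> arr_inv A (fmult E x y \<boxtimes>\<^bsub>A\<^esub> Idt A z))"
  "x \<in> Obj A \<Longrightarrow> fobj E x = x \<Longrightarrow> LUnit B x = farr E (LUnit A x \<cdot>\<^bsub>A\<^esub> arr_inv A (funit E \<boxtimes>\<^bsub>A\<^esub> Idt A x))"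
  "x \<in> Obj A \<Longrightarrow> fobj E x = x \<Longrightarrow> RUnit B x = farr E (RUnit A x \<cdot>\<^bsub>A\<^esub> arr_inv A (Idt A x \<boxtimes>\<^bsub>A\<^esub> funit E))"
  by (simp_all add: fixed_moncat_def fdom Let_def)

lemma incl_simps:
  "fdom (fixed_inclusion E) = B" "fcod (fixed_inclusion E) = A"
  "x \<in> Obj A \<Longrightarrow> fobj E x = x \<Longrightarrow> fobj (fixed_inclusion E) x = x"
  "f \<in> Arr A \<Longrightarrow> farr E f = f \<Longrightarrow> farr (fixed_inclusion E) f = f"
  "x \<in> Obj A \<Longrightarrow> fobj E x = x \<Longrightarrow> y \<in> Obj A \<Longrightarrow> fobj E y = y \<Longrightarrow> fmult (fixed_inclusion E) x y = fmult E x y"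
  "funit (fixed_inclusion E) = funit E"
  by (simp_all add: fixed_inclusion_def Let_def fixed_sets fdom)

lemma retr_simps:
  "fdom (fixed_retraction E) = A" "fcod (fixed_retraction E) = B"
  "fobj (fixed_retraction E) = fobj E" "farr (fixed_retraction E) = farr E"
  "x \<in> Obj A \<Longrightarrow> y \<in> Obj A \<Longrightarrow> fmult (fixed_retraction E) x y = farr E (fmult E x y)"
  "funit (fixed_retraction E) = farr E (funit E)"
  by (simp_all add: fixed_retraction_def fdom)

lemmas fs = fixed_sets fixed_simps incl_simps fixed_dom_cod es

lemma category_fixed: "category B"
  by unfold_locales (auto simp: Hom_def fs Fcomp A.assoc_simp)

lemma is_functor_retr: "is_functor A B (fobj E) (farr E)"
  unfolding is_functor_def Hom_def by (auto simp: fs Fcomp)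

lemma is_functor_incl: "is_functor B A (fobj (fixed_inclusion E)) (farr (fixed_inclusion E))"
  unfolding is_functor_def Hom_def by (auto simp: fs Fcomp)

lemma iso_fixed: "iso_in A f \<Longrightarrow> iso_in B (farr E f)"
  by (rule iso_in_functor[OF A.category_axioms is_functor_retr])

lemma mult_iso_id:
  assumes "x \<in> Obj A" "y \<in> Obj A" "z \<in> Obj A"
  shows "iso_in A (fmult E x y \<boxtimes>\<^bsub>A\<^esub> Idt A z)"
  using assms by (intro A.tens_iso fmult_iso A.iso_in_Idt)

lemma unit_iso_id:
  assumes "x \<in> Obj A"
  shows "iso_in A (funit E \<boxtimes>\<^bsub>A\<^esub> Idt A x)" "iso_in A (Idt A x \<boxtimes>\<^bsub>A\<^esub> funit E)"
  using assms by (auto intro: A.tens_iso funit_iso A.iso_in_Idt)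

lemma E_inv:
  assumes "iso_in A p" "q \<in> Arr A" "Cod A q = fobj E (Dom A p)"
  shows "farr E (arr_inv A p) \<cdot>\<^bsub>A\<^esub> (farr E p \<cdot>\<^bsub>A\<^esub> q) = q"
proof -
  note i = A.arr_inv[OF assms(1)]
  have "farr E (arr_inv A p) \<cdot>\<^bsub>A\<^esub> (farr E p \<cdot>\<^bsub>A\<^esub> q) = farr E (arr_inv A p \<cdot>\<^bsub>A\<^esub> p) \<cdot>\<^bsub>A\<^esub> q"
    using i(1-4) assms(2,3) by (simp add: Fcomp A.assoc_simp ss)
  also have "\<dots> = q" using i assms(2,3) by (simp add: ss)
  finally show ?thesis .
qed

lemma creation: "monoidal_creation A B (fixed_inclusion E)"
proof (intro monoidal_creation.intro monoidal_creation_axioms.intro A.monoidal_category_axioms category_fixed)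
  fix x y z assume "x \<in> Obj B" "y \<in> Obj B" "z \<in> Obj B"
  then have o: "x \<in> Obj A" "fobj E x = x" "y \<in> Obj A" "fobj E y = y" "z \<in> Obj A" "fobj E z = z"
    by (simp_all add: fs)
  note i = A.arr_inv[OF mult_iso_id[OF o(1,3,5)]]
  show "Assoc B x y z \<in> Hom B ((x \<otimes>\<^bsub>B\<^esub> y) \<otimes>\<^bsub>B\<^esub> z) (x \<otimes>\<^bsub>B\<^esub> (y \<otimes>\<^bsub>B\<^esub> z))"
    using o i by (simp add: fs Hom_def)
  show "iso_in B (Assoc B x y z)"
  proof -
    have "iso_in A ((Idt A x \<boxtimes>\<^bsub>A\<^esub> fmult E y z) \<cdot>\<^bsub>A\<^esub> Assoc A x y z \<cdot>\<^bsub>A\<^esub> arr_inv A (fmult E x y \<boxtimes>\<^bsub>A\<^esub> Idt A z))"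
      using o i by (intro A.iso_in_Comp A.tens_iso fmult_iso A.iso_in_Idt A.Assoc_iso) (simp_all add: fs)
    then show ?thesis using o iso_fixed by (simp add: fs)
  qed
  let ?J = "fixed_inclusion E" and ?m = "fmult E" and ?e = "farr E" and ?a = "Assoc A x y z"
  \<comment> \<open>Naturality of \<open>fmult E\<close> at \<open>fmult E x y\<close>, which \<open>E\<close> sends to an identity.\<close>
  have n1: "?m (fobj E (x \<otimes>\<^bsub>A\<^esub> y)) z = ?e (?m x y \<boxtimes>\<^bsub>A\<^esub> Idt A z) \<cdot>\<^bsub>A\<^esub> ?m (x \<otimes>\<^bsub>A\<^esub> y) z"
    using phi_nat[of "?m x y" "Idt A z" "x \<otimes>\<^bsub>A\<^esub> y" z "fobj E (x \<otimes>\<^bsub>A\<^esub> y)" z] o by (simp add: fs E_mult_fixed)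
  have n2: "?m x (fobj E (y \<otimes>\<^bsub>A\<^esub> z)) = ?e (Idt A x \<boxtimes>\<^bsub>A\<^esub> ?m y z) \<cdot>\<^bsub>A\<^esub> ?m x (y \<otimes>\<^bsub>A\<^esub> z)"
    using phi_nat[of "Idt A x" "?m y z" x "y \<otimes>\<^bsub>A\<^esub> z" x "fobj E (y \<otimes>\<^bsub>A\<^esub> z)"] o by (simp add: fs E_mult_fixed)
  have "?e ((Idt A x \<boxtimes>\<^bsub>A\<^esub> ?m y z) \<cdot>\<^bsub>A\<^esub> ?a \<cdot>\<^bsub>A\<^esub> arr_inv A (?m x y \<boxtimes>\<^bsub>A\<^esub> Idt A z)) \<cdot>\<^bsub>A\<^esub>
      (?e (?m x y \<boxtimes>\<^bsub>A\<^esub> Idt A z) \<cdot>\<^bsub>A\<^esub> ?m (x \<otimes>\<^bsub>A\<^esub> y) z) \<cdot>\<^bsub>A\<^esub> (?m x y \<boxtimes>\<^bsub>A\<^esub> Idt A z)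
    = ?e (Idt A x \<boxtimes>\<^bsub>A\<^esub> ?m y z) \<cdot>\<^bsub>A\<^esub> ?e ?a \<cdot>\<^bsub>A\<^esub> (?e (arr_inv A (?m x y \<boxtimes>\<^bsub>A\<^esub> Idt A z)) \<cdot>\<^bsub>A\<^esub>
      (?e (?m x y \<boxtimes>\<^bsub>A\<^esub> Idt A z) \<cdot>\<^bsub>A\<^esub> ?m (x \<otimes>\<^bsub>A\<^esub> y) z)) \<cdot>\<^bsub>A\<^esub> (?m x y \<boxtimes>\<^bsub>A\<^esub> Idt A z)"
    using o i by (simp add: ss Fcomp A.assoc_simp)
  also have "\<dots> = ?e (Idt A x \<boxtimes>\<^bsub>A\<^esub> ?m y z) \<cdot>\<^bsub>A\<^esub> (?e ?a \<cdot>\<^bsub>A\<^esub> ?m (x \<otimes>\<^bsub>A\<^esub> y) z \<cdot>\<^bsub>A\<^esub> (?m x y \<boxtimes>\<^bsub>A\<^esub> Idt A (fobj E z)))"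
    using E_inv[OF mult_iso_id[OF o(1,3,5)], of "?m (x \<otimes>\<^bsub>A\<^esub> y) z"] o by (simp add: ss A.assoc_simp)
  also have "\<dots> = (?e (Idt A x \<boxtimes>\<^bsub>A\<^esub> ?m y z) \<cdot>\<^bsub>A\<^esub> ?m x (y \<otimes>\<^bsub>A\<^esub> z)) \<cdot>\<^bsub>A\<^esub> (Idt A x \<boxtimes>\<^bsub>A\<^esub> ?m y z) \<cdot>\<^bsub>A\<^esub> ?a"
    unfolding fmult_assoc[OF o(1,3,5)] using o by (simp add: ss A.assoc_simp)
  finally show "farr ?J (Assoc B x y z) \<cdot>\<^bsub>A\<^esub> fmult ?J (x \<otimes>\<^bsub>B\<^esub> y) z \<cdot>\<^bsub>A\<^esub> (fmult ?J x y \<boxtimes>\<^bsub>A\<^esub> Idt A (fobj ?J z)) =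
      fmult ?J x (y \<otimes>\<^bsub>B\<^esub> z) \<cdot>\<^bsub>A\<^esub> (Idt A (fobj ?J x) \<boxtimes>\<^bsub>A\<^esub> fmult ?J y z)
        \<cdot>\<^bsub>A\<^esub> Assoc A (fobj ?J x) (fobj ?J y) (fobj ?J z)"
    unfolding n1[symmetric] n2[symmetric] using o i by (simp add: fs)
next
  fix x assume "x \<in> Obj B"
  then have o: "x \<in> Obj A" "fobj E x = x" by (simp_all add: fs)
  let ?J = "fixed_inclusion E" and ?m = "fmult E" and ?e = "farr E" and ?u = "funit E" and ?I = "fobj E \<one>\<^bsub>A\<^esub>"
  note i = A.arr_inv[OF unit_iso_id(1)[OF o(1)]] A.arr_inv[OF unit_iso_id(2)[OF o(1)]]
  show "LUnit B x \<in> Hom B (\<one>\<^bsub>B\<^esub> \<otimes>\<^bsub>B\<^esub> x) x" "RUnit B x \<in> Hom B (x \<otimes>\<^bsub>B\<^esub> \<one>\<^bsub>B\<^esub>) x"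
    using o i by (simp_all add: fs Hom_def)
  have "iso_in A (LUnit A x \<cdot>\<^bsub>A\<^esub> arr_inv A (?u \<boxtimes>\<^bsub>A\<^esub> Idt A x))" "iso_in A (RUnit A x \<cdot>\<^bsub>A\<^esub> arr_inv A (Idt A x \<boxtimes>\<^bsub>A\<^esub> ?u))"
    using o i by (auto intro!: A.iso_in_Comp A.LUnit_iso A.RUnit_iso simp: fs)
  then show "iso_in B (LUnit B x)" "iso_in B (RUnit B x)" using o iso_fixed by (simp_all add: fs)
  have n1: "?m ?I x = ?e (?u \<boxtimes>\<^bsub>A\<^esub> Idt A x) \<cdot>\<^bsub>A\<^esub> ?m \<one>\<^bsub>A\<^esub> x"
    using phi_nat[of ?u "Idt A x" "\<one>\<^bsub>A\<^esub>" x ?I x] o by (simp add: fs E_unit_fixed)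
  have n2: "?m x ?I = ?e (Idt A x \<boxtimes>\<^bsub>A\<^esub> ?u) \<cdot>\<^bsub>A\<^esub> ?m x \<one>\<^bsub>A\<^esub>"
    using phi_nat[of "Idt A x" ?u x "\<one>\<^bsub>A\<^esub>" x ?I] o by (simp add: fs E_unit_fixed)
  have "?e (LUnit A x \<cdot>\<^bsub>A\<^esub> arr_inv A (?u \<boxtimes>\<^bsub>A\<^esub> Idt A x)) \<cdot>\<^bsub>A\<^esub> (?e (?u \<boxtimes>\<^bsub>A\<^esub> Idt A x) \<cdot>\<^bsub>A\<^esub> ?m \<one>\<^bsub>A\<^esub> x) \<cdot>\<^bsub>A\<^esub> (?u \<boxtimes>\<^bsub>A\<^esub> Idt A x)
    = ?e (LUnit A x) \<cdot>\<^bsub>A\<^esub> (?e (arr_inv A (?u \<boxtimes>\<^bsub>A\<^esub> Idt A x)) \<cdot>\<^bsub>A\<^esub> (?e (?u \<boxtimes>\<^bsub>A\<^esub> Idt A x) \<cdot>\<^bsub>A\<^esub> ?m \<one>\<^bsub>A\<^esub> x)) \<cdot>\<^bsub>A\<^esub> (?u \<boxtimes>\<^bsub>A\<^esub> Idt A x)"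
    using o i by (simp add: ss Fcomp A.assoc_simp)
  also have "\<dots> = LUnit A x"
    using E_inv[OF unit_iso_id(1)[OF o(1)], of "?m \<one>\<^bsub>A\<^esub> x"] fmult_LUnit[OF o(1)] o by (simp add: ss A.assoc_simp)
  finally show "farr ?J (LUnit B x) \<cdot>\<^bsub>A\<^esub> fmult ?J \<one>\<^bsub>B\<^esub> x \<cdot>\<^bsub>A\<^esub> (funit ?J \<boxtimes>\<^bsub>A\<^esub> Idt A (fobj ?J x)) = LUnit A (fobj ?J x)"
    unfolding n1[symmetric] using o i by (simp add: fs)
  have "?e (RUnit A x \<cdot>\<^bsub>A\<^esub> arr_inv A (Idt A x \<boxtimes>\<^bsub>A\<^esub> ?u)) \<cdot>\<^bsub>A\<^esub> (?e (Idt A x \<boxtimes>\<^bsub>A\<^esub> ?u) \<cdot>\<^bsub>A\<^esub> ?m x \<one>\<^bsub>A\<^esub>) \<cdot>\<^bsub>A\<^esub> (Idt A x \<boxtimes>\<^bsub>A\<^esub> ?u)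
    = ?e (RUnit A x) \<cdot>\<^bsub>A\<^esub> (?e (arr_inv A (Idt A x \<boxtimes>\<^bsub>A\<^esub> ?u)) \<cdot>\<^bsub>A\<^esub> (?e (Idt A x \<boxtimes>\<^bsub>A\<^esub> ?u) \<cdot>\<^bsub>A\<^esub> ?m x \<one>\<^bsub>A\<^esub>)) \<cdot>\<^bsub>A\<^esub> (Idt A x \<boxtimes>\<^bsub>A\<^esub> ?u)"
    using o i by (simp add: ss Fcomp A.assoc_simp)
  also have "\<dots> = RUnit A x"
    using E_inv[OF unit_iso_id(2)[OF o(1)], of "?m x \<one>\<^bsub>A\<^esub>"] fmult_RUnit[OF o(1)] o by (simp add: ss A.assoc_simp)
  finally show "farr ?J (RUnit B x) \<cdot>\<^bsub>A\<^esub> fmult ?J x \<one>\<^bsub>B\<^esub> \<cdot>\<^bsub>A\<^esub> (Idt A (fobj ?J x) \<boxtimes>\<^bsub>A\<^esub> funit ?J) = RUnit A (fobj ?J x)"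
    unfolding n2[symmetric] using o i by (simp add: fs)
next
  let ?J = "fixed_inclusion E"
  fix f g assume "f \<in> Arr B" "g \<in> Arr B"
  then have h: "f \<in> Arr A" "farr E f = f" "g \<in> Arr A" "farr E g = g" by (simp_all add: fs)
  then show "fmult ?J (Cod B f) (Cod B g) \<cdot>\<^bsub>A\<^esub> (farr ?J f \<boxtimes>\<^bsub>A\<^esub> farr ?J g) =
      farr ?J (f \<boxtimes>\<^bsub>B\<^esub> g) \<cdot>\<^bsub>A\<^esub> fmult ?J (Dom B f) (Dom B g)"
    using phi_nat[of f g "Dom A f" "Dom A g" "Cod A f" "Cod A g"] by (simp add: fs)
qed (auto simp: fs is_functor_incl Hom_def intro: fmult_iso funit_iso)

sublocale B: monoidal_category B
  by (rule monoidal_creation.monoidal[OF creation])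

text \<open>
  Since \<open>E \<circ> E = E\<close>, every composite in \<open>B\<close> occurring here is \<open>E\<close> applied to a composite in \<open>A\<close>;
  so each coherence equation is \<open>E\<close> applied to the one for \<open>E\<close>, where \<open>E_mult\<close> absorbs the factors
  \<open>E \<phi>\<^sub>x\<^sub>y\<close>.
\<close>

lemma strong_monoidal_retr: "strong_monoidal_functor A B (fixed_retraction E)"
proof (intro strong_monoidal_functor.intro strong_monoidal_functor_axioms.intro A.monoidal_category_axioms B.monoidal_category_axioms)
  let ?R = "fixed_retraction E" and ?m = "fmult E" and ?e = "farr E"
  fix x y z assume o: "x \<in> Obj A" "y \<in> Obj A" "z \<in> Obj A"
  let ?X = "fobj E x" and ?Y = "fobj E y" and ?Z = "fobj E z"
  show "fmult ?R x y \<in> Hom B (fobj ?R x \<otimes>\<^bsub>B\<^esub> fobj ?R y) (fobj ?R (x \<otimes>\<^bsub>A\<^esub> y))"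
    using o by (simp add: fs retr_simps Hom_def)
  show "iso_in B (fmult ?R x y)" using o fmult_iso iso_fixed by (simp add: retr_simps)
  let ?k = "arr_inv A (?m ?X ?Y \<boxtimes>\<^bsub>A\<^esub> Idt A ?Z)"
  have O: "?X \<in> Obj A" "?Y \<in> Obj A" "?Z \<in> Obj A" using o by (simp_all add: ss)
  note i = A.arr_inv[OF mult_iso_id[OF O]]
  have em: "?e (?m x y) \<boxtimes>\<^bsub>A\<^esub> Idt A ?Z = (?m x y \<boxtimes>\<^bsub>A\<^esub> Idt A ?Z) \<cdot>\<^bsub>A\<^esub> ?k"
  proof (rule A.iso_cancel_right[OF mult_iso_id[OF O]])
    show "?e (?m x y) \<boxtimes>\<^bsub>A\<^esub> Idt A ?Z \<cdot>\<^bsub>A\<^esub> ?m ?X ?Y \<boxtimes>\<^bsub>A\<^esub> Idt A ?Z =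
      ((?m x y \<boxtimes>\<^bsub>A\<^esub> Idt A ?Z) \<cdot>\<^bsub>A\<^esub> ?k) \<cdot>\<^bsub>A\<^esub> ?m ?X ?Y \<boxtimes>\<^bsub>A\<^esub> Idt A ?Z"
      using o i E_mult[OF o(1,2)] by (simp add: es A.assoc_simp A.tens_comp)
  qed (use o i in \<open>simp_all add: es\<close>)
  have em2: "(Idt A ?X \<boxtimes>\<^bsub>A\<^esub> ?e (?m y z)) \<cdot>\<^bsub>A\<^esub> (Idt A ?X \<boxtimes>\<^bsub>A\<^esub> ?m ?Y ?Z) = Idt A ?X \<boxtimes>\<^bsub>A\<^esub> ?m y z"
    using o E_mult[OF o(2,3)] by (simp add: es A.tens_comp)
  have "?e (?e (Assoc A x y z)) \<cdot>\<^bsub>A\<^esub> ?e (?m (x \<otimes>\<^bsub>A\<^esub> y) z) \<cdot>\<^bsub>A\<^esub> ?e (?e (?m x y) \<boxtimes>\<^bsub>A\<^esub> Idt A ?Z)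
    = ?e ((?e (Assoc A x y z) \<cdot>\<^bsub>A\<^esub> ?m (x \<otimes>\<^bsub>A\<^esub> y) z \<cdot>\<^bsub>A\<^esub> (?m x y \<boxtimes>\<^bsub>A\<^esub> Idt A ?Z)) \<cdot>\<^bsub>A\<^esub> ?k)"
    unfolding em using o i by (simp add: es Fcomp A.assoc_simp)
  also have "\<dots> = ?e (?m x (y \<otimes>\<^bsub>A\<^esub> z) \<cdot>\<^bsub>A\<^esub> ((Idt A ?X \<boxtimes>\<^bsub>A\<^esub> ?e (?m y z)) \<cdot>\<^bsub>A\<^esub> (Idt A ?X \<boxtimes>\<^bsub>A\<^esub> ?m ?Y ?Z)) \<cdot>\<^bsub>A\<^esub> Assoc A ?X ?Y ?Z \<cdot>\<^bsub>A\<^esub> ?k)"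
    unfolding em2 fmult_assoc[OF o] ..
  also have "\<dots> = ?e (?m x (y \<otimes>\<^bsub>A\<^esub> z)) \<cdot>\<^bsub>A\<^esub> ?e (Idt A ?X \<boxtimes>\<^bsub>A\<^esub> ?e (?m y z)) \<cdot>\<^bsub>A\<^esub> ?e ((Idt A ?X \<boxtimes>\<^bsub>A\<^esub> ?m ?Y ?Z) \<cdot>\<^bsub>A\<^esub> Assoc A ?X ?Y ?Z \<cdot>\<^bsub>A\<^esub> ?k)"
    using o i by (simp add: es Fcomp A.assoc_simp)
  finally show "farr ?R (Assoc A x y z) \<cdot>\<^bsub>B\<^esub> fmult ?R (x \<otimes>\<^bsub>A\<^esub> y) z \<cdot>\<^bsub>B\<^esub> (fmult ?R x y \<boxtimes>\<^bsub>B\<^esub> Idt B (fobj ?R z)) =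
      fmult ?R x (y \<otimes>\<^bsub>A\<^esub> z) \<cdot>\<^bsub>B\<^esub> (Idt B (fobj ?R x) \<boxtimes>\<^bsub>B\<^esub> fmult ?R y z)
        \<cdot>\<^bsub>B\<^esub> Assoc B (fobj ?R x) (fobj ?R y) (fobj ?R z)"
    using o i by (simp add: fs retr_simps Fcomp)
next
  let ?R = "fixed_retraction E" and ?m = "fmult E" and ?e = "farr E" and ?u = "funit E"
  fix x assume o: "x \<in> Obj A"
  let ?X = "fobj E x" and ?I = "fobj E \<one>\<^bsub>A\<^esub>"
  have O: "?X \<in> Obj A" using o by (simp add: ss)
  note i = A.arr_inv[OF unit_iso_id(1)[OF O]] A.arr_inv[OF unit_iso_id(2)[OF O]]
  show "farr ?R (LUnit A x) \<cdot>\<^bsub>B\<^esub> fmult ?R \<one>\<^bsub>A\<^esub> x \<cdot>\<^bsub>B\<^esub> (funit ?R \<boxtimes>\<^bsub>B\<^esub> Idt B (fobj ?R x)) = LUnit B (fobj ?R x)"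
  proof -
    have "?e (LUnit A x) \<cdot>\<^bsub>A\<^esub> ?e (?m \<one>\<^bsub>A\<^esub> x) = ?e (LUnit A ?X \<cdot>\<^bsub>A\<^esub> arr_inv A (?u \<boxtimes>\<^bsub>A\<^esub> Idt A ?X))"
      using fmult_LUnit[OF o, symmetric] o i by (simp add: es Fcomp A.assoc_simp)
    then show ?thesis using o i by (simp add: fs retr_simps E_unit_fixed Fcomp)
  qed
  show "farr ?R (RUnit A x) \<cdot>\<^bsub>B\<^esub> fmult ?R x \<one>\<^bsub>A\<^esub> \<cdot>\<^bsub>B\<^esub> (Idt B (fobj ?R x) \<boxtimes>\<^bsub>B\<^esub> funit ?R) = RUnit B (fobj ?R x)"
  proof -
    have "?e (RUnit A x) \<cdot>\<^bsub>A\<^esub> ?e (?m x \<one>\<^bsub>A\<^esub>) = ?e (RUnit A ?X \<cdot>\<^bsub>A\<^esub> arr_inv A (Idt A ?X \<boxtimes>\<^bsub>A\<^esub> ?u))"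
      using fmult_RUnit[OF o, symmetric] o i by (simp add: es Fcomp A.assoc_simp)
    then show ?thesis using o i by (simp add: fs retr_simps E_unit_fixed Fcomp)
  qed
next
  let ?R = "fixed_retraction E" and ?e = "farr E" and ?m = "fmult E"
  fix f g x y x' y' assume "f \<in> Hom A x x'" "g \<in> Hom A y y'"
  then have h: "f \<in> Arr A" "g \<in> Arr A" "Dom A f = x" "Dom A g = y" "Cod A f = x'" "Cod A g = y'"
    by (simp_all add: Hom_def)
  then have o: "x \<in> Obj A" "y \<in> Obj A" "x' \<in> Obj A" "y' \<in> Obj A" by (auto simp: ss)
  have "?e (?m x' y') \<cdot>\<^bsub>A\<^esub> ?e (?e f \<boxtimes>\<^bsub>A\<^esub> ?e g) = ?e (?m x' y' \<cdot>\<^bsub>A\<^esub> (?e f \<boxtimes>\<^bsub>A\<^esub> ?e g))"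
    using h o by (simp add: es Fcomp)
  also have "\<dots> = ?e (?e (f \<boxtimes>\<^bsub>A\<^esub> g)) \<cdot>\<^bsub>A\<^esub> ?e (?m x y)"
    using h o phi_nat[OF h] by (simp add: es Fcomp)
  finally show "fmult ?R x' y' \<cdot>\<^bsub>B\<^esub> (farr ?R f \<boxtimes>\<^bsub>B\<^esub> farr ?R g) = farr ?R (f \<boxtimes>\<^bsub>A\<^esub> g) \<cdot>\<^bsub>B\<^esub> fmult ?R x y"
    using h o by (simp add: fs retr_simps)
next
  show "iso_in B (funit (fixed_retraction E))" using funit_iso iso_fixed by (simp add: retr_simps)
qed (simp_all add: fs retr_simps is_functor_retr Hom_def)

lemma fixed_small:
  assumes "A \<in> small_moncats" shows "B \<in> small_moncats"
proof -
  have "small_category B"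
    using assms category_fixed small_set_subset[of _ "Obj A" "Obj B"] small_set_subset[of _ "Arr A" "Arr B"]
    by (auto simp: small_moncats_def small_category_def fixed_sets)
  moreover have "extensional_moncat B"
    unfolding extensional_moncat_def fixed_sets by (auto simp: fixed_moncat_def Let_def fdom)
  ultimately show ?thesis using B.monoidal_category_axioms by (simp add: small_moncats_def)
qed

end

theorem idempotents_split_MonCat_p: "idempotents_split MonCat_p"
  unfolding idempotents_split_def MonCat_simps
proof (intro ballI impI)
  fix A :: "('u, 'u) moncat" and E
  assume A: "A \<in> small_moncats" and E: "E \<in> mor MonCat_p A A"
    and idem: "mftor_comp E E = E"
  show "\<exists>B\<in>small_moncats. \<exists>r\<in>mor MonCat_p A B. \<exists>s\<in>mor MonCat_p B A. E = mftor_comp s r \<and> mftor_comp r s = mftor_id B"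
  proof -
    have AE: "fdom E = A" "fcod E = A" "E \<in> mftors" using E by (simp_all add: mor_MonCat)
    interpret monoidal_idempotent A E
      using mftorsD(1)[OF AE(3)] AE idem by (simp add: monoidal_idempotent_def monoidal_idempotent_axioms_def)
    have B: "B \<in> small_moncats" by (rule fixed_small[OF A])
    have s: "fixed_inclusion E \<in> mftors"
      using A B monoidal_creation.strong_monoidal[OF creation]
      by (simp add: mftors_def incl_simps extensional_mftor_def) (auto simp: fixed_inclusion_def Let_def)
    have r: "fixed_retraction E \<in> mftors"
      using A B strong_monoidal_retr mftorsD(2)[OF AE(3)]
      by (simp add: mftors_def retr_simps extensional_mftor_def AE) (auto simp: fixed_retraction_def AE)
    have "E = mftor_comp (fixed_inclusion E) (fixed_retraction E)"
      by (rule mftor_eqI[OF AE(3) mftor_comp_in[OF r s]])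
        (simp_all add: AE(1,2) mftor_comp_simps fs retr_simps E_mult E_unit)
    moreover have "mftor_comp (fixed_retraction E) (fixed_inclusion E) = mftor_id B"
      by (rule mftor_eqI[OF mftor_comp_in[OF s r] mftor_id_in[OF B]])
        (simp_all add: mftor_comp_simps mftor_id_def fs retr_simps E_mult_fixed E_unit_fixed)
    ultimately show ?thesis
      using B r s by (intro bexI[of _ B] bexI[of _ "fixed_retraction E"] bexI[of _ "fixed_inclusion E"])
        (simp_all add: mor_MonCat incl_simps retr_simps)
  qed
qed


section \<open>Words in a monoidal category\<close>

text \<open>
  A one-letter word evaluates to its letter, not to its product with the unit; this makes the
  retraction of words onto \<open>C\<close> strict.
\<close>

primrec word_val :: "('o, 'a, 'x) moncat_scheme \<Rightarrow> 'o list \<Rightarrow> 'o" where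
  "word_val C [] = \<one>\<^bsub>C\<^esub>"
| "word_val C (x # w) = (if w = [] then x else x \<otimes>\<^bsub>C\<^esub> word_val C w)"

text \<open>
  The rebracketing \<open>word_val C u \<otimes> word_val C v \<rightarrow> word_val C (u @ v)\<close> for nonempty words, where no
  unitor is involved.
\<close>

primrec word_join :: "('o, 'a, 'x) moncat_scheme \<Rightarrow> 'o list \<Rightarrow> 'o list \<Rightarrow> 'a" where
  "word_join C [] v = undefined"
| "word_join C (x # u) v = (if u = [] then Idt C (x \<otimes>\<^bsub>C\<^esub> word_val C v)
     else (Idt C x \<boxtimes>\<^bsub>C\<^esub> word_join C u v) \<cdot>\<^bsub>C\<^esub> Assoc C x (word_val C u) (word_val C v))"

definition word_mult :: "('o, 'a, 'x) moncat_scheme \<Rightarrow> 'o list \<Rightarrow> 'o list \<Rightarrow> 'a" where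
  "word_mult C u v = (if u = [] then LUnit C (word_val C v) else if v = [] then RUnit C (word_val C u)
     else word_join C u v)"

lemma (in category) arr_inv_Idt: "x \<in> Obj C \<Longrightarrow> arr_inv C (Idt C x) = Idt C x"
  using arr_inv[OF iso_in_Idt[of x]] by (simp add: arr_simps)

context monoidal_category begin

lemma word_val_in: "set w \<subseteq> Obj C \<Longrightarrow> word_val C w \<in> Obj C"
  by (induction w) (auto simp: cs)

lemma word_join_in:
  assumes "u \<noteq> []" "v \<noteq> []" "set u \<subseteq> Obj C" "set v \<subseteq> Obj C"
  shows "word_join C u v \<in> Arr C" "Dom C (word_join C u v) = word_val C u \<otimes> word_val C v"
    "Cod C (word_join C u v) = word_val C (u @ v)" "iso_in C (word_join C u v)"
proof -
  have "word_join C u v \<in> Arr C \<and> Dom C (word_join C u v) = word_val C u \<otimes> word_val C v \<and>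
    Cod C (word_join C u v) = word_val C (u @ v) \<and> iso_in C (word_join C u v)"
    using assms
  proof (induction u rule: list_nonempty_induct)
    case (single x)
    then show ?case by (auto simp: cs word_val_in iso_in_Idt)
  next
    case (cons x u)
    then have o: "x \<in> Obj C" "word_val C u \<in> Obj C" "word_val C v \<in> Obj C" by (auto simp: word_val_in)
    have ih: "word_join C u v \<in> Arr C" "Dom C (word_join C u v) = word_val C u \<otimes> word_val C v"
      "Cod C (word_join C u v) = word_val C (u @ v)" "iso_in C (word_join C u v)"
      using cons by auto
    have "iso_in C ((Idt C x \<boxtimes> word_join C u v) \<cdot> Assoc C x (word_val C u) (word_val C v))"
      using o ih by (intro iso_in_Comp tens_iso iso_in_Idt Assoc_iso) (simp_all add: cs)
    then show ?case using o ih cons(1) by (simp add: cs)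
  qed
  then show "word_join C u v \<in> Arr C" "Dom C (word_join C u v) = word_val C u \<otimes> word_val C v"
    "Cod C (word_join C u v) = word_val C (u @ v)" "iso_in C (word_join C u v)" by auto
qed

lemma word_join_assoc:
  assumes "u \<noteq> []" "v \<noteq> []" "w \<noteq> []" "set u \<subseteq> Obj C" "set v \<subseteq> Obj C" "set w \<subseteq> Obj C"
  shows "word_join C (u @ v) w \<cdot> (word_join C u v \<boxtimes> Idt C (word_val C w)) =
    word_join C u (v @ w) \<cdot> (Idt C (word_val C u) \<boxtimes> word_join C v w) \<cdot>
      Assoc C (word_val C u) (word_val C v) (word_val C w)"
  using assms
proof (induction u rule: list_nonempty_induct)
  case (single x)
  then have o: "x \<in> Obj C" "word_val C v \<in> Obj C" "word_val C w \<in> Obj C" "word_val C (v @ w) \<in> Obj C"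
    by (auto simp: word_val_in)
  then show ?case using single word_join_in[of v w] by (simp add: cs)
next
  case (cons x u)
  let ?u = "word_val C u" and ?v = "word_val C v" and ?w = "word_val C w" and ?a = "Assoc C" and ?j = "word_join C"
  have o: "x \<in> Obj C" "?u \<in> Obj C" "?v \<in> Obj C" "?w \<in> Obj C" "word_val C (v @ w) \<in> Obj C" "word_val C (u @ v) \<in> Obj C"
    "word_val C (u @ v @ w) \<in> Obj C"
    and l: "set u \<subseteq> Obj C" "set v \<subseteq> Obj C" "set w \<subseteq> Obj C" "set (v @ w) \<subseteq> Obj C" "set (u @ v) \<subseteq> Obj C"
    using cons by (auto simp: word_val_in)
  note ne = cons(1,3,4)
  note j = word_join_in(1-3)[of u v] word_join_in(1-3)[of v w] word_join_in(1-3)[of "u @ v" w] word_join_in(1-3)[of u "v @ w"]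
  note s = o ne l j cs
  have n1: "?a x (word_val C (u @ v)) ?w \<cdot> ((Idt C x \<boxtimes> ?j u v) \<boxtimes> Idt C ?w) = (Idt C x \<boxtimes> (?j u v \<boxtimes> Idt C ?w)) \<cdot> ?a x (?u \<otimes> ?v) ?w"
    by (intro assoc_nat) (simp_all add: s)
  have n2: "?a x ?u (word_val C (v @ w)) \<cdot> ((Idt C x \<boxtimes> Idt C ?u) \<boxtimes> ?j v w) = (Idt C x \<boxtimes> (Idt C ?u \<boxtimes> ?j v w)) \<cdot> ?a x ?u (?v \<otimes> ?w)"
    by (intro assoc_nat) (simp_all add: s)
  have "((Idt C x \<boxtimes> ?j (u @ v) w) \<cdot> ?a x (word_val C (u @ v)) ?w) \<cdot> (((Idt C x \<boxtimes> ?j u v) \<cdot> ?a x ?u ?v) \<boxtimes> Idt C ?w)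
    = (Idt C x \<boxtimes> ?j (u @ v) w) \<cdot> (?a x (word_val C (u @ v)) ?w \<cdot> ((Idt C x \<boxtimes> ?j u v) \<boxtimes> Idt C ?w)) \<cdot> (?a x ?u ?v \<boxtimes> Idt C ?w)"
    by (simp add: s assoc_simp tens_id_comp)
  also have "\<dots> = (Idt C x \<boxtimes> (?j (u @ v) w \<cdot> (?j u v \<boxtimes> Idt C ?w))) \<cdot> (?a x (?u \<otimes> ?v) ?w \<cdot> (?a x ?u ?v \<boxtimes> Idt C ?w))"
    unfolding n1 by (simp add: s assoc_simp id_tens_comp)
  also have "?j (u @ v) w \<cdot> (?j u v \<boxtimes> Idt C ?w) = ?j u (v @ w) \<cdot> (Idt C ?u \<boxtimes> ?j v w) \<cdot> ?a ?u ?v ?w"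
    using cons by auto
  also have "(Idt C x \<boxtimes> \<dots>) \<cdot> (?a x (?u \<otimes> ?v) ?w \<cdot> (?a x ?u ?v \<boxtimes> Idt C ?w))
    = (Idt C x \<boxtimes> ?j u (v @ w)) \<cdot> (Idt C x \<boxtimes> (Idt C ?u \<boxtimes> ?j v w)) \<cdot>
      ((Idt C x \<boxtimes> ?a ?u ?v ?w) \<cdot> ?a x (?u \<otimes> ?v) ?w \<cdot> (?a x ?u ?v \<boxtimes> Idt C ?w))"
    by (simp add: s assoc_simp id_tens_comp)
  also have "\<dots> = (Idt C x \<boxtimes> ?j u (v @ w)) \<cdot> ((Idt C x \<boxtimes> (Idt C ?u \<boxtimes> ?j v w)) \<cdot> ?a x ?u (?v \<otimes> ?w)) \<cdot> ?a (x \<otimes> ?u) ?v ?w"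
    unfolding pentagon[OF o(1-4), symmetric] by (simp add: s assoc_simp)
  also have "\<dots> = ((Idt C x \<boxtimes> ?j u (v @ w)) \<cdot> ?a x ?u (word_val C (v @ w))) \<cdot> (Idt C (x \<otimes> ?u) \<boxtimes> ?j v w) \<cdot> ?a (x \<otimes> ?u) ?v ?w"
    unfolding n2[symmetric] by (simp add: s assoc_simp)
  finally show ?case using ne by simp
qed

lemma word_mult_in:
  assumes "set u \<subseteq> Obj C" "set v \<subseteq> Obj C"
  shows "word_mult C u v \<in> Arr C" "Dom C (word_mult C u v) = word_val C u \<otimes> word_val C v"
    "Cod C (word_mult C u v) = word_val C (u @ v)" "iso_in C (word_mult C u v)"
  using assms word_join_in[of u v] LUnit_iso RUnit_iso by (auto simp: word_mult_def cs word_val_in)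

lemma word_mult_Nil: "word_mult C [] v = LUnit C (word_val C v)" "word_mult C v [] = RUnit C (word_val C v)"
  by (simp_all add: word_mult_def LUnit_unit)

text \<open>
  If no word is empty, this is induction on \<open>u\<close> with the pentagon (\<open>word_join_assoc\<close>). If the first,
  the second or the third word is empty, it is \<open>LUnit_tens\<close>, the triangle or \<open>RUnit_tens\<close>. Where
  these cases overlap, both unitors apply, and \<open>LUnit_unit\<close> identifies them.
\<close>

lemma word_mult_assoc:
  assumes l: "set u \<subseteq> Obj C" "set v \<subseteq> Obj C" "set w \<subseteq> Obj C"
  shows "word_mult C (u @ v) w \<cdot> (word_mult C u v \<boxtimes> Idt C (word_val C w)) =
    word_mult C u (v @ w) \<cdot> (Idt C (word_val C u) \<boxtimes> word_mult C v w) \<cdot>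
      Assoc C (word_val C u) (word_val C v) (word_val C w)"
proof -
  let ?u = "word_val C u" and ?v = "word_val C v" and ?w = "word_val C w" and ?m = "word_mult C"
  have o: "?u \<in> Obj C" "?v \<in> Obj C" "?w \<in> Obj C" using l by (simp_all add: word_val_in)
  note s = o cs word_mult_in(1-3)[OF l(1,2)] word_mult_in(1-3)[OF l(2,3)]
  consider "u = []" | "v = []" | "w = []" | "u \<noteq> []" "v \<noteq> []" "w \<noteq> []" by blast
  then show ?thesis
  proof cases
    case 1
    have "LUnit C (word_val C (v @ w)) \<cdot> (Idt C \<one> \<boxtimes> ?m v w) = ?m v w \<cdot> LUnit C (?v \<otimes> ?w)"
      by (rule lunit_nat) (simp_all add: s)
    then show ?thesis using 1 LUnit_tens[of ?v ?w] by (simp add: word_mult_Nil s assoc_simp)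
  next
    case 2
    then show ?thesis using triangle[of ?u ?w] word_mult_in(1-3)[OF l(1,3)] by (simp add: word_mult_Nil s assoc_simp)
  next
    case 3
    have "RUnit C (word_val C (u @ v)) \<cdot> (?m u v \<boxtimes> Idt C \<one>) = ?m u v \<cdot> RUnit C (?u \<otimes> ?v)"
      by (rule runit_nat) (simp_all add: s)
    then show ?thesis using 3 RUnit_tens[of ?u ?v] by (simp add: word_mult_Nil s assoc_simp)
  next
    case 4
    then show ?thesis using word_join_assoc[of u v w] l by (simp add: word_mult_def)
  qed
qed

end

section \<open>The strictification of a monoidal category\<close>

definition word_arrows :: "('u, 'u) moncat \<Rightarrow> ('u list \<times> 'u \<times> 'u list) set" where
  "word_arrows X = {(u, f, v). set u \<subseteq> Obj X \<and> set v \<subseteq> Obj X \<and> f \<in> Hom X (word_val X u) (word_val X v)}"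

text \<open>
  Small monoidal categories have their objects and arrows in \<open>'u\<close>; so words, and arrows together
  with the words that they connect, are coded by elements of \<open>'u\<close>.
\<close>

locale coded_words = monoidal_category X
  for X :: "('u, 'u) moncat" +
  fixes c :: "'u list \<Rightarrow> 'u" and t :: "'u list \<times> 'u \<times> 'u list \<Rightarrow> 'u"
  assumes inj_c: "inj c" and inj_t: "inj t"
begin

text \<open>
  An arrow between words is an arrow between their values, and the tensor product of arrows is that
  of \<open>X\<close> conjugated by \<open>word_mult\<close>. Identities serve as associators since \<open>word_mult_assoc\<close> says
  exactly that conjugation turns the associator of \<open>X\<close> into an identity.
\<close>

definition strictification :: "('u, 'u) moncat" where
  "strictification = (let W = c ` {w. set w \<subseteq> Obj X}; T = t ` word_arrows X;
       w = inv c; src = (\<lambda>a. fst (inv t a)); mid = (\<lambda>a. fst (snd (inv t a))); tgt = (\<lambda>a. snd (snd (inv t a)));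
       idt = (\<lambda>u. t (u, Idt X (word_val X u), u)) in
    \<lparr>Obj = W, Arr = T, Dom = (\<lambda>a \<in> T. c (src a)), Cod = (\<lambda>a \<in> T. c (tgt a)), Idt = (\<lambda>p \<in> W. idt (w p)),
     Comp = (\<lambda>b a. if a \<in> T \<and> b \<in> T \<and> src b = tgt a then t (src a, mid b \<cdot>\<^bsub>X\<^esub> mid a, tgt b) else undefined),
     Tens = (\<lambda>p q. if p \<in> W \<and> q \<in> W then c (w p @ w q) else undefined),
     TensA = (\<lambda>a b. if a \<in> T \<and> b \<in> T then
       t (src a @ src b, word_mult X (tgt a) (tgt b) \<cdot>\<^bsub>X\<^esub> (mid a \<boxtimes>\<^bsub>X\<^esub> mid b) \<cdot>\<^bsub>X\<^esub> arr_inv X (word_mult X (src a) (src b)),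
         tgt a @ tgt b) else undefined),
     Unit = c [],
     Assoc = (\<lambda>p q r. if p \<in> W \<and> q \<in> W \<and> r \<in> W then idt (w p @ w q @ w r) else undefined),
     LUnit = (\<lambda>p \<in> W. idt (w p)), RUnit = (\<lambda>p \<in> W. idt (w p))\<rparr>)"

definition evaluation :: "'u mftor" where
  "evaluation = (let S = strictification in
    \<lparr>fdom = S, fcod = X, fobj = (\<lambda>p \<in> Obj S. word_val X (inv c p)), farr = (\<lambda>a \<in> Arr S. fst (snd (inv t a))),
     fmult = (\<lambda>p q. if p \<in> Obj S \<and> q \<in> Obj S then word_mult X (inv c p) (inv c q) else undefined),
     funit = Idt X \<one>\<^bsub>X\<^esub>\<rparr>)"

definition letters :: "'u mftor" where
  "letters =
    \<lparr>fdom = X, fcod = strictification, fobj = (\<lambda>x \<in> Obj X. c [x]), farr = (\<lambda>f \<in> Arr X. t ([Dom X f], f, [Cod X f])),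
     fmult = (\<lambda>x y. if x \<in> Obj X \<and> y \<in> Obj X
       then t ([x, y], Idt X (x \<otimes>\<^bsub>X\<^esub> y), [x \<otimes>\<^bsub>X\<^esub> y]) else undefined),
     funit = t ([], Idt X \<one>\<^bsub>X\<^esub>, [\<one>\<^bsub>X\<^esub>])\<rparr>"

abbreviation "S \<equiv> strictification"
abbreviation "val \<equiv> word_val X"

lemma code_simps: "inv c (c u) = u" "inv t (t a) = a" "c u = c v \<longleftrightarrow> u = v" "t a = t b \<longleftrightarrow> a = b"
  using inj_c inj_t by (simp_all add: inj_eq)

lemma Obj_S: "Obj S = c ` {w. set w \<subseteq> Obj X}" and Arr_S: "Arr S = t ` word_arrows X"
  by (simp_all add: strictification_def Let_def)

lemma Obj_S_iff: "c u \<in> Obj S \<longleftrightarrow> set u \<subseteq> Obj X"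
  unfolding Obj_S using inj_c by (auto simp: inj_image_mem_iff)

lemma Arr_S_iff: "t (u, f, v) \<in> Arr S \<longleftrightarrow>
    set u \<subseteq> Obj X \<and> set v \<subseteq> Obj X \<and> f \<in> Arr X \<and> Dom X f = val u \<and> Cod X f = val v"
  unfolding Arr_S using inj_t by (auto simp: inj_image_mem_iff word_arrows_def Hom_def)

lemma Obj_S_E: assumes "p \<in> Obj S" obtains u where "p = c u" "set u \<subseteq> Obj X"
  using assms by (auto simp: Obj_S)

lemma Arr_S_E:
  assumes "a \<in> Arr S"
  obtains u f v where "a = t (u, f, v)" "set u \<subseteq> Obj X" "set v \<subseteq> Obj X" "f \<in> Arr X" "Dom X f = val u" "Cod X f = val v"
proof -
  obtain u f v where "a = t (u, f, v)" using assms by (auto simp: Arr_S)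
  then show ?thesis using assms that by (simp add: Arr_S_iff)
qed

lemma S_simps:
  "t (u, f, v) \<in> Arr S \<Longrightarrow> Dom S (t (u, f, v)) = c u"
  "t (u, f, v) \<in> Arr S \<Longrightarrow> Cod S (t (u, f, v)) = c v"
  "set u \<subseteq> Obj X \<Longrightarrow> Idt S (c u) = t (u, Idt X (val u), u)"
  "t (u, f, v) \<in> Arr S \<Longrightarrow> t (v, g, w) \<in> Arr S \<Longrightarrow> t (v, g, w) \<cdot>\<^bsub>S\<^esub> t (u, f, v) = t (u, g \<cdot>\<^bsub>X\<^esub> f, w)"
  "set u \<subseteq> Obj X \<Longrightarrow> set v \<subseteq> Obj X \<Longrightarrow> c u \<otimes>\<^bsub>S\<^esub> c v = c (u @ v)"
  "t (u, f, v) \<in> Arr S \<Longrightarrow> t (u', g, v') \<in> Arr S \<Longrightarrow> t (u, f, v) \<boxtimes>\<^bsub>S\<^esub> t (u', g, v') =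
    t (u @ u', word_mult X v v' \<cdot>\<^bsub>X\<^esub> (f \<boxtimes>\<^bsub>X\<^esub> g) \<cdot>\<^bsub>X\<^esub> arr_inv X (word_mult X u u'), v @ v')"
  "\<one>\<^bsub>S\<^esub> = c []"
  "set u \<subseteq> Obj X \<Longrightarrow> set v \<subseteq> Obj X \<Longrightarrow> set w \<subseteq> Obj X \<Longrightarrow>
    Assoc S (c u) (c v) (c w) = t (u @ v @ w, Idt X (val (u @ v @ w)), u @ v @ w)"
  "set u \<subseteq> Obj X \<Longrightarrow> LUnit S (c u) = t (u, Idt X (val u), u)"
  "set u \<subseteq> Obj X \<Longrightarrow> RUnit S (c u) = t (u, Idt X (val u), u)"
  unfolding Arr_S
  by (simp_all add: strictification_def Let_def code_simps inj_image_mem_iff[OF inj_c])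

lemma evaluation_simps:
  "fdom evaluation = S" "fcod evaluation = X"
  "set u \<subseteq> Obj X \<Longrightarrow> fobj evaluation (c u) = val u"
  "t (u, f, v) \<in> Arr S \<Longrightarrow> farr evaluation (t (u, f, v)) = f"
  "set u \<subseteq> Obj X \<Longrightarrow> set v \<subseteq> Obj X \<Longrightarrow> fmult evaluation (c u) (c v) = word_mult X u v"
  "funit evaluation = Idt X \<one>\<^bsub>X\<^esub>"
  by (simp_all add: evaluation_def Let_def code_simps Obj_S_iff)

lemma letters_simps:
  "fdom letters = X" "fcod letters = S"
  "x \<in> Obj X \<Longrightarrow> fobj letters x = c [x]"
  "f \<in> Arr X \<Longrightarrow> farr letters f = t ([Dom X f], f, [Cod X f])"
  "x \<in> Obj X \<Longrightarrow> y \<in> Obj X \<Longrightarrow> fmult letters x y = t ([x, y], Idt X (x \<otimes>\<^bsub>X\<^esub> y), [x \<otimes>\<^bsub>X\<^esub> y])"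
  "funit letters = t ([], Idt X \<one>\<^bsub>X\<^esub>, [\<one>\<^bsub>X\<^esub>])"
  by (simp_all add: letters_def)

lemmas sm = S_simps Obj_S_iff Arr_S_iff cs word_val_in word_mult_in(1-3) arr_inv(2-4)[OF word_mult_in(4)] code_simps

lemma category_S: "category S"
  by unfold_locales (auto elim!: Obj_S_E Arr_S_E simp: Hom_def sm assoc_simp)

lemma iso_S:
  assumes "iso_in X f" "set u \<subseteq> Obj X" "set v \<subseteq> Obj X" "Dom X f = val u" "Cod X f = val v"
  shows "iso_in S (t (u, f, v))"
  unfolding iso_in_def using assms arr_inv[OF assms(1)]
  by (intro conjI bexI[of _ "t (v, arr_inv X f, u)"]) (simp_all add: sm Hom_def)

lemma creation: "monoidal_creation X S evaluation"
proof (intro monoidal_creation.intro monoidal_creation_axioms.intro monoidal_category_axioms category_S)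
  show "is_functor S X (fobj evaluation) (farr evaluation)"
    unfolding is_functor_def by (auto elim!: Obj_S_E Arr_S_E simp: Hom_def sm evaluation_simps)
  fix f g assume "f \<in> Arr S" "g \<in> Arr S"
  then obtain u u' h v v' k where h: "f = t (u, h, u')" "set u \<subseteq> Obj X" "set u' \<subseteq> Obj X" "h \<in> Arr X" "Dom X h = val u" "Cod X h = val u'"
    "g = t (v, k, v')" "set v \<subseteq> Obj X" "set v' \<subseteq> Obj X" "k \<in> Arr X" "Dom X k = val v" "Cod X k = val v'"
    by (auto elim!: Arr_S_E)
  then show "f \<boxtimes>\<^bsub>S\<^esub> g \<in> Hom S (Dom S f \<otimes>\<^bsub>S\<^esub> Dom S g) (Cod S f \<otimes>\<^bsub>S\<^esub> Cod S g)"
    by (simp add: sm Hom_def)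
  show "f = g" if "Dom S f = Dom S g" "Cod S f = Cod S g" "farr evaluation f = farr evaluation g"
    using that h by (simp add: sm evaluation_simps)
  show "fmult evaluation (Cod S f) (Cod S g) \<cdot>\<^bsub>X\<^esub> (farr evaluation f \<boxtimes>\<^bsub>X\<^esub> farr evaluation g) =
      farr evaluation (f \<boxtimes>\<^bsub>S\<^esub> g) \<cdot>\<^bsub>X\<^esub> fmult evaluation (Dom S f) (Dom S g)"
    using h arr_inv(5)[OF word_mult_in(4)[of u v]] by (simp add: sm evaluation_simps assoc_simp)
next
  fix p q r assume "p \<in> Obj S" "q \<in> Obj S" "r \<in> Obj S"
  then obtain u v w where h: "p = c u" "set u \<subseteq> Obj X" "q = c v" "set v \<subseteq> Obj X" "r = c w" "set w \<subseteq> Obj X"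
    by (auto elim!: Obj_S_E)
  show "Assoc S p q r \<in> Hom S ((p \<otimes>\<^bsub>S\<^esub> q) \<otimes>\<^bsub>S\<^esub> r) (p \<otimes>\<^bsub>S\<^esub> (q \<otimes>\<^bsub>S\<^esub> r))"
    using h by (simp add: sm Hom_def)
  show "iso_in S (Assoc S p q r)" using h by (auto simp: sm intro!: iso_S iso_in_Idt)
  show "farr evaluation (Assoc S p q r) \<cdot>\<^bsub>X\<^esub> fmult evaluation (p \<otimes>\<^bsub>S\<^esub> q) r \<cdot>\<^bsub>X\<^esub>
      (fmult evaluation p q \<boxtimes>\<^bsub>X\<^esub> Idt X (fobj evaluation r)) =
    fmult evaluation p (q \<otimes>\<^bsub>S\<^esub> r) \<cdot>\<^bsub>X\<^esub> (Idt X (fobj evaluation p) \<boxtimes>\<^bsub>X\<^esub> fmult evaluation q r) \<cdot>\<^bsub>X\<^esub>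
      Assoc X (fobj evaluation p) (fobj evaluation q) (fobj evaluation r)"
    using h word_mult_assoc[of u v w] by (simp add: sm evaluation_simps)
qed (auto elim!: Obj_S_E simp: Hom_def sm evaluation_simps word_mult_Nil intro!: iso_S iso_in_Idt word_mult_in(4))

sublocale S: monoidal_category S
  by (rule monoidal_creation.monoidal[OF creation])

lemma strict_S: "strict_monoidal S"
  unfolding strict_monoidal_def using S.monoidal_category_axioms by (auto elim!: Obj_S_E simp: sm)

lemma strong_monoidal_letters: "strong_monoidal_functor X S letters"
proof (intro strong_monoidal_functor.intro strong_monoidal_functor_axioms.intro
    monoidal_category_axioms S.monoidal_category_axioms)
  fix x y z assume o: "x \<in> Obj X" "y \<in> Obj X" "z \<in> Obj X"
  have i: "iso_in X (Assoc X x y z)" using o by (rule Assoc_iso)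
  show "farr letters (Assoc X x y z) \<cdot>\<^bsub>S\<^esub> fmult letters (x \<otimes>\<^bsub>X\<^esub> y) z \<cdot>\<^bsub>S\<^esub>
      (fmult letters x y \<boxtimes>\<^bsub>S\<^esub> Idt S (fobj letters z)) =
    fmult letters x (y \<otimes>\<^bsub>X\<^esub> z) \<cdot>\<^bsub>S\<^esub> (Idt S (fobj letters x) \<boxtimes>\<^bsub>S\<^esub> fmult letters y z) \<cdot>\<^bsub>S\<^esub>
      Assoc S (fobj letters x) (fobj letters y) (fobj letters z)"
    using o arr_inv[OF i] by (simp add: sm letters_simps word_mult_def arr_inv_Idt)
next
  fix x assume o: "x \<in> Obj X"
  show "farr letters (LUnit X x) \<cdot>\<^bsub>S\<^esub> fmult letters \<one>\<^bsub>X\<^esub> x \<cdot>\<^bsub>S\<^esub> (funit letters \<boxtimes>\<^bsub>S\<^esub> Idt S (fobj letters x)) =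
      LUnit S (fobj letters x)"
    using o arr_inv[OF LUnit_iso[OF o]] by (simp add: sm letters_simps word_mult_def)
  show "farr letters (RUnit X x) \<cdot>\<^bsub>S\<^esub> fmult letters x \<one>\<^bsub>X\<^esub> \<cdot>\<^bsub>S\<^esub> (Idt S (fobj letters x) \<boxtimes>\<^bsub>S\<^esub> funit letters) =
      RUnit S (fobj letters x)"
    using o arr_inv[OF RUnit_iso[OF o]] by (simp add: sm letters_simps word_mult_def)
next
  fix f g x y x' y' assume "f \<in> Hom X x x'" "g \<in> Hom X y y'"
  then have h: "f \<in> Arr X" "g \<in> Arr X" "Dom X f = x" "Dom X g = y" "Cod X f = x'" "Cod X g = y'"
    by (simp_all add: Hom_def)
  then have o: "x \<in> Obj X" "y \<in> Obj X" "x' \<in> Obj X" "y' \<in> Obj X" by (auto simp: cs)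
  show "fmult letters x' y' \<cdot>\<^bsub>S\<^esub> (farr letters f \<boxtimes>\<^bsub>S\<^esub> farr letters g) =
      farr letters (f \<boxtimes>\<^bsub>X\<^esub> g) \<cdot>\<^bsub>S\<^esub> fmult letters x y"
    using h o by (simp add: sm letters_simps word_mult_def arr_inv_Idt)
qed (auto simp: is_functor_def Hom_def sm letters_simps intro!: iso_S iso_in_Idt)

end


section \<open>Cardinalities of sets of words\<close>

lemma finite_card_less_infinite:
  assumes "finite A" "infinite B" shows "|A| <o |B|"
  using assms card_of_ordLeq_finite not_ordLeq_iff_ordLess[OF card_of_Well_order card_of_Well_order] by blast

lemma card_Times_le_infinite:
  assumes "infinite S" "|A| \<le>o |S|" "|B| \<le>o |S|" shows "|A \<times> B| \<le>o |S|"
  using assms by (intro card_of_Times_ordLeq_infinite_Field) (auto simp: Field_card_of card_of_card_order_on)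

lemma card_lists_infinite:
  fixes S :: "'b set"
  assumes "infinite S" shows "|{w. set w \<subseteq> S}| \<le>o |S|"
proof -
  have n: "|{w. set w \<subseteq> S \<and> length w = n}| \<le>o |S|" for n
  proof (induction n)
    case 0
    have "{w. set w \<subseteq> S \<and> length w = 0} = {[]}" by auto
    then have "|{w. set w \<subseteq> S \<and> length w = 0}| <o |S|" using assms by (simp add: finite_card_less_infinite)
    then show ?case by (rule ordLess_imp_ordLeq)
  next
    case (Suc n)
    have "{w. set w \<subseteq> S \<and> length w = Suc n} = (\<lambda>(x, w). x # w) ` (S \<times> {w. set w \<subseteq> S \<and> length w = n})"
      by (auto simp: length_Suc_conv image_iff)
    then have "|{w. set w \<subseteq> S \<and> length w = Suc n}| \<le>o |S \<times> {w. set w \<subseteq> S \<and> length w = n}|"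
      by (simp add: card_of_image)
    also have "|S \<times> {w. set w \<subseteq> S \<and> length w = n}| \<le>o |S|"
      using assms Suc by (intro card_Times_le_infinite) (auto intro: ordLeq_refl card_of_Card_order)
    finally show ?case .
  qed
  have "{w. set w \<subseteq> S} = (\<Union>n. {w. set w \<subseteq> S \<and> length w = n})" by auto
  moreover have "|\<Union>n. {w. set w \<subseteq> S \<and> length w = n}| \<le>o |S|"
    using assms n by (intro card_of_UNION_ordLeq_infinite) (auto simp: infinite_iff_card_of_nat)
  ultimately show ?thesis by simp
qed

lemma small_set_countable:
  assumes "uncountable (UNIV :: 'u set)" "countable S" shows "small_set TYPE('u) S"
proof (rule ccontr)
  assume "\<not> small_set TYPE('u) S"
  then have "|UNIV :: 'u set| \<le>o |S|" by (simp add: small_set_def not_ordLess_iff_ordLeq[OF card_of_Well_order card_of_Well_order])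
  then obtain f :: "'u \<Rightarrow> _" where "inj f" "range f \<subseteq> S" by (auto simp flip: card_of_ordLeq)
  then show False using assms countable_image_inj_on countable_subset by blast
qed

text \<open>
  The words over a finite set may be infinite in number but are countable; this is where the
  uncountability of \<open>'u\<close> enters.
\<close>

lemma small_set_lists:
  fixes S :: "'u set"
  assumes "uncountable (UNIV :: 'u set)" "small_set TYPE('u) S"
  shows "small_set TYPE('u) {w. set w \<subseteq> S}"
proof (cases "finite S")
  case True
  then have "countable {w. set w \<subseteq> S}" using countable_lists[of S] by (simp add: countable_finite lists_eq_set)
  then show ?thesis by (rule small_set_countable[OF assms(1)])
next
  case False
  then show ?thesis using card_lists_infinite assms(2) ordLeq_ordLess_trans unfolding small_set_def by blast
qed

lemma small_set_image:
  assumes "small_set U S" shows "small_set U (f ` S)"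
  using assms card_of_image ordLeq_ordLess_trans unfolding small_set_def by blast

lemma small_set_Times:
  assumes inf: "infinite (UNIV :: 'u set)" and S: "small_set TYPE('u) S" and T: "small_set TYPE('u) T"
  shows "small_set TYPE('u) (S \<times> T)"
proof (cases "finite S \<and> finite T")
  case True
  then show ?thesis using inf by (simp add: small_set_def finite_card_less_infinite)
next
  case False
  consider "|S| \<le>o |T|" | "|T| \<le>o |S|"
    using ordLeq_total[OF card_of_Well_order card_of_Well_order] by blast
  then show ?thesis
  proof cases
    case 1
    then have "infinite T" using False card_of_ordLeq_finite by blast
    then have "|S \<times> T| \<le>o |T|" using 1 by (intro card_Times_le_infinite) (auto intro: ordLeq_refl card_of_Card_order)
    then show ?thesis using T ordLeq_ordLess_trans unfolding small_set_def by blast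
  next
    case 2
    then have "infinite S" using False card_of_ordLeq_finite by blast
    then have "|S \<times> T| \<le>o |S|" using 2 by (intro card_Times_le_infinite) (auto intro: ordLeq_refl card_of_Card_order)
    then show ?thesis using S ordLeq_ordLess_trans unfolding small_set_def by blast
  qed
qed

section \<open>Every monoidal category is a retract of a strict one\<close>

lemma (in coded_words) small_S:
  assumes "uncountable (UNIV :: 'u set)" "X \<in> small_moncats"
  shows "S \<in> small_moncats"
proof -
  have i: "infinite (UNIV :: 'u set)" using assms(1) countable_finite by blast
  have s: "small_set TYPE('u) (Obj X)" "small_set TYPE('u) (Arr X)"
    using assms(2) by (simp_all add: small_moncats_def small_category_def)
  have l: "small_set TYPE('u) {w. set w \<subseteq> Obj X}" by (rule small_set_lists[OF assms(1) s(1)])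
  have "word_arrows X \<subseteq> {w. set w \<subseteq> Obj X} \<times> (Arr X \<times> {w. set w \<subseteq> Obj X})"
    by (auto simp: word_arrows_def Hom_def)
  then have "small_set TYPE('u) (word_arrows X)"
    using small_set_Times[OF i l small_set_Times[OF i s(2) l]] small_set_subset by blast
  then have "small_category S"
    using category_S small_set_image[OF l] small_set_image unfolding small_category_def Obj_S Arr_S by blast
  moreover have "extensional_moncat S"
    unfolding extensional_moncat_def
  proof (intro conjI allI impI)
    fix g f assume "\<not> (f \<in> Arr S \<and> g \<in> Arr S \<and> Dom S g = Cod S f)"
    then show "g \<cdot>\<^bsub>S\<^esub> f = undefined"
      by (auto simp: strictification_def Let_def code_simps)
  qed (auto simp: strictification_def Let_def)
  ultimately show ?thesis using S.monoidal_category_axioms by (simp add: small_moncats_def)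
qed

theorem retract_of_strict:
  fixes X :: "('u, 'u) moncat"
  assumes u: "uncountable (UNIV :: 'u set)" and X: "X \<in> small_moncats"
  obtains Y where "Y \<in> small_moncats" "strict_monoidal Y" "is_retract_of MonCat_p X Y"
proof -
  have i: "infinite (UNIV :: 'u set)" using u countable_finite by blast
  have l: "|UNIV :: 'u list set| \<le>o |UNIV :: 'u set|" using card_lists_infinite[OF i] by simp
  then obtain c :: "'u list \<Rightarrow> 'u" where c: "inj c" by (auto simp flip: card_of_ordLeq)
  have "|(UNIV :: 'u list set) \<times> (UNIV :: 'u set) \<times> (UNIV :: 'u list set)| \<le>o |UNIV :: 'u set|"
    using i l by (intro card_Times_le_infinite) (auto intro: ordLeq_refl card_of_Card_order)
  then obtain t :: "'u list \<times> 'u \<times> 'u list \<Rightarrow> 'u" where t: "inj t" by (auto simp flip: card_of_ordLeq)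
  interpret coded_words X c t
    using X c t by (simp add: coded_words_def coded_words_axioms_def small_moncats_def)
  have S: "S \<in> small_moncats" by (rule small_S[OF u X])
  have e: "evaluation \<in> mftors"
    using X S monoidal_creation.strong_monoidal[OF creation]
    by (simp add: mftors_def evaluation_simps extensional_mftor_def) (auto simp: evaluation_def Let_def)
  have s: "letters \<in> mftors"
    using X S strong_monoidal_letters
    by (simp add: mftors_def letters_simps extensional_mftor_def) (auto simp: letters_def)
  have "mftor_comp evaluation letters = mftor_id X"
    by (rule mftor_eqI[OF mftor_comp_in[OF s e] mftor_id_in[OF X]])
      (simp_all add: mftor_comp_simps mftor_id_def letters_simps evaluation_simps sm word_mult_def)
  then have "is_retract_of MonCat_p X S" unfolding is_retract_of_def
    using e s by (intro bexI[of _ evaluation] bexI[of _ letters])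
      (simp_all add: MonCat_simps mor_MonCat letters_simps evaluation_simps)
  then show ?thesis by (rule that[OF S strict_S])
qed

section \<open>A monoidal category that is not isomorphic to a strict one\<close>

text \<open>
  The example is a preorder, so all diagrams commute in it. Its objects \<open>a\<close> and \<open>b\<close> are isomorphic
  and \<open>i\<close> is isomorphic to neither; an arrow is coded by the pair of its ends. Up to isomorphism the
  objects form the group with two elements, which is why \<open>mul\<close> is associative up to isomorphism.
\<close>

locale twins =
  fixes i a b :: 'u and k :: "'u \<times> 'u \<Rightarrow> 'u"
  assumes distinct: "i \<noteq> a" "i \<noteq> b" "a \<noteq> b" and inj_k: "inj k"
begin

definition mul :: "'u \<Rightarrow> 'u \<Rightarrow> 'u" where
  "mul x y = (if x = i then y else if y = i then x else i)"

definition twin_moncat :: "('u, 'u) moncat" where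
  "twin_moncat = (let S = {i, a, b}; T = k ` {(x, y). x \<in> S \<and> y \<in> S \<and> (x = i \<longleftrightarrow> y = i)};
      src = (\<lambda>f. fst (inv k f)); tgt = (\<lambda>f. snd (inv k f)) in
    \<lparr>Obj = S, Arr = T, Dom = restrict src T, Cod = restrict tgt T, Idt = (\<lambda>x \<in> S. k (x, x)),
     Comp = (\<lambda>g f. if f \<in> T \<and> g \<in> T \<and> src g = tgt f then k (src f, tgt g) else undefined),
     Tens = (\<lambda>x y. if x \<in> S \<and> y \<in> S then mul x y else undefined),
     TensA = (\<lambda>f g. if f \<in> T \<and> g \<in> T then k (mul (src f) (src g), mul (tgt f) (tgt g)) else undefined),
     Unit = i,
     Assoc = (\<lambda>x y z. if x \<in> S \<and> y \<in> S \<and> z \<in> S then k (mul (mul x y) z, mul x (mul y z)) else undefined),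
     LUnit = (\<lambda>x \<in> S. k (x, x)), RUnit = (\<lambda>x \<in> S. k (x, x))\<rparr>)"

abbreviation "X \<equiv> twin_moncat"

lemma Obj_X: "Obj X = {i, a, b}"
  and Arr_X: "Arr X = k ` {(x, y). x \<in> Obj X \<and> y \<in> Obj X \<and> (x = i \<longleftrightarrow> y = i)}"
  by (simp_all add: twin_moncat_def Let_def)

lemma Arr_X_iff: "k (x, y) \<in> Arr X \<longleftrightarrow> x \<in> Obj X \<and> y \<in> Obj X \<and> (x = i \<longleftrightarrow> y = i)"
  unfolding Arr_X using inj_k by (auto simp: inj_image_mem_iff)

lemma Arr_X_E:
  assumes "f \<in> Arr X" obtains x y where "f = k (x, y)" "x \<in> Obj X" "y \<in> Obj X" "x = i \<longleftrightarrow> y = i"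
  using assms by (auto simp: Arr_X)

lemma X_simps:
  "k (x, y) \<in> Arr X \<Longrightarrow> Dom X (k (x, y)) = x"
  "k (x, y) \<in> Arr X \<Longrightarrow> Cod X (k (x, y)) = y"
  "x \<in> Obj X \<Longrightarrow> Idt X x = k (x, x)"
  "k (x, y) \<in> Arr X \<Longrightarrow> k (y, z) \<in> Arr X \<Longrightarrow> k (y, z) \<cdot>\<^bsub>X\<^esub> k (x, y) = k (x, z)"
  "x \<in> Obj X \<Longrightarrow> y \<in> Obj X \<Longrightarrow> x \<otimes>\<^bsub>X\<^esub> y = mul x y"
  "k (x, y) \<in> Arr X \<Longrightarrow> k (z, w) \<in> Arr X \<Longrightarrow> k (x, y) \<boxtimes>\<^bsub>X\<^esub> k (z, w) = k (mul x z, mul y w)"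
  "\<one>\<^bsub>X\<^esub> = i"
  "x \<in> Obj X \<Longrightarrow> y \<in> Obj X \<Longrightarrow> z \<in> Obj X \<Longrightarrow> Assoc X x y z = k (mul (mul x y) z, mul x (mul y z))"
  "x \<in> Obj X \<Longrightarrow> LUnit X x = k (x, x)" "x \<in> Obj X \<Longrightarrow> RUnit X x = k (x, x)"
  unfolding Arr_X Obj_X
  by (simp_all add: twin_moncat_def Let_def inv_f_f[OF inj_k])

lemma mul_simps:
  "x \<in> Obj X \<Longrightarrow> y \<in> Obj X \<Longrightarrow> mul x y \<in> Obj X"
  "x \<in> Obj X \<Longrightarrow> y \<in> Obj X \<Longrightarrow> mul x y = i \<longleftrightarrow> (x = i \<longleftrightarrow> y = i)"
  "mul i x = x" "mul x i = x" "i \<in> Obj X"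
  by (auto simp: mul_def Obj_X)

lemmas xs = X_simps Arr_X_iff mul_simps

lemma iso_X: "k (x, y) \<in> Arr X \<Longrightarrow> iso_in X (k (x, y))"
  unfolding iso_in_def by (intro conjI bexI[of _ "k (y, x)"]) (simp_all add: xs Hom_def)

lemma monoidal_category_X: "monoidal_category X"
  apply unfold_locales
                      apply (auto elim!: Arr_X_E intro!: iso_X simp: Hom_def xs)
  subgoal for x y z by (cases "x = i"; cases "y = i"; cases "z = i"; simp add: xs)
  subgoal for x y z by (cases "x = i"; cases "y = i"; cases "z = i"; simp add: xs)
  subgoal for w x y z by (cases "w = i"; cases "x = i"; cases "y = i"; cases "z = i"; simp add: xs)
  done

lemma small_X:
  assumes "uncountable (UNIV :: 'u set)" shows "X \<in> small_moncats"
proof -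
  have "finite (Obj X)" by (simp add: Obj_X)
  moreover have "Arr X \<subseteq> k ` (Obj X \<times> Obj X)" by (auto simp: Arr_X)
  ultimately have "countable (Obj X)" "countable (Arr X)"
    using finite_subset[of "Arr X" "k ` (Obj X \<times> Obj X)"] by (simp_all add: countable_finite)
  then have "small_set TYPE('u) (Obj X)" "small_set TYPE('u) (Arr X)"
    using small_set_countable[OF assms] by blast+
  then have "small_category X"
    using monoidal_category_X by (simp add: small_category_def monoidal_category_def)
  moreover have "extensional_moncat X"
    unfolding extensional_moncat_def by (auto simp: twin_moncat_def Let_def)
  ultimately show ?thesis using monoidal_category_X by (simp add: small_moncats_def)
qed

text \<open>
  An object connected to \<open>i\<close> by an arrow equals \<open>i\<close>, and an isomorphism transports this property to
  \<open>B\<close>. The structure maps of \<open>F\<close> are such arrows, so they give equations between objects: the unit of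
  \<open>B\<close> is the image of \<open>i\<close> and every product of the images of \<open>a\<close> and \<open>b\<close> is the unit.
\<close>

lemma not_iso_strict:
  assumes F: "F \<in> mftors" "fdom F = X" "fcod F = B" and G: "G \<in> mftors" "fdom G = B" "fcod G = X"
    and GF: "mftor_comp G F = mftor_id X" and FG: "mftor_comp F G = mftor_id B"
    and B: "strict_monoidal B"
  shows False
proof -
  interpret F: strong_monoidal_functor X B F using mftorsD(1)[OF F(1)] F by simp
  interpret G: strong_monoidal_functor B X G using mftorsD(1)[OF G(1)] G by simp
  let ?f = "fobj F" and ?g = "fobj G"
  have gf: "?g (?f x) = x" if "x \<in> Obj X" for x
    using arg_cong[OF GF, of "\<lambda>H. fobj H x"] that F by (simp add: mftor_comp_simps mftor_id_simps)
  have fg: "?f (?g y) = y" if "y \<in> Obj B" for y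
    using arg_cong[OF FG, of "\<lambda>H. fobj H y"] that G by (simp add: mftor_comp_simps mftor_id_simps)
  have eq: "y = ?f i" if "f \<in> Hom B y (?f i) \<or> f \<in> Hom B (?f i) y" for f y
  proof -
    have f: "f \<in> Arr B" and y: "y \<in> Obj B" using that F.B.Dom_in F.B.Cod_in by (auto simp: Hom_def)
    have "farr G f \<in> Hom X (?g y) i \<or> farr G f \<in> Hom X i (?g y)"
      using that G.Fs f gf[of i] by (auto simp: Hom_def xs)
    then have "?g y = i" by (auto elim!: Arr_X_E simp: Hom_def xs)
    then show ?thesis using fg[OF y] by simp
  qed
  have o: "a \<in> Obj X" "b \<in> Obj X" "i \<in> Obj X" by (simp_all add: Obj_X)
  have unit: "\<one>\<^bsub>B\<^esub> = ?f i" using eq[of "funit F" "\<one>\<^bsub>B\<^esub>"] F.funit_in by (simp add: X_simps)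
  have m: "?f x \<otimes>\<^bsub>B\<^esub> ?f y = \<one>\<^bsub>B\<^esub>" if "x \<in> {a, b}" "y \<in> {a, b}" for x y
  proof -
    have "x \<otimes>\<^bsub>X\<^esub> y = i" using that distinct o by (auto simp: xs mul_def)
    then show ?thesis using eq F.fmult_in[of x y] that o unit by auto
  qed
  have "?f a = ?f a \<otimes>\<^bsub>B\<^esub> (?f b \<otimes>\<^bsub>B\<^esub> ?f b)" using B o F.Fs m by (simp add: strict_monoidal_def)
  also have "\<dots> = (?f a \<otimes>\<^bsub>B\<^esub> ?f b) \<otimes>\<^bsub>B\<^esub> ?f b" using B o F.Fs by (simp add: strict_monoidal_def)
  also have "\<dots> = ?f b" using B o F.Fs m by (simp add: strict_monoidal_def)
  finally show False using gf[of a] gf[of b] o distinct by simp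
qed

end

lemma SMonCat_simps:
  "Obj0 SMonCat_p = {A \<in> small_moncats. strict_monoidal A}"
  "f \<in> mor SMonCat_p A B \<longleftrightarrow> f \<in> mor MonCat_p A B \<and> strict_monoidal A \<and> strict_monoidal B"
  "cmp SMonCat_p = mftor_comp" "one SMonCat_p = mftor_id"
  by (auto simp: SMonCat_p_def full_sub_def MonCat_simps mor_def)

text \<open>
  With \<open>s\<close> and \<open>r\<close> exhibiting the three-object example as a retract of a strict monoidal category, and
  \<open>s'\<close> and \<open>r'\<close> splitting the idempotent \<open>s r\<close>, the functors \<open>r' s\<close> and \<open>r s'\<close> are inverse to each other.
\<close>

theorem idempotents_do_not_split_SMonCat_p:
  assumes u: "uncountable (UNIV :: 'u set)"
  shows "\<not> idempotents_split (SMonCat_p :: (('u, 'u) moncat, 'u mftor, 'u mntr) twocat)"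
proof
  assume split: "idempotents_split (SMonCat_p :: (('u, 'u) moncat, 'u mftor, 'u mntr) twocat)"
  have inf: "infinite (UNIV :: 'u set)" using u countable_finite by blast
  obtain T :: "'u set" where "finite T" "card T = 3" using infinite_arbitrarily_large[OF inf] by blast
  then obtain i a b :: 'u where d: "i \<noteq> a" "i \<noteq> b" "a \<noteq> b" by (auto simp: card_3_iff)
  have "|UNIV :: ('u \<times> 'u) set| \<le>o |UNIV :: 'u set|"
    using card_of_Times_same_infinite[OF inf] by (simp add: ordIso_imp_ordLeq)
  then obtain k :: "'u \<times> 'u \<Rightarrow> 'u" where "inj k" by (auto simp flip: card_of_ordLeq)
  then interpret twins i a b k using d by unfold_locales auto
  have X: "X \<in> small_moncats" by (rule small_X[OF u])
  obtain Y where Y: "Y \<in> small_moncats" "strict_monoidal Y" and "is_retract_of MonCat_p X Y"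
    by (rule retract_of_strict[OF u X])
  then obtain s r where s: "s \<in> mftors" "fdom s = X" "fcod s = Y" and r: "r \<in> mftors" "fdom r = Y" "fcod r = X"
    and rs: "mftor_comp r s = mftor_id X"
    by (auto simp: is_retract_of_def mor_MonCat MonCat_simps)
  let ?e = "mftor_comp s r"
  have e: "?e \<in> mftors" "fdom ?e = Y" "fcod ?e = Y" using s r by (simp_all add: mftor_comp_in mftor_comp_simps)
  have "mftor_comp ?e ?e = mftor_comp s (mftor_comp (mftor_comp r s) r)"
    using s r by (simp add: mftor_comp_assoc mftor_comp_in mftor_comp_simps)
  also have "\<dots> = ?e" unfolding rs using mftor_id_comp[OF r(1)] r by simp
  finally have idem: "cmp SMonCat_p ?e ?e = ?e" by (simp add: SMonCat_simps)
  have "Y \<in> Obj0 SMonCat_p" "?e \<in> mor SMonCat_p Y Y" using Y e by (simp_all add: SMonCat_simps mor_MonCat)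
  with split idem obtain B r' s' where "B \<in> Obj0 SMonCat_p" "r' \<in> mor SMonCat_p Y B" "s' \<in> mor SMonCat_p B Y"
    "?e = cmp SMonCat_p s' r'" "cmp SMonCat_p r' s' = one SMonCat_p B"
    unfolding idempotents_split_def by blast
  then have B: "B \<in> small_moncats" "strict_monoidal B"
    and r': "r' \<in> mftors" "fdom r' = Y" "fcod r' = B" and s': "s' \<in> mftors" "fdom s' = B" "fcod s' = Y"
    and e': "mftor_comp s r = mftor_comp s' r'" and rs': "mftor_comp r' s' = mftor_id B"
    by (simp_all only: SMonCat_simps mor_MonCat mem_Collect_eq simp_thms)
  let ?F = "mftor_comp r' s" and ?G = "mftor_comp r s'"
  have F: "?F \<in> mftors" "fdom ?F = X" "fcod ?F = B" and G: "?G \<in> mftors" "fdom ?G = B" "fcod ?G = X"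
    using s r s' r' by (simp_all add: mftor_comp_in mftor_comp_simps)
  have "mftor_comp ?G ?F = mftor_comp r (mftor_comp (mftor_comp s' r') s)"
    using s r s' r' by (simp add: mftor_comp_assoc mftor_comp_in mftor_comp_simps)
  also have "\<dots> = mftor_comp (mftor_comp r s) (mftor_comp r s)"
    unfolding e'[symmetric] using s r by (simp add: mftor_comp_assoc mftor_comp_in mftor_comp_simps)
  also have "\<dots> = mftor_id X" unfolding rs using mftor_id_comp[OF mftor_id_in[OF X]] by (simp add: mftor_id_simps)
  finally have GF: "mftor_comp ?G ?F = mftor_id X" .
  have "mftor_comp ?F ?G = mftor_comp r' (mftor_comp (mftor_comp s r) s')"
    using s r s' r' by (simp add: mftor_comp_assoc mftor_comp_in mftor_comp_simps)
  also have "\<dots> = mftor_comp (mftor_comp r' s') (mftor_comp r' s')"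
    unfolding e' using s' r' by (simp add: mftor_comp_assoc mftor_comp_in mftor_comp_simps)
  also have "\<dots> = mftor_id B" unfolding rs' using mftor_id_comp[OF mftor_id_in[OF B(1)]] by (simp add: mftor_id_simps)
  finally have FG: "mftor_comp ?F ?G = mftor_id B" .
  show False by (rule not_iso_strict[OF F G GF FG B(2)])
qed

section \<open>Filtered colimits split idempotents\<close>

definition free_idempotent :: "'u \<Rightarrow> 'u \<Rightarrow> ('u, 'u) cat" where
  "free_idempotent i d = \<lparr>Obj = {i}, Arr = {i, d}, Dom = (\<lambda>_. i), Cod = (\<lambda>_. i), Idt = (\<lambda>_. i),
     Comp = (\<lambda>g f. if g = i then f else d)\<rparr>"

text \<open>
  For every diagram the family constant at the idempotent \<open>d\<close> is a cocone, because \<open>d\<close> absorbs every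
  arrow; hence the category is filtered for every cardinal.
\<close>

lemma small_filtered_free_idempotent:
  fixes i d :: 'u
  assumes "infinite (UNIV :: 'u set)" "i \<noteq> d"
  shows "small_filtered_category \<kappa> (free_idempotent i d)"
proof -
  have "category (free_idempotent i d)"
    by unfold_locales (auto simp: free_idempotent_def Hom_def)
  moreover have "|{i}| <o |UNIV :: 'u set|" "|{i, d}| <o |UNIV :: 'u set|"
    using assms(1) by (simp_all add: finite_card_less_infinite)
  moreover have "\<exists>j \<in> Obj (free_idempotent i d). \<exists>q. (\<forall>x \<in> Obj K. q x \<in> Hom (free_idempotent i d) (F0 x) j) \<and>
        (\<forall>u \<in> Arr K. Comp (free_idempotent i d) (q (Cod K u)) (F1 u) = q (Dom K u))"
    if "is_functor K (free_idempotent i d) F0 F1" for K :: "('u, 'u) cat" and F0 F1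
    using functorD(1)[OF that] assms(2)
    by (intro bexI[of _ i] exI[of _ "\<lambda>_. d"]) (auto simp: free_idempotent_def Hom_def)
  ultimately show ?thesis
    by (auto simp: small_filtered_category_def small_category_def small_set_def free_idempotent_def)
qed

text \<open>
  A cocone under the diagram given by \<open>e\<close> is a map \<open>h\<close> with \<open>h e = h\<close>. If \<open>q\<close> is the universal one, then
  \<open>e\<close> factors as \<open>s q\<close>; and \<open>q s q = q e = q\<close> gives \<open>q s = 1\<close> by uniqueness of factorizations.
\<close>

theorem filtered_colimits_split_idempotents:
  fixes C :: "('o, 'm, 'c) twocat" and \<kappa> :: "'u rel"
  assumes C: "two_category C" and inf: "infinite (UNIV :: 'u set)" and col: "has_filtered_colimits \<kappa> C"
  shows "idempotents_split C"
  unfolding idempotents_split_def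
proof (intro ballI impI)
  fix A e assume A: "A \<in> Obj0 C" and e: "e \<in> mor C A A" and idem: "cmp C e e = e"
  interpret two_category C by fact
  interpret U: category "underlying C" by (rule category_underlying)
  have U: "Hom (underlying C) = mor C" "Obj (underlying C) = Obj0 C" "Idt (underlying C) = one C"
    "Comp (underlying C) = cmp C" "Arr (underlying C) = Mor C"
    by (auto simp: underlying_def Hom_def mor_def fun_eq_iff)
  note comp_in = U.Comp_in[unfolded U] and comp_id = U.Comp_Id[unfolded U] and id_comp = U.Id_Comp[unfolded U]
    and comp_assoc = U.Comp_assoc[unfolded U] and id_in = U.Id_in[unfolded U]
  obtain i d :: 'u where id: "i \<noteq> d"
    using inf by (metis (full_types) UNIV_I finite.emptyI finite_insert finite_subset insertCI subsetI)
  let ?J = "free_idempotent i d" and ?D0 = "\<lambda>_ :: 'u. A" and ?D1 = "\<lambda>u. if u = i then one C A else e"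
  have J: "Obj ?J = {i}" "Arr ?J = {i, d}" "Dom ?J = (\<lambda>_. i)" "Cod ?J = (\<lambda>_. i)"
    by (simp_all add: free_idempotent_def)
  have D: "is_functor ?J (underlying C) ?D0 ?D1"
    using A e idem id id_in[OF A] comp_id[OF id_in[OF A]] comp_id[OF e] id_comp[OF e]
    by (auto simp: is_functor_def free_idempotent_def U)
  then obtain L p where L: "is_colimit C ?J ?D0 ?D1 L p"
    using col small_filtered_free_idempotent[OF inf id, of \<kappa>] unfolding has_filtered_colimits_def by blast
  define q where "q = p i"
  have LO: "L \<in> Obj0 C" and q: "q \<in> mor C A L" and qe: "cmp C q e = q"
    using L id unfolding is_colimit_def q_def J by auto
  have lim: "bij_betw (\<lambda>x. \<lambda>j \<in> {i}. cmp C x (p j)) (mor C L Y)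
      (matching_families ?J (\<lambda>j. mor C A Y) (\<lambda>u h. cmp C h (?D1 u)))" if "Y \<in> Obj0 C" for Y
    using L that unfolding is_colimit_def is_limit_def by (simp add: hom_def J)
  have inj: "x = y" if "Y \<in> Obj0 C" "x \<in> mor C L Y" "y \<in> mor C L Y" "cmp C x q = cmp C y q" for x y Y
  proof -
    have "(\<lambda>j \<in> {i}. cmp C x (p j)) = (\<lambda>j \<in> {i}. cmp C y (p j))"
      using that(4) by (intro restrict_ext) (simp add: q_def)
    then show ?thesis using bij_betw_imp_inj_on[OF lim[OF that(1)]] that(2,3) by (auto dest: inj_onD)
  qed
  have ex: "\<exists>x \<in> mor C L Y. cmp C x q = h" if Y: "Y \<in> Obj0 C" and h: "h \<in> mor C A Y" "cmp C h e = h" for h Y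
  proof -
    have "(\<lambda>j \<in> {i}. h) \<in> matching_families ?J (\<lambda>j. mor C A Y) (\<lambda>u h. cmp C h (?D1 u))"
      using h comp_id[OF h(1)] by (auto simp: matching_families_def J)
    then obtain x where x: "x \<in> mor C L Y" "(\<lambda>j \<in> {i}. h) = (\<lambda>j \<in> {i}. cmp C x (p j))"
      using bij_betw_imp_surj_on[OF lim[OF Y], symmetric] by (auto simp: image_iff)
    have "cmp C x q = h" using fun_cong[OF x(2), of i] by (simp add: q_def)
    then show ?thesis using x(1) by blast
  qed
  obtain s where s: "s \<in> mor C L A" "cmp C s q = e" using ex[OF A e idem] by blast
  have "cmp C (cmp C q s) q = cmp C (one C L) q"
    using comp_assoc[OF q s(1) q] s(2) qe id_comp[OF q] by simp
  then have "cmp C q s = one C L"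
    by (rule inj[OF LO comp_in[OF s(1) q] id_in[OF LO]])
  then show "\<exists>B \<in> Obj0 C. \<exists>r \<in> mor C A B. \<exists>s \<in> mor C B A. e = cmp C s r \<and> cmp C r s = one C B"
    using LO q s by blast
qed

section \<open>The idempotent completion\<close>

lemma full_sub_Obj0:
  assumes "two_category C" shows "full_sub C (Obj0 (full_sub C S)) = full_sub C S"
proof -
  interpret two_category C by fact
  have f: "src C f \<in> Obj0 C" "trg C f \<in> Obj0 C" if "f \<in> Mor C" for f
    using category.Dom_in[OF category_underlying] category.Cod_in[OF category_underlying] that
    by (simp_all add: underlying_def)
  have "cdom C \<alpha> \<in> Mor C" if "\<alpha> \<in> Cell C" for \<alpha>
    using Cell_hom[OF that] by (auto simp: hom_def mor_def)
  with f have "{\<alpha> \<in> Cell C. src C (cdom C \<alpha>) \<in> Obj0 C \<inter> S \<and> trg C (cdom C \<alpha>) \<in> Obj0 C \<inter> S} =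
      {\<alpha> \<in> Cell C. src C (cdom C \<alpha>) \<in> S \<and> trg C (cdom C \<alpha>) \<in> S}"
    by blast
  moreover from f have "{f \<in> Mor C. src C f \<in> Obj0 C \<inter> S \<and> trg C f \<in> Obj0 C \<inter> S} =
      {f \<in> Mor C. src C f \<in> S \<and> trg C f \<in> S}" by blast
  moreover have "Obj0 (full_sub C S) = Obj0 C \<inter> S" by (simp add: full_sub_def)
  ultimately show ?thesis by (simp only: full_sub_def Int_assoc[symmetric] Int_absorb)
qed

theorem mainTheorem9:
  assumes "uncountable (UNIV :: 'u set)"
  shows "\<not> idempotents_split (SMonCat_p :: (('u, 'u) moncat, 'u mftor, 'u mntr) twocat) \<and>
    \<not> accessible TYPE('u) (SMonCat_p :: (('u, 'u) moncat, 'u mftor, 'u mntr) twocat) \<and>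
    exhibits_idempotent_completion
      (SMonCat_p :: (('u, 'u) moncat, 'u mftor, 'u mntr) twocat) MonCat_p"
proof (intro conjI)
  let ?S = "SMonCat_p :: (('u, 'u) moncat, 'u mftor, 'u mntr) twocat"
  have inf: "infinite (UNIV :: 'u set)" using assms countable_finite by blast
  show no_split: "\<not> idempotents_split ?S" by (rule idempotents_do_not_split_SMonCat_p[OF assms])
  show "\<not> accessible TYPE('u) ?S"
    using no_split filtered_colimits_split_idempotents[OF two_category_SMonCat_p inf]
    unfolding accessible_def lambda_accessible_def by blast
  have "\<exists>Y \<in> Obj0 ?S. is_retract_of MonCat_p X Y" if X: "X \<in> Obj0 MonCat_p" for X :: "('u, 'u) moncat"
  proof -
    have "X \<in> small_moncats" using X by (simp add: MonCat_simps)
    then obtain Y where "Y \<in> small_moncats" "strict_monoidal Y" "is_retract_of MonCat_p X Y"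
      by (rule retract_of_strict[OF assms])
    then show ?thesis by (auto simp: SMonCat_simps)
  qed
  then show "exhibits_idempotent_completion ?S MonCat_p"
    unfolding exhibits_idempotent_completion_def
    using full_sub_Obj0[OF two_category_MonCat_p, of "{A. strict_monoidal A}", folded SMonCat_p_def, symmetric]
      idempotents_split_MonCat_p by (auto simp: SMonCat_simps(1) MonCat_simps)
qed

end
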